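(* Let $n\ge 2$ and $p\in(0,1/2]$, and let $\mathcal{F}$ be an odd-linear-dependency-intersecting family of subsets of $\mathbb{Z}_2^n$. Then $\mu_p(\mathcal{F})\le p^3$, with equality if and only if $\mathcal{F}$ is a Schur-umvirate. Moreover, for each $p\in(0,1/2]$ there exists a constant $c_p$, not depending on $n$, with $\sup_{p\in[\delta,1/2]}c_p<\infty$ for every fixed $\delta>0$, such that for any $\epsilon>0$, if $\mu_p(\mathcal{F})\ge p^3-\epsilon$ then there exists a Schur-umvirate $\mathcal{T}$ with $\mu_p(\mathcal{T}\,\Delta\,\mathcal{F})\le c_p\epsilon$. For $p=1/2$, the corresponding statements hold for odd-linear-dependency-agreeing families, with Schur-umvirates replaced by Schur juntas: if $\mathcal{F}$ is odd-linear-dependency-agreeing then $\mu_{1/2}(\mathcal{F})\le 1/8$, with equality iff $\mathcal{F}$ is a Schur junta, and if $\mu_{1/2}(\mathcal{F})\ge 1/8-\epsilon$ then $\mu_{1/2}(\mathcal{T}\,\Delta\,\mathcal{F})\le c_{1/2}\epsilon$ for some Schur junta $\mathcal{T}$.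
   Context: A family $\mathcal{F}$ of subsets of $\mathbb{Z}_2^n$ is odd-linear-dependency-intersecting if for any $S,T\in\mathcal{F}$ there exist $l\in\mathbb{N}$ and non-zero vectors $v_1,\dots,v_{2l+1}\in S\cap T$ with $v_1+\dots+v_{2l+1}=0$; it is odd-linear-dependency-agreeing if the same holds with $\overline{S\Delta T}$ (complement of the symmetric difference, in $\mathbb{Z}_2^n$) in place of $S\cap T$. For $p\in[0,1]$, $\mu_p(S)=p^{|S|}(1-p)^{2^n-|S|}$ for $S\subseteq\mathbb{Z}_2^n$ and $\mu_p(\mathcal{F})=\sum_{S\in\mathcal{F}}\mu_p(S)$. A Schur triple is a set $\{x,y,x+y\}$ of three distinct non-zero vectors. A Schur-umvirate is the family of all subsets of $\mathbb{Z}_2^n$ containing a fixed Schur triple; a Schur junta is the family of all subsets of $\mathbb{Z}_2^n$ with a prescribed intersection with a fixed Schur triple. *)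

theory Defs
  imports Complex_Main "HOL-Library.Z2" "HOL-Library.Function_Algebras" "HOL-Library.FuncSet"
begin

text \<open>
  Since the constant in the stability statement must not depend on \<open>n\<close>, the dimension has to be
  quantified inside the statement. Vectors are therefore sequences of bits supported on the first
  \<open>n\<close> coordinates, with the pointwise addition of \<^theory>\<open>HOL-Library.Function_Algebras\<close>.
\<close>

type_synonym vec2 = "nat \<Rightarrow> bit"

definition Z2n :: "nat \<Rightarrow> vec2 set" where
  "Z2n n = {v. \<forall>i\<ge>n. v i = 0}"

text \<open>The vectors in a linear dependency need not be distinct.\<close>

definition has_odd_linear_dependency :: "vec2 set \<Rightarrow> bool" where
  "has_odd_linear_dependency A \<longleftrightarrow>
     (\<exists>(l::nat) (v::nat \<Rightarrow> vec2).
        (\<forall>i\<in>{1..2 * l + 1}. v i \<in> A \<and> v i \<noteq> 0) \<and> (\<Sum>i = 1..2 * l + 1. v i) = 0)"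

definition odd_linear_dependency_intersecting :: "nat \<Rightarrow> vec2 set set \<Rightarrow> bool" where
  "odd_linear_dependency_intersecting n F \<longleftrightarrow>
     F \<subseteq> Pow (Z2n n) \<and> (\<forall>S\<in>F. \<forall>T\<in>F. has_odd_linear_dependency (S \<inter> T))"

definition odd_linear_dependency_agreeing :: "nat \<Rightarrow> vec2 set set \<Rightarrow> bool" where
  "odd_linear_dependency_agreeing n F \<longleftrightarrow>
     F \<subseteq> Pow (Z2n n) \<and> (\<forall>S\<in>F. \<forall>T\<in>F. has_odd_linear_dependency (Z2n n - sym_diff S T))"

definition mu_set :: "nat \<Rightarrow> real \<Rightarrow> vec2 set \<Rightarrow> real" where
  "mu_set n p S = p ^ card S * (1 - p) ^ (2 ^ n - card S)"

definition mu :: "nat \<Rightarrow> real \<Rightarrow> vec2 set set \<Rightarrow> real" where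
  "mu n p F = (\<Sum>S\<in>F. mu_set n p S)"

definition schur_triple :: "nat \<Rightarrow> vec2 set \<Rightarrow> bool" where
  "schur_triple n X \<longleftrightarrow>
     (\<exists>x\<in>Z2n n. \<exists>y\<in>Z2n n. X = {x, y, x + y} \<and> distinct [x, y, x + y] \<and> 0 \<notin> X)"

definition schur_umvirate :: "nat \<Rightarrow> vec2 set set \<Rightarrow> bool" where
  "schur_umvirate n F \<longleftrightarrow> (\<exists>X. schur_triple n X \<and> F = {S. S \<subseteq> Z2n n \<and> X \<subseteq> S})"

definition schur_junta :: "nat \<Rightarrow> vec2 set set \<Rightarrow> bool" where
  "schur_junta n F \<longleftrightarrow>
     (\<exists>X B. schur_triple n X \<and> B \<subseteq> X \<and> F = {S. S \<subseteq> Z2n n \<and> S \<inter> X = B})"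

text \<open>
  The next lemmas show that the truncated subtraction in \<^const>\<open>mu_set\<close> is harmless and that
  \<^const>\<open>mu\<close> only ever sums over finite families.
\<close>

lemma bij_betw_Z2n: "bij_betw (\<lambda>v. restrict v {..<n}) (Z2n n) ({..<n} \<rightarrow>\<^sub>E UNIV)"
proof (rule bij_betwI[where g = "\<lambda>w i. if i < n then w i else 0"])
  show "(\<lambda>v. restrict v {..<n}) \<in> Z2n n \<rightarrow> ({..<n} \<rightarrow>\<^sub>E UNIV)" by auto
  show "(\<lambda>w i. if i < n then w i else 0) \<in> ({..<n} \<rightarrow>\<^sub>E UNIV) \<rightarrow> Z2n n"
    by (auto simp: Z2n_def)
  show "(\<lambda>i. if i < n then restrict v {..<n} i else 0) = v" if "v \<in> Z2n n" for v
    using that by (auto simp: Z2n_def fun_eq_iff)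
  show "restrict (\<lambda>i. if i < n then w i else 0) {..<n} = w"
    if "w \<in> {..<n} \<rightarrow>\<^sub>E UNIV" for w :: vec2
  proof
    show "restrict (\<lambda>i. if i < n then w i else 0) {..<n} i = w i" for i
      using PiE_arb[OF that, of i] by (cases "i < n") simp_all
  qed
qed

lemma UNIV_bit: "(UNIV :: bit set) = {0, 1}"
  by (rule UNIV_eq_I) (metis bit_not_one_iff insertCI)

lemma finite_Z2n: "finite (Z2n n)"
proof -
  have "finite ({..<n} \<rightarrow>\<^sub>E (UNIV :: bit set))"
    by (intro finite_PiE) (auto simp: UNIV_bit)
  then show ?thesis
    using bij_betw_finite[OF bij_betw_Z2n] by blast
qed

lemma card_Z2n: "card (Z2n n) = 2 ^ n"
  using bij_betw_same_card[OF bij_betw_Z2n, of n] by (simp add: card_PiE UNIV_bit numeral_2_eq_2)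

lemma card_le_if_subset_Z2n: "S \<subseteq> Z2n n \<Longrightarrow> card S \<le> 2 ^ n"
  using card_mono[OF finite_Z2n] by (metis card_Z2n)

lemma finite_family_Z2n: "F \<subseteq> Pow (Z2n n) \<Longrightarrow> finite F"
  using finite_Z2n finite_subset by blast

end

theory Submission
  imports Defs "HOL-Analysis.Convex"
begin

text \<open>
  A set contained in \<open>{v. a \<bullet> v = 1} \<union> {0}\<close> has no odd linear dependency. Hence, for an agreeing
  family with indicator \<open>f\<close> and Fourier coefficients \<open>c\<^sub>R\<close>, every weight on the traces
  \<open>R \<inter> {v. a \<bullet> v = 1}\<close>, averaged over \<open>a\<close> and multiplied by \<open>(-1)\<close> to the power \<open>card R\<close>, yields
  eigenvalues \<open>\<lambda>\<^sub>R\<close> with \<open>\<Sum>\<^sub>R \<lambda>\<^sub>R c\<^sub>R\<^sup>2 = 0\<close>. A suitable weight has \<open>\<lambda> = 1\<close> at the empty set, minimum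
  \<open>-1/7\<close>, and a spectral gap outside the singletons, pairs and Schur triples. Hoffman's bound then
  gives \<open>1/8\<close> and shows that a near-extremal \<open>f\<close> is almost a cubic polynomial.

  For a Boolean \<open>f\<close> that is almost cubic, hypercontractivity makes the influence of every set of
  coordinates either negligible or bounded below. So \<open>f\<close> almost depends on boundedly many
  coordinates, some Schur triple carries Fourier mass close to \<open>1/64\<close>, and applying the dichotomy
  to its complement makes \<open>f\<close> linearly close to a junta on that triple.

  For \<open>p < 1/2\<close>, write \<open>p = (1/2)\<^sup>t\<close>; an increasing family of \<open>1/2\<close>-biased measure \<open>m\<close> has \<open>p\<close>-biased
  measure at most \<open>m\<^sup>t\<close>. Applied to the up-closure of an intersecting family, and to the union of
  this up-closure with an umvirate, this transfers both the bound and stability.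
\<close>

subsection \<open>Fourier analysis on a finite cube\<close>

text \<open>The vanishing behind the proof is finer than one eigenvalue identity. The set on which
  two members of the family agree never lies inside a \<open>cut a\<close>, so \<open>f\<close> is
  orthogonal to its shifts by complements of subsets of \<open>cut a\<close>. Fourier inversion over
  these subsets shows that the signed masses (-1)^|R| c_R^2 sum to zero over every class of sets R
  with a prescribed trace. Averaged with weights, this is Hoffman's bound; taken class by class, it
  relates the coefficients of a Schur triple, its pairs and its points.

  Two obstacles shape the stability part: no constant may depend on n, and the loss must be linear
  in \<epsilon>. Rounding a coefficient to a multiple of 1/8 only controls the error up to the
  square root of the defect; the influence dichotomy then upgrades "small" to "at most twice the
  defect". It removes the dimension in the same way, since adjoining uninfluential coordinates one
  by one accumulates no error.

  Equality is read off from stability: an estimate linear in \<epsilon> and valid for every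
  \<epsilon> leaves no room for a nonempty symmetric difference.\<close>

definition walsh :: "'a set \<Rightarrow> 'a set \<Rightarrow> real" where
  "walsh R S = (-1) ^ card (R \<inter> S)"

definition expect :: "'a set \<Rightarrow> ('a set \<Rightarrow> real) \<Rightarrow> real" where
  "expect V f = (\<Sum>S\<in>Pow V. f S) / 2 ^ card V"

definition fourier :: "'a set \<Rightarrow> ('a set \<Rightarrow> real) \<Rightarrow> 'a set \<Rightarrow> real" where
  "fourier V f R = expect V (\<lambda>S. f S * walsh R S)"

definition walsh_sum :: "'a set \<Rightarrow> ('a set \<Rightarrow> real) \<Rightarrow> 'a set \<Rightarrow> real" where
  "walsh_sum V c S = (\<Sum>R\<in>Pow V. c R * walsh R S)"

lemma walsh_commute: "walsh R S = walsh S R"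
  by (simp add: walsh_def Int_commute)

lemma walsh_empty [simp]: "walsh {} S = 1" "walsh R {} = 1"
  by (simp_all add: walsh_def)

lemma walsh_cases: "walsh R S = 1 \<or> walsh R S = -1"
  unfolding walsh_def by (cases "even (card (R \<inter> S))") auto

lemma walsh_square [simp]: "walsh R S * walsh R S = 1"
  using walsh_cases[of R S] by auto

lemma walsh_in_Ints: "walsh R S \<in> \<int>"
  by (simp add: walsh_def)

lemma even_card_sym_diff:
  assumes "finite A" "finite B"
  shows "even (card (sym_diff A B)) \<longleftrightarrow> (even (card A) \<longleftrightarrow> even (card B))"
proof -
  have "card A = card (A - B) + card (A \<inter> B)" "card B = card (B - A) + card (A \<inter> B)"
    using assms by (metis card_Diff_subset_Int card_Int_Diff inf_commute add.commute)+
  moreover have "card (sym_diff A B) = card (A - B) + card (B - A)"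
    using assms by (intro card_Un_disjoint) auto
  ultimately show ?thesis by auto
qed

lemma walsh_sym_diff:
  assumes "finite R"
  shows "walsh R (sym_diff S T) = walsh R S * walsh R T"
proof -
  have "R \<inter> sym_diff S T = sym_diff (R \<inter> S) (R \<inter> T)" by auto
  then have "even (card (R \<inter> sym_diff S T)) \<longleftrightarrow> (even (card (R \<inter> S)) \<longleftrightarrow> even (card (R \<inter> T)))"
    using even_card_sym_diff[of "R \<inter> S" "R \<inter> T"] assms by simp
  then show ?thesis
    unfolding walsh_def by (auto simp: minus_one_power_iff)
qed

lemma walsh_sym_diff_left:
  assumes "finite S"
  shows "walsh (sym_diff Q R) S = walsh Q S * walsh R S"
  using walsh_sym_diff[OF assms, of Q R] by (simp add: walsh_commute)

lemma bij_betw_sym_diff_Pow: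
  assumes "U \<subseteq> V"
  shows "bij_betw (\<lambda>S. sym_diff S U) (Pow V) (Pow V)"
  by (rule bij_betwI[where g = "\<lambda>S. sym_diff S U"]) (use assms in auto)

lemma sum_Pow_sym_diff:
  assumes "U \<subseteq> V"
  shows "(\<Sum>S\<in>Pow V. f (sym_diff S U)) = (\<Sum>S\<in>Pow V. f S)"
  using sum.reindex_bij_betw[OF bij_betw_sym_diff_Pow[OF assms]] .

lemma sum_walsh:
  assumes "finite V"
  shows "(\<Sum>S\<in>Pow V. walsh R S) = (if R \<inter> V = {} then 2 ^ card V else 0)"
proof (cases "R \<inter> V = {}")
  case True
  then have "walsh R S = 1" if "S \<in> Pow V" for S
    using that unfolding walsh_def by (metis Int_mono Pow_iff card.empty order_refl power_0 subset_empty)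
  then show ?thesis using True assms by (simp add: card_Pow)
next
  case False
  then obtain x where x: "x \<in> R" "x \<in> V" by auto
  have neg: "walsh R (sym_diff S {x}) = - walsh R S" if "S \<in> Pow V" for S
  proof -
    have "finite S" using that assms finite_subset by auto
    \<comment> \<open>\<open>R\<close> may be infinite while \<open>walsh_sym_diff\<close> wants a
      finite set, so \<open>R\<close> is cut down to \<open>S \<union> {x}\<close>, which changes
      neither sign.\<close>
    then have "walsh R (sym_diff S {x}) = walsh (R \<inter> (S \<union> {x})) (sym_diff S {x})"
      and "walsh R S = walsh (R \<inter> (S \<union> {x})) S"
      by (auto simp: walsh_def intro!: arg_cong[where f = "\<lambda>X. (-1) ^ card X"])
    moreover have "walsh (R \<inter> (S \<union> {x})) {x} = -1"
      using x by (simp add: walsh_def Int_absorb1 Int_commute)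
    ultimately show ?thesis
      using walsh_sym_diff[of "R \<inter> (S \<union> {x})" S "{x}"] \<open>finite S\<close> by simp
  qed
  have "(\<Sum>S\<in>Pow V. walsh R S) = (\<Sum>S\<in>Pow V. walsh R (sym_diff S {x}))"
    using sum_Pow_sym_diff[of "{x}" V "walsh R"] x by simp
  also have "\<dots> = - (\<Sum>S\<in>Pow V. walsh R S)"
    unfolding sum_negf[symmetric] by (rule sum.cong) (use neg in auto)
  finally show ?thesis using False by simp
qed

lemma walsh_orthogonal:
  assumes "finite V" "Q \<subseteq> V" "R \<subseteq> V"
  shows "(\<Sum>S\<in>Pow V. walsh Q S * walsh R S) = (if Q = R then 2 ^ card V else 0)"
proof -
  have "(\<Sum>S\<in>Pow V. walsh Q S * walsh R S) = (\<Sum>S\<in>Pow V. walsh (sym_diff Q R) S)"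
  proof (rule sum.cong)
    fix S assume "S \<in> Pow V"
    then have "finite S" using assms(1) finite_subset by auto
    then show "walsh Q S * walsh R S = walsh (sym_diff Q R) S"
      by (simp add: walsh_sym_diff_left)
  qed simp
  moreover have "sym_diff Q R \<inter> V = {} \<longleftrightarrow> Q = R" using assms by auto
  ultimately show ?thesis using sum_walsh[OF assms(1), of "sym_diff Q R"] by simp
qed

lemma walsh_sum_fourier:
  assumes "finite V" "S \<subseteq> V"
  shows "walsh_sum V (fourier V f) S = f S"
proof -
  have "walsh_sum V (fourier V f) S
      = (\<Sum>R\<in>Pow V. \<Sum>T\<in>Pow V. f T * (walsh T R * walsh S R) / 2 ^ card V)"
    unfolding walsh_sum_def fourier_def expect_def
    by (simp add: sum_divide_distrib sum_distrib_right walsh_commute mult.assoc)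
  also have "\<dots> = (\<Sum>T\<in>Pow V. \<Sum>R\<in>Pow V. f T * (walsh T R * walsh S R) / 2 ^ card V)"
    by (rule sum.swap)
  also have "\<dots> = (\<Sum>T\<in>Pow V. f T * (if T = S then 1 else 0))"
    by (rule sum.cong)
      (use assms in \<open>auto simp: walsh_orthogonal sum_distrib_left[symmetric] sum_divide_distrib[symmetric]\<close>)
  also have "\<dots> = f S"
    using assms by (simp add: if_distrib sum.delta cong: if_cong)
  finally show ?thesis .
qed

lemma expect_walsh_sum_mult:
  assumes "finite V"
  shows "expect V (\<lambda>S. walsh_sum V c S * walsh_sum V d S) = (\<Sum>R\<in>Pow V. c R * d R)"
proof -
  have "(\<Sum>S\<in>Pow V. walsh_sum V c S * walsh_sum V d S)
     = (\<Sum>S\<in>Pow V. \<Sum>Q\<in>Pow V. \<Sum>R\<in>Pow V. c Q * d R * (walsh Q S * walsh R S))"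
    unfolding walsh_sum_def by (simp add: sum_product mult.assoc mult.left_commute)
  also have "\<dots> = (\<Sum>Q\<in>Pow V. \<Sum>S\<in>Pow V. \<Sum>R\<in>Pow V. c Q * d R * (walsh Q S * walsh R S))"
    by (rule sum.swap)
  also have "\<dots> = (\<Sum>Q\<in>Pow V. \<Sum>R\<in>Pow V. \<Sum>S\<in>Pow V. c Q * d R * (walsh Q S * walsh R S))"
    by (intro sum.cong refl sum.swap)
  also have "\<dots> = (\<Sum>Q\<in>Pow V. \<Sum>R\<in>Pow V. if Q = R then c Q * d R * 2 ^ card V else 0)"
    by (intro sum.cong refl)
      (use assms in \<open>auto simp: walsh_orthogonal sum_distrib_left[symmetric]\<close>)
  also have "\<dots> = (\<Sum>R\<in>Pow V. c R * d R) * 2 ^ card V"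
    using assms by (simp add: sum_distrib_right)
  finally show ?thesis by (simp add: expect_def)
qed

lemma expect_mult_walsh_sum:
  assumes "finite V"
  shows "expect V (\<lambda>S. f S * walsh_sum V d S) = (\<Sum>R\<in>Pow V. fourier V f R * d R)"
proof -
  have "expect V (\<lambda>S. f S * walsh_sum V d S)
      = expect V (\<lambda>S. walsh_sum V (fourier V f) S * walsh_sum V d S)"
    unfolding expect_def using assms by (simp add: walsh_sum_fourier)
  then show ?thesis using expect_walsh_sum_mult[OF assms] by simp
qed

lemma parseval:
  assumes "finite V"
  shows "expect V (\<lambda>S. f S * g S) = (\<Sum>R\<in>Pow V. fourier V f R * fourier V g R)"
proof -
  have "expect V (\<lambda>S. f S * g S) = expect V (\<lambda>S. f S * walsh_sum V (fourier V g) S)"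
    unfolding expect_def using assms by (simp add: walsh_sum_fourier)
  then show ?thesis using expect_mult_walsh_sum[OF assms] by simp
qed

lemma fourier_shift:
  assumes "finite V" "U \<subseteq> V" "R \<subseteq> V"
  shows "fourier V (\<lambda>S. f (sym_diff S U)) R = walsh R U * fourier V f R"
proof -
  have "(\<Sum>S\<in>Pow V. f (sym_diff S U) * walsh R S)
      = (\<Sum>S\<in>Pow V. f (sym_diff S U) * walsh R (sym_diff (sym_diff S U) U))"
  proof (rule sum.cong)
    fix S have "sym_diff (sym_diff S U) U = S" by auto
    then show "f (sym_diff S U) * walsh R S = f (sym_diff S U) * walsh R (sym_diff (sym_diff S U) U)"
      by simp
  qed simp
  also have "\<dots> = (\<Sum>S\<in>Pow V. f S * walsh R (sym_diff S U))"
    by (rule sum_Pow_sym_diff[OF assms(2), of "\<lambda>S. f S * walsh R (sym_diff S U)"])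
  also have "\<dots> = walsh R U * (\<Sum>S\<in>Pow V. f S * walsh R S)"
    using assms finite_subset[of R V] by (simp add: walsh_sym_diff sum_distrib_left mult_ac)
  finally show ?thesis by (simp add: fourier_def expect_def)
qed

lemma expect_diff: "expect V (\<lambda>S. f S - g S) = expect V f - expect V g"
  by (simp add: expect_def sum_subtractf diff_divide_distrib)

lemma expect_add: "expect V (\<lambda>S. f S + g S) = expect V f + expect V g"
  by (simp add: expect_def sum.distrib add_divide_distrib)

lemma expect_cmult: "expect V (\<lambda>S. c * f S) = c * expect V f"
  by (simp add: expect_def sum_distrib_left)

lemma expect_mono: "(\<And>S. S \<subseteq> V \<Longrightarrow> f S \<le> g S) \<Longrightarrow> expect V f \<le> expect V g"
  unfolding expect_def by (intro divide_right_mono sum_mono) auto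

lemma expect_cong: "(\<And>S. S \<subseteq> V \<Longrightarrow> f S = g S) \<Longrightarrow> expect V f = expect V g"
  unfolding expect_def by (intro arg_cong2[where f = "(/)"] sum.cong) auto

lemma expect_const: "finite V \<Longrightarrow> expect V (\<lambda>S. c) = c"
  by (simp add: expect_def card_Pow)

lemma expect_nonneg: "(\<And>S. S \<subseteq> V \<Longrightarrow> 0 \<le> f S) \<Longrightarrow> 0 \<le> expect V f"
  unfolding expect_def by (intro divide_nonneg_nonneg sum_nonneg) auto

lemma expect_Cauchy_Schwarz:
  "(expect V (\<lambda>S. f S * g S))\<^sup>2 \<le> expect V (\<lambda>S. (f S)\<^sup>2) * expect V (\<lambda>S. (g S)\<^sup>2)"
proof -
  have "(\<Sum>S\<in>Pow V. f S * g S)\<^sup>2 \<le> (\<Sum>S\<in>Pow V. (f S)\<^sup>2) * (\<Sum>S\<in>Pow V. (g S)\<^sup>2)"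
    by (rule Cauchy_Schwarz_ineq_sum)
  then show ?thesis
    unfolding expect_def by (simp add: power_divide field_simps power2_eq_square)
qed

lemma fourier_empty: "fourier V f {} = expect V f"
  by (simp add: fourier_def)

subsection \<open>Hypercontractivity for polynomials of bounded degree\<close>

lemma sum_Pow_insert:
  assumes "finite V" "x \<notin> V"
  shows "(\<Sum>S\<in>Pow (insert x V). f S) = (\<Sum>S\<in>Pow V. f S + f (insert x S))"
proof -
  have "inj_on (insert x) (Pow V)" using assms by (auto simp: inj_on_def)
  moreover have "Pow V \<inter> insert x ` Pow V = {}" using assms by auto
  ultimately show ?thesis
    using assms by (simp add: Pow_insert sum.union_disjoint sum.reindex sum.distrib)
qed

lemma walsh_sum_insert:
  assumes "finite V" "x \<notin> V" "S \<subseteq> V"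
  shows "walsh_sum (insert x V) c S = walsh_sum V c S + walsh_sum V (\<lambda>R. c (insert x R)) S"
    and "walsh_sum (insert x V) c (insert x S) = walsh_sum V c S - walsh_sum V (\<lambda>R. c (insert x R)) S"
proof -
  have w: "walsh (insert x R) S = walsh R S" "walsh R (insert x S) = walsh R S"
    "walsh (insert x R) (insert x S) = - walsh R S" if "R \<in> Pow V" for R
  proof -
    have "x \<notin> S" "x \<notin> R" "finite R" using assms that finite_subset by auto
    then show "walsh (insert x R) S = walsh R S" "walsh R (insert x S) = walsh R S"
      "walsh (insert x R) (insert x S) = - walsh R S"
      by (simp_all add: walsh_def)
  qed
  show "walsh_sum (insert x V) c S = walsh_sum V c S + walsh_sum V (\<lambda>R. c (insert x R)) S"
    unfolding walsh_sum_def sum_Pow_insert[OF assms(1,2)] using w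
    by (simp add: sum.distrib)
  show "walsh_sum (insert x V) c (insert x S) = walsh_sum V c S - walsh_sum V (\<lambda>R. c (insert x R)) S"
    unfolding walsh_sum_def sum_Pow_insert[OF assms(1,2)] using w
    by (simp add: sum.distrib sum_subtractf)
qed

text \<open>Induction on the ground set: averaging a + b and a - b leaves only even powers, and
  \<open>b\<close> has degree one less. Cauchy-Schwarz bounds the mixed term 6 E a^2 b^2 by 18 *
  9^(d-1) A B, which is exactly the mixed term of 9^d (A + B)^2; this is where the 9 comes
  from.\<close>

theorem bonami_lemma:
  assumes "finite V" "\<And>R. R \<subseteq> V \<Longrightarrow> d < card R \<Longrightarrow> c R = 0"
  shows "expect V (\<lambda>S. walsh_sum V c S ^ 4) \<le> 9 ^ d * (\<Sum>R\<in>Pow V. (c R)\<^sup>2)\<^sup>2"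
  using assms
proof (induction V arbitrary: c d rule: finite_induct)
  case empty
  have "(1::real) * c {} ^ 4 \<le> 9 ^ d * c {} ^ 4"
    by (intro mult_right_mono) auto
  then show ?case by (simp add: expect_def walsh_sum_def)
next
  case (insert x V)
  define a where "a = walsh_sum V c"
  define b where "b = walsh_sum V (\<lambda>R. c (insert x R))"
  define A where "A = (\<Sum>R\<in>Pow V. (c R)\<^sup>2)"
  define B where "B = (\<Sum>R\<in>Pow V. (c (insert x R))\<^sup>2)"
  have "expect (insert x V) (\<lambda>S. walsh_sum (insert x V) c S ^ 4)
      = expect V (\<lambda>S. ((a S + b S) ^ 4 + (a S - b S) ^ 4) / 2)"
  proof -
    have "(\<Sum>S\<in>Pow (insert x V). walsh_sum (insert x V) c S ^ 4)
        = (\<Sum>S\<in>Pow V. (a S + b S) ^ 4 + (a S - b S) ^ 4)"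
      unfolding sum_Pow_insert[OF insert.hyps(1,2)] a_def b_def
      by (rule sum.cong) (use insert.hyps in \<open>auto simp: walsh_sum_insert\<close>)
    then show ?thesis
      using insert.hyps by (simp add: expect_def sum_divide_distrib)
  qed
  also have "\<dots> = expect V (\<lambda>S. a S ^ 4 + 6 * (a S ^ 2 * b S ^ 2) + b S ^ 4)"
    by (rule expect_cong) (simp add: power4_eq_xxxx power2_eq_square algebra_simps)
  also have "\<dots> = expect V (\<lambda>S. a S ^ 4) + 6 * expect V (\<lambda>S. a S ^ 2 * b S ^ 2) + expect V (\<lambda>S. b S ^ 4)"
    by (simp add: expect_add expect_cmult)
  finally have E: "expect (insert x V) (\<lambda>S. walsh_sum (insert x V) c S ^ 4)
     = expect V (\<lambda>S. a S ^ 4) + 6 * expect V (\<lambda>S. a S ^ 2 * b S ^ 2) + expect V (\<lambda>S. b S ^ 4)" .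
  have tot: "(\<Sum>R\<in>Pow (insert x V). (c R)\<^sup>2) = A + B"
    unfolding A_def B_def sum_Pow_insert[OF insert.hyps(1,2)] by (simp add: sum.distrib)
  have nn: "0 \<le> A" "0 \<le> B" by (auto simp: A_def B_def intro: sum_nonneg)
  have Ea: "expect V (\<lambda>S. a S ^ 4) \<le> 9 ^ d * A\<^sup>2"
    unfolding a_def A_def by (rule insert.IH) (use insert.prems in auto)
  show ?case
  proof (cases d)
    case 0
    have "c (insert x R) = 0" if "R \<subseteq> V" for R
      using insert.prems[of "insert x R"] that 0 insert.hyps finite_subset[of R V]
      by (auto simp: card_gt_0_iff)
    then have b0: "B = 0" "\<And>S. b S = 0"
      by (auto simp: B_def b_def walsh_sum_def)
    show ?thesis
      unfolding E tot using Ea b0 by (simp add: expect_def)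
  next
    case (Suc e)
    have "expect V (\<lambda>S. b S ^ 4) \<le> 9 ^ e * B\<^sup>2"
      unfolding b_def B_def
    proof (rule insert.IH)
      fix R assume R: "R \<subseteq> V" "e < card R"
      then have "card (insert x R) = Suc (card R)"
        using insert.hyps finite_subset[of R V] by (subst card_insert_disjoint) auto
      then show "c (insert x R) = 0" using R Suc insert.prems[of "insert x R"] by auto
    qed
    then have Eb: "expect V (\<lambda>S. b S ^ 4) \<le> 9 ^ e * B\<^sup>2" .
    have "(expect V (\<lambda>S. a S ^ 2 * b S ^ 2))\<^sup>2
       \<le> expect V (\<lambda>S. (a S ^ 2)\<^sup>2) * expect V (\<lambda>S. (b S ^ 2)\<^sup>2)"
      by (rule expect_Cauchy_Schwarz)
    also have "\<dots> \<le> (9 ^ d * A\<^sup>2) * (9 ^ e * B\<^sup>2)"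
      using Ea Eb by (intro mult_mono) (auto intro!: expect_nonneg mult_nonneg_nonneg)
    also have "\<dots> = (3 * 9 ^ e * A * B)\<^sup>2"
      by (simp add: Suc power2_eq_square algebra_simps)
    finally have Eab: "expect V (\<lambda>S. a S ^ 2 * b S ^ 2) \<le> 3 * 9 ^ e * A * B"
      by (rule power2_le_imp_le) (use nn in auto)
    have "(9::real) ^ d * A\<^sup>2 + 6 * (3 * 9 ^ e * A * B) + 9 ^ e * B\<^sup>2 \<le> 9 ^ d * (A + B)\<^sup>2"
      using nn by (simp add: Suc power2_eq_square algebra_simps)
    then show ?thesis
      unfolding E tot using Ea Eb Eab by linarith
  qed
qed

subsection \<open>Boolean functions that are almost cubic\<close>

text \<open>By Parseval this is the squared L2 distance of \<open>f\<close> from its average over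
  \<open>L\<close>; for one coordinate it is the usual influence up to a constant factor.\<close>

definition influence :: "'a set \<Rightarrow> ('a set \<Rightarrow> real) \<Rightarrow> 'a set \<Rightarrow> real" where
  "influence V f L = (\<Sum>R\<in>{R. R \<subseteq> V \<and> R \<inter> L \<noteq> {}}. (fourier V f R)\<^sup>2)"

text \<open>The conditional expectation given the coordinates outside \<open>L\<close>, written as
  an average of shifts so that \<open>fourier_shift\<close> computes its coefficients.\<close>

definition average_over :: "'a set \<Rightarrow> ('a set \<Rightarrow> real) \<Rightarrow> 'a set \<Rightarrow> real" where
  "average_over L f S = expect L (\<lambda>U. f (sym_diff S U))"

lemma fourier_sum:
  "fourier V (\<lambda>S. \<Sum>i\<in>I. g i S) R = (\<Sum>i\<in>I. fourier V (g i) R)"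
  by (simp add: fourier_def expect_def sum_distrib_right sum_divide_distrib sum.swap[of _ I])

lemma fourier_cmult: "fourier V (\<lambda>S. a * f S) R = a * fourier V f R"
  by (simp add: fourier_def mult.assoc expect_cmult)

lemma fourier_average_over:
  assumes "finite V" "L \<subseteq> V" "R \<subseteq> V"
  shows "fourier V (average_over L f) R = (if R \<inter> L = {} then fourier V f R else 0)"
proof -
  have fin: "finite L" by (rule finite_subset[OF assms(2,1)])
  have "average_over L f = (\<lambda>S. \<Sum>U\<in>Pow L. inverse (2 ^ card L) * f (sym_diff S U))"
    by (simp add: average_over_def expect_def sum_distrib_left divide_inverse mult.commute fun_eq_iff)
  then have "fourier V (average_over L f) R
      = (\<Sum>U\<in>Pow L. inverse (2 ^ card L) * (walsh R U * fourier V f R))"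
    using assms by (auto simp: fourier_sum fourier_cmult fourier_shift intro!: sum.cong)
  also have "\<dots> = inverse (2 ^ card L) * (\<Sum>U\<in>Pow L. walsh R U) * fourier V f R"
    by (simp add: sum_distrib_left sum_distrib_right mult.assoc)
  finally show ?thesis using sum_walsh[OF fin, of R] by simp
qed

lemma influence_nonneg: "0 \<le> influence V f L"
  unfolding influence_def by (intro sum_nonneg) auto

lemma sum_if_Pow:
  assumes "finite V"
  shows "(\<Sum>R\<in>Pow V. if P R then g R else 0) = (\<Sum>R\<in>{R. R \<subseteq> V \<and> P R}. g R)"
proof -
  have "{R. R \<subseteq> V \<and> P R} = {R\<in>Pow V. P R}" by auto
  then show ?thesis using assms by (simp only: sum.inter_filter[OF iffD2[OF finite_Pow_iff]])
qed

lemma sum_Pow_influence: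
  assumes "finite V"
  shows "(\<Sum>R\<in>Pow V. (fourier V f R)\<^sup>2)
    = (\<Sum>R\<in>{R. R \<subseteq> V \<and> R \<inter> L = {}}. (fourier V f R)\<^sup>2) + influence V f L"
proof -
  have "(\<Sum>R\<in>Pow V. (fourier V f R)\<^sup>2)
      = (\<Sum>R\<in>Pow V. (if R \<inter> L = {} then (fourier V f R)\<^sup>2 else 0)
          + (if R \<inter> L \<noteq> {} then (fourier V f R)\<^sup>2 else 0))"
    by (rule sum.cong) auto
  then show ?thesis using assms by (simp add: sum.distrib sum_if_Pow influence_def)
qed

lemma average_over_bounds:
  assumes "finite V" "L \<subseteq> V" "S \<subseteq> V" "\<And>S. S \<subseteq> V \<Longrightarrow> f S = 0 \<or> f S = 1"
  shows "0 \<le> average_over L f S" "average_over L f S \<le> 1"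
proof -
  have fin: "finite L" by (rule finite_subset[OF assms(2,1)])
  have b: "0 \<le> f (sym_diff S U) \<and> f (sym_diff S U) \<le> 1" if "U \<subseteq> L" for U
  proof -
    have "sym_diff S U \<subseteq> V" using assms that by auto
    then show ?thesis using assms(4)[of "sym_diff S U"] by auto
  qed
  show "0 \<le> average_over L f S"
    unfolding average_over_def by (intro expect_nonneg) (use b in auto)
  have "average_over L f S \<le> expect L (\<lambda>_. 1)"
    unfolding average_over_def by (intro expect_mono) (use b in auto)
  then show "average_over L f S \<le> 1" using expect_const[OF fin, of 1] by simp
qed

lemma expect_eq_sum_fourier_sq:
  assumes "finite V" "\<And>S. S \<subseteq> V \<Longrightarrow> f S = 0 \<or> f S = 1"
  shows "expect V f = (\<Sum>R\<in>Pow V. (fourier V f R)\<^sup>2)"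
proof -
  have "expect V f = expect V (\<lambda>S. f S * f S)"
    by (rule expect_cong) (use assms(2) in fastforce)
  then show ?thesis using parseval[OF assms(1), of f f] by (simp add: power2_eq_square)
qed

text \<open>Averaging is the orthogonal projection onto the characters disjoint from
  \<open>L\<close>, and f^2 = f makes the mean of \<open>f\<close> its total Fourier mass.\<close>

lemma expect_eq_average_influence:
  assumes "finite V" "L \<subseteq> V" "\<And>S. S \<subseteq> V \<Longrightarrow> f S = 0 \<or> f S = 1"
  shows "expect V (\<lambda>S. f S * average_over L f S) = expect V f - influence V f L"
    and "expect V (\<lambda>S. (average_over L f S)\<^sup>2) = expect V f - influence V f L"
    and "expect V (average_over L f) = expect V f"
proof -
  have F: "fourier V (average_over L f) R = (if R \<inter> L = {} then fourier V f R else 0)"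
    if "R \<in> Pow V" for R
    using fourier_average_over[OF assms(1,2)] that by auto
  have *: "(\<Sum>R\<in>Pow V. if R \<inter> L = {} then (fourier V f R)\<^sup>2 else 0) = expect V f - influence V f L"
    using expect_eq_sum_fourier_sq[OF assms(1,3)] sum_Pow_influence[OF assms(1), of f L]
    by (simp add: sum_if_Pow[OF assms(1)])
  have "expect V (\<lambda>S. f S * average_over L f S)
     = (\<Sum>R\<in>Pow V. if R \<inter> L = {} then (fourier V f R)\<^sup>2 else 0)"
    unfolding parseval[OF assms(1)] by (rule sum.cong) (auto simp: F power2_eq_square)
  then show "expect V (\<lambda>S. f S * average_over L f S) = expect V f - influence V f L"
    using * by simp
  have "expect V (\<lambda>S. average_over L f S * average_over L f S)
     = (\<Sum>R\<in>Pow V. if R \<inter> L = {} then (fourier V f R)\<^sup>2 else 0)"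
    unfolding parseval[OF assms(1)] by (rule sum.cong) (auto simp: F power2_eq_square)
  then show "expect V (\<lambda>S. (average_over L f S)\<^sup>2) = expect V f - influence V f L"
    using * by (simp add: power2_eq_square)
  show "expect V (average_over L f) = expect V f"
    using F[of "{}"] by (simp add: fourier_empty)
qed

text \<open>
  Let \<open>D = f - u\<close>, where \<open>u\<close> averages \<open>f\<close> over the coordinates in \<open>L\<close>. As \<open>f\<close> is Boolean,
  the mean of \<open>\<bar>D\<bar>\<close> is twice that of \<open>D\<^sup>2\<close>, so a small influence makes \<open>D\<close> nearly sparse, and by
  hypercontractivity a sparse function has little weight on low levels. With \<open>\<alpha>\<close> the influence and
  \<open>\<beta>\<close> its part on \<open>\<T>\<close>, this reads \<open>\<beta>\<^sup>2 \<le> 54\<^sup>2 \<alpha>\<^sup>3\<close>; the threshold \<open>1/11664 = 1/108\<^sup>2\<close> makes \<open>\<beta> \<le> \<alpha>/2\<close>.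
\<close>

lemma influence_dichotomy:
  assumes fin: "finite V" and L: "L \<subseteq> V"
    and f01: "\<And>S. S \<subseteq> V \<Longrightarrow> f S = 0 \<or> f S = 1"
    and low: "\<And>R. R \<in> \<T> \<Longrightarrow> card R \<le> 3"
    and W: "W = (\<Sum>R\<in>Pow V - \<T>. (fourier V f R)\<^sup>2)"
  shows "influence V f L \<le> 2 * W \<or> 1 / 11664 < influence V f L"
proof -
  define \<alpha> where "\<alpha> = influence V f L"
  define u where "u = average_over L f"
  define D where "D S = f S - u S" for S
  define d where "d R = (if R \<inter> L \<noteq> {} \<and> R \<in> \<T> then fourier V f R else 0)" for R
  define G where "G = walsh_sum V d"
  define \<beta> where "\<beta> = (\<Sum>R\<in>Pow V. (d R)\<^sup>2)"
  note avg = expect_eq_average_influence[where f = f, OF fin L f01]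
  have u01: "0 \<le> u S" "u S \<le> 1" if "S \<subseteq> V" for S
    using average_over_bounds[where f = f, OF fin L that f01] by (auto simp: u_def)
  have D1: "\<bar>D S\<bar> \<le> 1" if "S \<subseteq> V" for S
    using u01[OF that] f01[OF that] by (auto simp: D_def)
  have ED: "expect V (\<lambda>S. \<bar>D S\<bar>) = 2 * \<alpha>"
  proof -
    have "expect V (\<lambda>S. \<bar>D S\<bar>) = expect V (\<lambda>S. (f S + u S) - 2 * (f S * u S))"
    proof (rule expect_cong)
      fix S assume "S \<subseteq> V"
      then show "\<bar>D S\<bar> = (f S + u S) - 2 * (f S * u S)"
        using u01[of S] f01[of S] by (auto simp: D_def)
    qed
    then show ?thesis
      using avg by (simp add: expect_diff expect_add expect_cmult u_def \<alpha>_def)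
  qed
  have ED2: "expect V (\<lambda>S. (D S)\<^sup>2) = \<alpha>"
  proof -
    have "expect V (\<lambda>S. (D S)\<^sup>2) = expect V (\<lambda>S. (f S + (u S)\<^sup>2) - 2 * (f S * u S))"
    proof (rule expect_cong)
      fix S assume "S \<subseteq> V"
      then show "(D S)\<^sup>2 = (f S + (u S)\<^sup>2) - 2 * (f S * u S)"
        using f01[of S] by (auto simp: D_def power2_diff)
    qed
    then show ?thesis
      using avg by (simp add: expect_diff expect_add expect_cmult u_def \<alpha>_def)
  qed
  have EG4: "expect V (\<lambda>S. G S ^ 4) \<le> 729 * \<beta>\<^sup>2"
  proof -
    have "d R = 0" if "3 < card R" for R
      using low[of R] that by (auto simp: d_def)
    then show ?thesis using bonami_lemma[OF fin, of 3 d] by (simp add: G_def \<beta>_def)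
  qed
  \<comment> \<open>\<open>D\<close> keeps exactly the coefficients of \<open>f\<close> that meet
    \<open>L\<close>, and \<open>G\<close> is its truncation to \<open>\<T>\<close>, so pairing the
    two gives the mass of \<open>G\<close>.\<close>
  have EDG: "expect V (\<lambda>S. D S * G S) = \<beta>"
  proof -
    have "fourier V D R = fourier V f R - fourier V u R" for R
      by (simp add: fourier_def D_def left_diff_distrib expect_diff)
    then have "fourier V D R * d R = (d R)\<^sup>2" if "R \<in> Pow V" for R
      using that fourier_average_over[OF fin L, of R f]
      by (auto simp: d_def u_def power2_eq_square)
    then show ?thesis
      unfolding G_def \<beta>_def expect_mult_walsh_sum[OF fin] by simp
  qed
  have \<beta>0: "0 \<le> \<beta>" by (simp add: \<beta>_def sum_nonneg)
  have \<alpha>0: "0 \<le> \<alpha>" by (simp add: \<alpha>_def influence_nonneg)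
  \<comment> \<open>Together with \<open>h2\<close> this is Hoelder's inequality with exponents 2,
    4, 4 for |D|^(1/2), |D|^(1/2) and G, fed with E|D| = 2\<alpha> and E D^2 = \<alpha>.\<close>
  have h1: "\<beta>\<^sup>2 \<le> 2 * \<alpha> * expect V (\<lambda>S. \<bar>D S\<bar> * (G S)\<^sup>2)"
  proof -
    have "\<beta> = expect V (\<lambda>S. sqrt \<bar>D S\<bar> * (sqrt \<bar>D S\<bar> * sgn (D S) * G S))"
      unfolding EDG[symmetric]
    proof (rule expect_cong)
      fix S
      have "sqrt \<bar>D S\<bar> * (sqrt \<bar>D S\<bar> * sgn (D S) * G S)
          = (sqrt \<bar>D S\<bar> * sqrt \<bar>D S\<bar>) * sgn (D S) * G S"
        by (simp only: mult.assoc)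
      also have "\<dots> = D S * G S"
        unfolding real_sqrt_mult_self abs_abs abs_mult_sgn ..
      finally show "D S * G S = sqrt \<bar>D S\<bar> * (sqrt \<bar>D S\<bar> * sgn (D S) * G S)" ..
    qed
    then have "\<beta>\<^sup>2 \<le> expect V (\<lambda>S. (sqrt \<bar>D S\<bar>)\<^sup>2) * expect V (\<lambda>S. (sqrt \<bar>D S\<bar> * sgn (D S) * G S)\<^sup>2)"
      using expect_Cauchy_Schwarz[of V "\<lambda>S. sqrt \<bar>D S\<bar>" "\<lambda>S. sqrt \<bar>D S\<bar> * sgn (D S) * G S"] by simp
    also have "expect V (\<lambda>S. (sqrt \<bar>D S\<bar>)\<^sup>2) = 2 * \<alpha>"
      using ED by simp
    also have "expect V (\<lambda>S. (sqrt \<bar>D S\<bar> * sgn (D S) * G S)\<^sup>2) = expect V (\<lambda>S. \<bar>D S\<bar> * (G S)\<^sup>2)"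
      by (rule expect_cong) (auto simp: power_mult_distrib sgn_if)
    finally show ?thesis .
  qed
  have h2: "(expect V (\<lambda>S. \<bar>D S\<bar> * (G S)\<^sup>2))\<^sup>2 \<le> \<alpha> * (729 * \<beta>\<^sup>2)"
  proof -
    have "(expect V (\<lambda>S. \<bar>D S\<bar> * (G S)\<^sup>2))\<^sup>2
       \<le> expect V (\<lambda>S. \<bar>D S\<bar>\<^sup>2) * expect V (\<lambda>S. ((G S)\<^sup>2)\<^sup>2)"
      by (rule expect_Cauchy_Schwarz)
    also have "\<dots> = \<alpha> * expect V (\<lambda>S. G S ^ 4)" using ED2 by simp
    also have "\<dots> \<le> \<alpha> * (729 * \<beta>\<^sup>2)" using EG4 \<alpha>0 by (rule mult_left_mono)
    finally show ?thesis .
  qed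
  have "(\<beta>\<^sup>2)\<^sup>2 \<le> (2 * \<alpha> * expect V (\<lambda>S. \<bar>D S\<bar> * (G S)\<^sup>2))\<^sup>2"
    using h1 by (intro power_mono) auto
  also have "\<dots> = 4 * \<alpha>\<^sup>2 * (expect V (\<lambda>S. \<bar>D S\<bar> * (G S)\<^sup>2))\<^sup>2"
    by (simp add: power_mult_distrib)
  also have "\<dots> \<le> 4 * \<alpha>\<^sup>2 * (\<alpha> * (729 * \<beta>\<^sup>2))"
    using h2 by (intro mult_left_mono) auto
  finally have "\<beta>\<^sup>2 * \<beta>\<^sup>2 \<le> (2916 * \<alpha> ^ 3) * \<beta>\<^sup>2"
    by (simp add: power2_eq_square power3_eq_cube mult_ac)
  have key: "\<beta>\<^sup>2 \<le> 2916 * \<alpha> ^ 3"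
  proof (cases "\<beta> = 0")
    case False
    then have "0 < \<beta>\<^sup>2" by simp
    then show ?thesis using \<open>\<beta>\<^sup>2 * \<beta>\<^sup>2 \<le> (2916 * \<alpha> ^ 3) * \<beta>\<^sup>2\<close> by (rule mult_right_le_imp_le[rotated])
  qed (use \<alpha>0 in simp)
  have \<alpha>\<beta>: "\<alpha> \<le> \<beta> + W"
  proof -
    have "\<alpha> = (\<Sum>R\<in>Pow V. if R \<inter> L \<noteq> {} then (fourier V f R)\<^sup>2 else 0)"
      using fin by (simp add: \<alpha>_def influence_def sum_if_Pow)
    also have "\<dots> \<le> (\<Sum>R\<in>Pow V. (d R)\<^sup>2 + (if R \<notin> \<T> then (fourier V f R)\<^sup>2 else 0))"
      by (rule sum_mono) (auto simp: d_def)
    also have "\<dots> = \<beta> + W"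
    proof -
      have "{R. R \<subseteq> V \<and> R \<notin> \<T>} = Pow V - \<T>" by auto
      then show ?thesis using fin by (simp add: sum.distrib \<beta>_def W sum_if_Pow)
    qed
    finally show ?thesis .
  qed
  show ?thesis
  proof (cases "\<alpha> \<le> 1 / 11664")
    case True
    have "\<beta>\<^sup>2 \<le> 2916 * (\<alpha>\<^sup>2 * \<alpha>)" using key by (simp add: power3_eq_cube power2_eq_square mult_ac)
    also have "\<dots> \<le> 2916 * (\<alpha>\<^sup>2 * (1 / 11664))"
      using True by (intro mult_left_mono) auto
    also have "\<dots> = (\<alpha> / 2)\<^sup>2" by (simp add: power_divide)
    finally have "\<beta> \<le> \<alpha> / 2" by (rule power2_le_imp_le) (use \<alpha>0 in auto)
    then show ?thesis using \<alpha>\<beta> by (simp add: \<alpha>_def)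
  qed (simp add: \<alpha>_def)
qed

lemma influence_Un:
  assumes "finite V"
  shows "influence V f (L \<union> M) \<le> influence V f L + influence V f M"
proof -
  have "influence V f (L \<union> M) = (\<Sum>R\<in>Pow V. if R \<inter> (L \<union> M) \<noteq> {} then (fourier V f R)\<^sup>2 else 0)"
    using assms by (simp add: influence_def sum_if_Pow)
  also have "\<dots> \<le> (\<Sum>R\<in>Pow V. (if R \<inter> L \<noteq> {} then (fourier V f R)\<^sup>2 else 0)
       + (if R \<inter> M \<noteq> {} then (fourier V f R)\<^sup>2 else 0))"
    by (rule sum_mono) auto
  finally show ?thesis using assms by (simp add: influence_def sum_if_Pow sum.distrib)
qed

text \<open>Coordinates of negligible influence are adjoined one at a time. Each union has influence
  at most 4W, below the threshold, so the dichotomy brings it back to 2W. Every influential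
  coordinate carries mass at least 1/23328 on \<open>\<T>\<close>; sets there have at most three
  elements and the total mass is at most 1, whence 3 * 23328 = 69984.\<close>

theorem few_influential_coordinates:
  assumes fin: "finite V"
    and f01: "\<And>S. S \<subseteq> V \<Longrightarrow> f S = 0 \<or> f S = 1"
    and low: "\<And>R. R \<in> \<T> \<Longrightarrow> card R \<le> 3"
    and W: "W = (\<Sum>R\<in>Pow V - \<T>. (fourier V f R)\<^sup>2)" and small: "4 * W \<le> 1 / 11664"
  obtains H where "H \<subseteq> V" "card H \<le> 69984" "influence V f (V - H) \<le> 2 * W"
proof
  define H where "H = {x\<in>V. 1 / 11664 < influence V f {x}}"
  show HV: "H \<subseteq> V" by (auto simp: H_def)
  have finH: "finite H" using HV fin finite_subset by auto
  have "influence V f L \<le> 2 * W" if "finite L" "L \<subseteq> V - H" for L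
    using that
  proof (induction L rule: finite_induct)
    case empty
    then show ?case by (simp add: influence_def W sum_nonneg)
  next
    case (insert x L)
    have "influence V f {x} \<le> 2 * W"
      using influence_dichotomy[where f = f, OF fin _ f01 low W, of "{x}"] insert.prems by (auto simp: H_def)
    then have "influence V f (insert x L) \<le> 4 * W"
      using influence_Un[OF fin, of f "{x}" L] insert by auto
    then show ?case
      using influence_dichotomy[where f = f, OF fin _ f01 low W, of "insert x L"] insert.prems small by auto
  qed
  then show "influence V f (V - H) \<le> 2 * W" using fin by auto
  have part: "1 / 23328 \<le> (\<Sum>R\<in>Pow V. if x \<in> R \<and> R \<in> \<T> then (fourier V f R)\<^sup>2 else 0)" if "x \<in> H" for x
  proof -
    have "1 / 11664 < influence V f {x}" using that by (simp add: H_def)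
    also have "\<dots> = (\<Sum>R\<in>Pow V. if R \<inter> {x} \<noteq> {} then (fourier V f R)\<^sup>2 else 0)"
      using fin by (simp add: influence_def sum_if_Pow)
    also have "\<dots> \<le> (\<Sum>R\<in>Pow V. (if x \<in> R \<and> R \<in> \<T> then (fourier V f R)\<^sup>2 else 0)
          + (if R \<notin> \<T> then (fourier V f R)\<^sup>2 else 0))"
      by (rule sum_mono) auto
    also have "\<dots> = (\<Sum>R\<in>Pow V. if x \<in> R \<and> R \<in> \<T> then (fourier V f R)\<^sup>2 else 0) + W"
    proof -
      have "{R. R \<subseteq> V \<and> R \<notin> \<T>} = Pow V - \<T>" by auto
      then show ?thesis using fin by (simp add: sum.distrib W sum_if_Pow)
    qed
    finally show ?thesis using small by simp
  qed
  have "real (card H) / 23328 = (\<Sum>x\<in>H. 1 / 23328)" by simp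
  also have "\<dots> \<le> (\<Sum>x\<in>H. \<Sum>R\<in>Pow V. if x \<in> R \<and> R \<in> \<T> then (fourier V f R)\<^sup>2 else 0)"
    by (rule sum_mono) (rule part)
  also have "\<dots> = (\<Sum>R\<in>Pow V. \<Sum>x\<in>H. if x \<in> R \<and> R \<in> \<T> then (fourier V f R)\<^sup>2 else 0)"
    by (rule sum.swap)
  also have "\<dots> \<le> (\<Sum>R\<in>Pow V. 3 * (fourier V f R)\<^sup>2)"
  proof (rule sum_mono)
    fix R assume R: "R \<in> Pow V"
    show "(\<Sum>x\<in>H. if x \<in> R \<and> R \<in> \<T> then (fourier V f R)\<^sup>2 else 0) \<le> 3 * (fourier V f R)\<^sup>2"
    proof (cases "R \<in> \<T>")
      case True
      have "{x\<in>H. x \<in> R} \<subseteq> R" "finite R" using R fin finite_subset by auto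
      then have "card {x\<in>H. x \<in> R} \<le> 3"
        using low[OF True] card_mono[of R "{x\<in>H. x \<in> R}"] by linarith
      then have "real (card {x\<in>H. x \<in> R}) * (fourier V f R)\<^sup>2 \<le> 3 * (fourier V f R)\<^sup>2"
        by (intro mult_right_mono) auto
      then show ?thesis using True finH by (simp add: sum.inter_filter[symmetric])
    qed simp
  qed
  also have "\<dots> = 3 * expect V f"
    using expect_eq_sum_fourier_sq[where f = f, OF fin f01] by (simp add: sum_distrib_left)
  also have "\<dots> \<le> 3"
  proof -
    have "f S \<le> 1" if "S \<subseteq> V" for S using f01[OF that] by auto
    then have "expect V f \<le> expect V (\<lambda>_. 1)" by (rule expect_mono)
    then show ?thesis using expect_const[OF fin, of 1] by simp
  qed
  finally show "card H \<le> 69984" by simp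
qed

lemma exists_le_expect:
  assumes "finite V"
  obtains S where "S \<subseteq> V" "f S \<le> expect V f"
proof (rule ccontr)
  assume "\<not> thesis"
  then have "\<And>S. S \<in> Pow V \<Longrightarrow> expect V f < f S" using that by (meson PowD not_le)
  then have "(\<Sum>S\<in>Pow V. expect V f) < (\<Sum>S\<in>Pow V. f S)"
    using assms by (intro sum_strict_mono) auto
  then show False using assms by (simp add: card_Pow expect_def)
qed

text \<open>
  The derivative of an integer-valued function in the directions of \<open>X\<close> is integer-valued, and
  all its Fourier mass outside the supersets of \<open>X\<close> vanishes.
\<close>

lemma fourier_granularity:
  assumes fin: "finite V" and X: "X \<subseteq> V" and int: "\<And>S. S \<subseteq> V \<Longrightarrow> f S \<in> \<int>"
  obtains k :: int where
    "(of_int k - 2 ^ card X * fourier V f X)\<^sup>2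
       \<le> 4 ^ card X * (\<Sum>R\<in>{R. R \<subseteq> V \<and> X \<subset> R}. (fourier V f R)\<^sup>2)"
proof -
  have finX: "finite X" using X fin finite_subset by auto
  define Z where "Z S = (\<Sum>U\<in>Pow X. walsh X U * f (sym_diff S U))" for S
  define m where "m = 2 ^ card X * fourier V f X"
  have FZ: "fourier V Z R = (if X \<subseteq> R then 2 ^ card X * fourier V f R else 0)" if "R \<in> Pow V" for R
  proof -
    have finR: "finite R" using that fin finite_subset by auto
    have "fourier V Z R = (\<Sum>U\<in>Pow X. walsh X U * (walsh R U * fourier V f R))"
      unfolding Z_def fourier_sum fourier_cmult
      by (rule sum.cong) (use fin X that in \<open>auto simp: fourier_shift\<close>)
    also have "\<dots> = (\<Sum>U\<in>Pow X. walsh (sym_diff X R) U) * fourier V f R"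
      unfolding sum_distrib_right
    proof (rule sum.cong)
      fix U assume "U \<in> Pow X"
      then have "finite U" using finX finite_subset by auto
      then show "walsh X U * (walsh R U * fourier V f R) = walsh (sym_diff X R) U * fourier V f R"
        by (simp add: walsh_sym_diff_left)
    qed simp
    also have "\<dots> = (if sym_diff X R \<inter> X = {} then 2 ^ card X else 0) * fourier V f R"
      by (simp add: sum_walsh[OF finX])
    also have "sym_diff X R \<inter> X = {} \<longleftrightarrow> X \<subseteq> R" by auto
    finally show ?thesis by simp
  qed
  have "expect V (\<lambda>S. (Z S * walsh X S - m)\<^sup>2)
      = expect V (\<lambda>S. (Z S * Z S - 2 * m * (Z S * walsh X S)) + m\<^sup>2)"
    by (rule expect_cong) (simp add: power2_eq_square algebra_simps)
  also have "\<dots> = (\<Sum>R\<in>Pow V. (fourier V Z R)\<^sup>2) - 2 * m * fourier V Z X + m\<^sup>2"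
    by (simp add: expect_add expect_diff expect_cmult parseval[OF fin] fourier_def[symmetric]
      expect_const[OF fin] power2_eq_square)
  also have "\<dots> = (\<Sum>R\<in>Pow V. (fourier V Z R)\<^sup>2) - m\<^sup>2"
    using FZ[of X] X by (simp add: m_def power2_eq_square)
  also have "\<dots> = (\<Sum>R\<in>Pow V. (if X \<subset> R then 4 ^ card X * (fourier V f R)\<^sup>2 else 0) + (if R = X then m\<^sup>2 else 0)) - m\<^sup>2"
    by (intro arg_cong2[where f = "(-)"] sum.cong refl)
      (auto simp: FZ m_def power_mult_distrib power_mult[symmetric] mult.commute[of _ 2] power_mult)
  also have "\<dots> = 4 ^ card X * (\<Sum>R\<in>{R. R \<subseteq> V \<and> X \<subset> R}. (fourier V f R)\<^sup>2)"
    using fin X by (simp add: sum.distrib sum_if_Pow sum_distrib_left)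
  finally have E: "expect V (\<lambda>S. (Z S * walsh X S - m)\<^sup>2) = \<dots>" .
  obtain S where S: "S \<subseteq> V" "(Z S * walsh X S - m)\<^sup>2 \<le> expect V (\<lambda>S. (Z S * walsh X S - m)\<^sup>2)"
    using exists_le_expect[OF fin, of "\<lambda>S. (Z S * walsh X S - m)\<^sup>2"] by blast
  have "Z S * walsh X S \<in> \<int>"
    unfolding Z_def
  proof (intro Ints_mult Ints_sum walsh_in_Ints int)
    fix U assume "U \<in> Pow X"
    then show "sym_diff S U \<subseteq> V" using S X by auto
  qed
  then obtain k where "Z S * walsh X S = of_int k" by (auto elim: Ints_cases)
  then show thesis using that[of k] S(2) unfolding E by (simp add: m_def)
qed

text \<open>Let u be the average of \<open>f\<close> over V - X, so that u(S) is the density of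
  \<open>f\<close> on the cell of S. Since E u^2 is at most max u times E u, and E u^2 is E f minus
  the influence, some cell is nearly full.\<close>

lemma concentrated_on_cell:
  assumes fin: "finite V" and X: "X \<subseteq> V"
    and f01: "\<And>S. S \<subseteq> V \<Longrightarrow> f S = 0 \<or> f S = 1" and pos: "0 < expect V f"
  obtains B where "B \<subseteq> X" "1 - influence V f (V - X) / expect V f \<le> expect (V - X) (\<lambda>U. f (B \<union> U))"
proof -
  define L where "L = V - X"
  have L: "L \<subseteq> V" by (auto simp: L_def)
  note avg = expect_eq_average_influence[where f = f, OF fin L f01]
  define M where "M = Max (average_over L f ` Pow V)"
  have "M \<in> average_over L f ` Pow V" unfolding M_def using fin by (intro Max_in) auto
  then obtain S where S: "S \<subseteq> V" "M = average_over L f S" by auto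
  have "expect V (\<lambda>S. (average_over L f S)\<^sup>2) \<le> expect V (\<lambda>S. M * average_over L f S)"
  proof (rule expect_mono)
    fix T assume T: "T \<subseteq> V"
    then have "average_over L f T \<le> M" unfolding M_def using fin by (intro Max_ge) auto
    then show "(average_over L f T)\<^sup>2 \<le> M * average_over L f T"
      using average_over_bounds(1)[where f = f, OF fin L T f01]
      by (simp add: power2_eq_square mult_right_mono)
  qed
  then have "expect V f - influence V f L \<le> M * expect V f"
    using avg by (simp add: expect_cmult)
  then have "1 - influence V f L / expect V f \<le> M"
    using pos by (simp add: field_simps)
  also have "M = expect L (\<lambda>U. f ((S \<inter> X) \<union> U))"
  proof -
    have "(\<Sum>U\<in>Pow L. f ((S \<inter> X) \<union> U)) = (\<Sum>U\<in>Pow L. f ((S \<inter> X) \<union> sym_diff U (S \<inter> L)))"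
      by (rule sum_Pow_sym_diff[symmetric, of "S \<inter> L" L "\<lambda>U. f ((S \<inter> X) \<union> U)"]) auto
    also have "\<dots> = (\<Sum>U\<in>Pow L. f (sym_diff S U))"
    proof (rule sum.cong)
      fix U assume "U \<in> Pow L"
      then have "(S \<inter> X) \<union> sym_diff U (S \<inter> L) = sym_diff S U" using S by (auto simp: L_def)
      then show "f ((S \<inter> X) \<union> sym_diff U (S \<inter> L)) = f (sym_diff S U)" by simp
    qed simp
    finally show ?thesis using S by (simp add: average_over_def expect_def)
  qed
  finally show thesis using that[of "S \<inter> X"] by (simp add: L_def)
qed

subsection \<open>Traces of affine hyperplanes\<close>

definition dot :: "nat \<Rightarrow> vec2 \<Rightarrow> vec2 \<Rightarrow> bit" where
  "dot n a v = (\<Sum>i<n. a i * v i)"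

definition trace :: "nat \<Rightarrow> vec2 set \<Rightarrow> vec2 \<Rightarrow> vec2 set" where
  "trace n R a = {v\<in>R. dot n a v = 1}"

declare add_bit_eq_xor [simp del] mult_bit_eq_and [simp del]

lemma bit_cases: "(x::bit) = 0 \<or> x = 1"
  using UNIV_bit by auto

lemma vec2_add_self [simp]: "(v::vec2) + v = 0"
  by (rule ext) (simp add: plus_fun_def zero_fun_def)

lemma vec2_add_self_left [simp]: "(v::vec2) + (v + w) = w"
  by (simp add: add.assoc[symmetric])

lemma vec2_add_eq_0_iff: "(v::vec2) + w = 0 \<longleftrightarrow> v = w"
  by (metis vec2_add_self vec2_add_self_left add_0_right)

lemma dot_add_right: "dot n a (v + w) = dot n a v + dot n a w"
  by (simp add: dot_def plus_fun_def distrib_left sum.distrib)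

lemma dot_add_left: "dot n (a + b) v = dot n a v + dot n b v"
  by (simp add: dot_def plus_fun_def distrib_right sum.distrib)

lemma dot_zero [simp]: "dot n 0 v = 0" "dot n a 0 = 0"
  by (simp_all add: dot_def zero_fun_def)

lemma dot_sum_right: "dot n a (sum v I) = (\<Sum>i\<in>I. dot n a (v i))"
  using sum_comp_morphism[of "dot n a" v I] by (simp add: dot_add_right comp_def)

lemma dot_sum_left: "dot n (sum a I) v = (\<Sum>i\<in>I. dot n (a i) v)"
  using sum_comp_morphism[of "\<lambda>a. dot n a v" a I] by (simp add: dot_add_left comp_def)

lemma zero_in_Z2n [simp]: "0 \<in> Z2n n"
  by (simp add: Z2n_def zero_fun_def)

lemma add_in_Z2n: "v \<in> Z2n n \<Longrightarrow> w \<in> Z2n n \<Longrightarrow> v + w \<in> Z2n n"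
  by (simp add: Z2n_def plus_fun_def)

lemma sum_in_Z2n: "(\<And>i. i \<in> I \<Longrightarrow> v i \<in> Z2n n) \<Longrightarrow> (\<Sum>i\<in>I. v i) \<in> Z2n n"
  by (induction I rule: infinite_finite_induct) (simp_all add: add_in_Z2n)

lemma exists_dot_eq_1:
  assumes "v \<in> Z2n n" "v \<noteq> 0"
  obtains a where "a \<in> Z2n n" "dot n a v = 1"
proof -
  obtain i where i: "v i \<noteq> 0" using assms(2) by (auto simp: zero_fun_def fun_eq_iff)
  then have "i < n" using assms(1) by (auto simp: Z2n_def not_le[symmetric])
  have "v i = 1" using i bit_cases by blast
  let ?a = "(\<lambda>j. if j = i then 1 else 0) :: vec2"
  have "?a \<in> Z2n n" using \<open>i < n\<close> by (auto simp: Z2n_def)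
  moreover have "dot n ?a v = 1"
    using \<open>i < n\<close> \<open>v i = 1\<close> by (simp add: dot_def if_distrib[where f = "\<lambda>c. c * _"] cong: if_cong)
  ultimately show thesis by (rule that)
qed

lemma trace_add: "trace n R (a + b) = sym_diff (trace n R a) (trace n R b)"
proof -
  have "dot n (a + b) v = 1 \<longleftrightarrow> (dot n a v = 1) \<noteq> (dot n b v = 1)" for v
    unfolding dot_add_left using bit_cases[of "dot n a v"] bit_cases[of "dot n b v"] by auto
  then have "trace n R (a + b) = {v\<in>R. (dot n a v = 1) \<noteq> (dot n b v = 1)}" by (simp add: trace_def)
  also have "\<dots> = sym_diff (trace n R a) (trace n R b)" unfolding trace_def by blast
  finally show ?thesis .
qed

text \<open>
  In a dual frame, \<open>B\<close> is a basis of \<open>R\<close> with dual vectors \<open>d\<close>. The traces of all functionals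
  on \<open>R\<close> form a linear code, parametrised by the subsets of \<open>B\<close>.
\<close>

locale dual_frame =
  fixes n :: nat and R B :: "vec2 set" and d :: "vec2 \<Rightarrow> vec2"
  assumes R_subset: "R \<subseteq> Z2n n" and zero_notin: "0 \<notin> R" and B_subset: "B \<subseteq> R"
    and d_in: "b \<in> B \<Longrightarrow> d b \<in> Z2n n"
    and dual: "b \<in> B \<Longrightarrow> b' \<in> B \<Longrightarrow> dot n (d b) b' = (if b = b' then 1 else 0)"
    and vanish: "a \<in> Z2n n \<Longrightarrow> (\<And>b. b \<in> B \<Longrightarrow> dot n a b = 0) \<Longrightarrow> v \<in> R \<Longrightarrow> dot n a v = 0"

text \<open>Gaussian elimination. If some functional \<open>a\<close> vanishes on \<open>B\<close>
  and is 1 at the new vector, that vector joins the basis with dual \<open>a\<close>, and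
  \<open>a\<close> is added to the old duals that are 1 there; otherwise the frame survives
  unchanged.\<close>

lemma exists_dual_frame:
  assumes "R \<subseteq> Z2n n" "0 \<notin> R"
  obtains B d where "dual_frame n R B d"
proof -
  have "finite R" using assms finite_Z2n finite_subset by blast
  then have "\<exists>B d. dual_frame n R B d" using assms
  proof (induction R rule: finite_induct)
    case empty
    have "dual_frame n {} {} undefined" by unfold_locales auto
    then show ?case by blast
  next
    case (insert v R)
    have vR: "insert v R \<subseteq> Z2n n" "0 \<notin> insert v R" by (rule insert.prems)+
    then have "R \<subseteq> Z2n n" "0 \<notin> R" by auto
    then have "\<exists>B d. dual_frame n R B d" by (rule insert.IH)
    then obtain B d where "dual_frame n R B d" by auto
    then interpret dual_frame n R B d .
    show ?case
    proof (cases "\<forall>a\<in>Z2n n. (\<forall>b\<in>B. dot n a b = 0) \<longrightarrow> dot n a v = 0")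
      case True
      have "dual_frame n (insert v R) B d"
      proof
        show "insert v R \<subseteq> Z2n n" "0 \<notin> insert v R" "B \<subseteq> insert v R"
          using vR B_subset by auto
        show "dot n a w = 0"
          if "a \<in> Z2n n" "\<And>b. b \<in> B \<Longrightarrow> dot n a b = 0" "w \<in> insert v R" for a w
          using that(3)
        proof
          assume "w = v"
          then show ?thesis using True that(1,2) by blast
        next
          assume "w \<in> R"
          then show ?thesis using that(1,2) by (rule vanish[rotated 2])
        qed
      qed (fact d_in dual)+
      then show ?thesis by blast
    next
      case False
      then obtain a where a: "a \<in> Z2n n" "\<And>b. b \<in> B \<Longrightarrow> dot n a b = 0" "dot n a v = 1"
        using bit_cases by blast
      have "v \<notin> B" using insert.hyps B_subset by auto
      define d' where "d' b = (if b = v then a else if dot n (d b) v = 1 then d b + a else d b)" for b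
      have "dual_frame n (insert v R) (insert v B) d'"
      proof
        show "insert v R \<subseteq> Z2n n" "0 \<notin> insert v R" "insert v B \<subseteq> insert v R"
          using vR B_subset by auto
        show "d' b \<in> Z2n n" if "b \<in> insert v B" for b
          using that a d_in by (auto simp: d'_def add_in_Z2n)
        show "dot n (d' b) b' = (if b = b' then 1 else 0)" if "b \<in> insert v B" "b' \<in> insert v B" for b b'
        proof (cases "b = v")
          case True
          then show ?thesis using that a \<open>v \<notin> B\<close> by (cases "b' = v") (auto simp: d'_def)
        next
          case False
          then have b: "b \<in> B" using that by simp
          have "dot n (d b) v = 0 \<or> dot n (d b) v = 1" by (rule bit_cases)
          then show ?thesis
            using False b that a dual[of b b'] \<open>v \<notin> B\<close>
            by (cases "b' = v") (auto simp: d'_def dot_add_left)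
        qed
        show "dot n a' w = 0"
          if a': "a' \<in> Z2n n" "\<And>b. b \<in> insert v B \<Longrightarrow> dot n a' b = 0" "w \<in> insert v R" for a' w
          using a'(3)
        proof
          assume w: "w = v"
          show ?thesis unfolding w by (rule a'(2)) simp
        next
          assume "w \<in> R"
          have z: "dot n a' b = 0" if "b \<in> B" for b by (rule a'(2)) (use that in simp)
          show ?thesis by (rule vanish[OF a'(1) z \<open>w \<in> R\<close>])
        qed
      qed
      then show ?thesis by blast
    qed
  qed
  then show thesis using that by auto
qed

section \<open>The code of traces, its coordinates and its coloops\<close>

context dual_frame
begin

definition word :: "vec2 set \<Rightarrow> vec2 set" where
  "word U = trace n R (\<Sum>b\<in>U. d b)"

lemma finite_R: "finite R"
  using R_subset finite_Z2n finite_subset by blast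

lemma finite_B: "finite B"
  using B_subset finite_R finite_subset by blast

lemma sum_d_in: "U \<subseteq> B \<Longrightarrow> (\<Sum>b\<in>U. d b) \<in> Z2n n"
  by (rule sum_in_Z2n) (use d_in in auto)

lemma dot_sum_d:
  assumes "U \<subseteq> B" "b \<in> B"
  shows "dot n (\<Sum>b\<in>U. d b) b = (if b \<in> U then 1 else 0)"
proof -
  have "finite U" using assms finite_B finite_subset by blast
  have "dot n (\<Sum>b\<in>U. d b) b = (\<Sum>c\<in>U. if c = b then 1 else 0)"
    unfolding dot_sum_left by (rule sum.cong) (use assms dual in auto)
  then show ?thesis using \<open>finite U\<close> by simp
qed

lemma dot_eqI:
  assumes "a \<in> Z2n n" "a' \<in> Z2n n" "\<And>b. b \<in> B \<Longrightarrow> dot n a b = dot n a' b" "v \<in> R"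
  shows "dot n a v = dot n a' v"
proof -
  have "dot n (a + a') v = 0"
    by (rule vanish) (use assms in \<open>auto simp: add_in_Z2n dot_add_left\<close>)
  then show ?thesis
    using bit_cases[of "dot n a v"] bit_cases[of "dot n a' v"] by (auto simp: dot_add_left)
qed

lemma trace_eq_word:
  assumes "a \<in> Z2n n"
  shows "trace n R a = word (trace n B a)"
proof -
  have sub: "trace n B a \<subseteq> B" by (auto simp: trace_def)
  have "dot n a v = dot n (\<Sum>b\<in>trace n B a. d b) v" if "v \<in> R" for v
  proof (rule dot_eqI[OF assms sum_d_in[OF sub] _ that])
    fix b assume b: "b \<in> B"
    show "dot n a b = dot n (\<Sum>b\<in>trace n B a. d b) b"
      unfolding dot_sum_d[OF sub b] using b bit_cases[of "dot n a b"] by (auto simp: trace_def)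
  qed
  then show ?thesis by (auto simp: word_def trace_def)
qed

lemma word_subset: "word U \<subseteq> R"
  by (auto simp: word_def trace_def)

lemma trace_sum_d:
  assumes "U \<subseteq> B"
  shows "trace n B (\<Sum>b\<in>U. d b) = U"
proof -
  have "trace n B (\<Sum>b\<in>U. d b) = {b\<in>B. b \<in> U}"
    unfolding trace_def by (rule Collect_cong) (auto simp: dot_sum_d[OF assms] split: if_splits)
  then show ?thesis using assms by auto
qed

lemma word_Int:
  assumes "U \<subseteq> B"
  shows "word U \<inter> B = U"
proof -
  have "word U \<inter> B = trace n B (\<Sum>b\<in>U. d b)" using B_subset by (auto simp: word_def trace_def)
  then show ?thesis using trace_sum_d[OF assms] by simp
qed

lemma finite_word: "finite (word U)"
  using word_subset finite_R finite_subset by blast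

lemma card_le_card_word:
  assumes "U \<subseteq> B"
  shows "card U \<le> card (word U)"
  using word_Int[OF assms] card_mono[OF finite_word, of U U] by auto

lemma word_empty [simp]: "word {} = {}"
  by (auto simp: word_def trace_def)

lemma word_sym_diff:
  assumes "U \<subseteq> B" "U' \<subseteq> B"
  shows "word (sym_diff U U') = sym_diff (word U) (word U')"
proof -
  let ?a = "(\<Sum>b\<in>U. d b) + (\<Sum>b\<in>U'. d b)"
  have a: "?a \<in> Z2n n" using assms by (intro add_in_Z2n sum_d_in)
  have "trace n B ?a = sym_diff (trace n B (\<Sum>b\<in>U. d b)) (trace n B (\<Sum>b\<in>U'. d b))"
    unfolding trace_add ..
  also have "\<dots> = sym_diff U U'" using assms by (simp add: trace_sum_d)
  finally have "trace n B ?a = sym_diff U U'" .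
  then have "word (sym_diff U U') = trace n R ?a" using trace_eq_word[OF a] by simp
  also have "\<dots> = sym_diff (word U) (word U')" by (simp add: word_def trace_add)
  finally show ?thesis .
qed

text \<open>Restricting functionals to \<open>B\<close> maps \<open>Z2n n\<close> onto the subsets
  of \<open>B\<close>, and translation by dual vectors shows that all fibres have the same size.
  Averages over functionals become averages over codewords, and the dimension \<open>n\<close>
  disappears.\<close>

lemma expect_trace:
  "(\<Sum>a\<in>Z2n n. G (trace n R a)) / 2 ^ n = expect B (\<lambda>U. G (word U))"
proof -
  define fib where "fib U = {a\<in>Z2n n. trace n B a = U}" for U
  have card_fib: "card (fib U) = card (fib {})" if U: "U \<subseteq> B" for U
  proof -
    let ?e = "\<Sum>b\<in>U. d b"
    have e: "?e \<in> Z2n n" by (rule sum_d_in[OF U])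
    have tr: "trace n B (a + ?e) = sym_diff (trace n B a) U" for a
      by (simp add: trace_add trace_sum_d[OF U])
    have "bij_betw (\<lambda>a. a + ?e) (fib U) (fib {})"
    proof (rule bij_betwI[where g = "\<lambda>a. a + ?e"])
      show "(\<lambda>a. a + ?e) \<in> fib U \<rightarrow> fib {}" "(\<lambda>a. a + ?e) \<in> fib {} \<rightarrow> fib U"
        by (auto simp: fib_def tr add_in_Z2n e)
    qed (simp_all add: add.assoc)
    then show ?thesis by (rule bij_betw_same_card)
  qed
  have split: "(\<Sum>a\<in>Z2n n. H (trace n B a)) = real (card (fib {})) * (\<Sum>U\<in>Pow B. H U)"
    for H :: "vec2 set \<Rightarrow> real"
  proof -
    have "(\<Sum>a\<in>Z2n n. H (trace n B a)) = (\<Sum>U\<in>Pow B. \<Sum>a\<in>fib U. H (trace n B a))"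
      unfolding fib_def
      by (rule sum.group[symmetric]) (use finite_Z2n finite_B in \<open>auto simp: trace_def\<close>)
    also have "\<dots> = (\<Sum>U\<in>Pow B. real (card (fib {})) * H U)"
    proof (rule sum.cong)
      fix U assume "U \<in> Pow B"
      then have "card (fib U) = card (fib {})" by (intro card_fib) auto
      moreover have "(\<Sum>a\<in>fib U. H (trace n B a)) = (\<Sum>a\<in>fib U. H U)"
        by (rule sum.cong[OF refl]) (simp only: fib_def mem_Collect_eq)
      ultimately show "(\<Sum>a\<in>fib U. H (trace n B a)) = real (card (fib {})) * H U" by simp
    qed simp
    finally show ?thesis by (simp add: sum_distrib_left)
  qed
  have one: "2 ^ n = real (card (fib {})) * 2 ^ card B"
    using split[of "\<lambda>_. 1"] finite_B by (simp add: card_Z2n card_Pow)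
  have "(\<Sum>a\<in>Z2n n. G (trace n R a)) = (\<Sum>a\<in>Z2n n. G (word (trace n B a)))"
    by (intro sum.cong refl arg_cong[where f = G] trace_eq_word)
  also have "\<dots> = real (card (fib {})) * (\<Sum>U\<in>Pow B. G (word U))" by (rule split)
  finally have "(\<Sum>a\<in>Z2n n. G (trace n R a)) / 2 ^ n
      = real (card (fib {})) * (\<Sum>U\<in>Pow B. G (word U)) / (real (card (fib {})) * 2 ^ card B)"
    using one by simp
  moreover have "real (card (fib {})) \<noteq> 0" using one by (metis mult_zero_left power_not_zero zero_neq_numeral)
  ultimately show ?thesis by (simp add: expect_def)
qed

definition coord :: "vec2 \<Rightarrow> vec2 set" where
  "coord v = {b\<in>B. dot n (d b) v = 1}"

text \<open>The locale states spanning only dually, by \<open>vanish\<close>. If the two vectors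
  differed, some functional would separate them; but on \<open>R\<close> it is a sum of dual
  vectors, and expanding that sum gives the same value at both.\<close>

lemma sum_coord:
  assumes "v \<in> R"
  shows "v = \<Sum>(coord v)"
proof (rule ccontr)
  assume ne: "v \<noteq> \<Sum>(coord v)"
  have "\<Sum>(coord v) \<in> Z2n n"
    by (rule sum_in_Z2n) (use B_subset R_subset in \<open>auto simp: coord_def\<close>)
  then have "v + \<Sum>(coord v) \<in> Z2n n" using assms R_subset by (auto intro: add_in_Z2n)
  moreover have "v + \<Sum>(coord v) \<noteq> 0" using ne by (simp add: vec2_add_eq_0_iff)
  ultimately obtain a where a: "a \<in> Z2n n" "dot n a (v + \<Sum>(coord v)) = 1"
    by (rule exists_dot_eq_1)
  have sub: "trace n B a \<subseteq> B" by (auto simp: trace_def)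
  have "dot n a v = 1 \<longleftrightarrow> dot n (\<Sum>b\<in>trace n B a. d b) v = 1"
    using trace_eq_word[OF a(1)] assms unfolding word_def by (auto simp: trace_def[of n R])
  then have "dot n a v = dot n (\<Sum>b\<in>trace n B a. d b) v"
    using bit_cases by metis
  also have "\<dots> = (\<Sum>b\<in>B. if dot n a b = 1 then dot n (d b) v else 0)"
    unfolding dot_sum_left trace_def by (rule sum.inter_filter[OF finite_B])
  also have "\<dots> = (\<Sum>b\<in>B. if dot n (d b) v = 1 then dot n a b else 0)"
    by (rule sum.cong) (use bit_cases in auto)
  also have "\<dots> = dot n a (\<Sum>(coord v))"
    unfolding dot_sum_right coord_def by (rule sum.inter_filter[OF finite_B, symmetric])
  finally show False using a(2) by (simp add: dot_add_right)
qed

lemma coord_subset: "coord v \<subseteq> B"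
  by (auto simp: coord_def)

lemma mem_word_singleton: "b \<in> B \<Longrightarrow> v \<in> R \<Longrightarrow> b \<in> coord v \<Longrightarrow> v \<in> word {b}"
  by (simp add: word_def trace_def coord_def)

lemma two_le_card_coord:
  assumes "v \<in> R" "v \<notin> B"
  shows "2 \<le> card (coord v)"
proof (rule ccontr)
  assume "\<not> ?thesis"
  then have "card (coord v) = 0 \<or> card (coord v) = 1" by linarith
  moreover have "finite (coord v)" using coord_subset finite_B finite_subset by blast
  ultimately have "coord v = {} \<or> (\<exists>b. coord v = {b})" by (auto simp: card_1_singleton_iff)
  then show False
  proof
    assume "coord v = {}"
    then have "v = 0" using sum_coord[OF assms(1)] by simp
    then show False using assms(1) zero_notin by simp
  next
    assume "\<exists>b. coord v = {b}"
    then obtain b where "coord v = {b}" by auto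
    then have "v = b" "b \<in> B" using sum_coord[OF assms(1)] coord_subset[of v] by auto
    then show False using assms(2) by simp
  qed
qed

text \<open>In matroid terms the \<open>b\<close> with \<open>word {b} = {b}\<close> are coloops: no
  other vector of \<open>R\<close> has \<open>b\<close> among its coordinates. A vector outside the
  basis has at least two coordinates, and none of them is a coloop.\<close>

lemma card_coloops:
  assumes "R \<noteq> B"
  shows "card {b\<in>B. word {b} = {b}} + 2 \<le> card B"
proof -
  obtain v where v: "v \<in> R" "v \<notin> B" using assms B_subset by auto
  have "word {b} \<noteq> {b}" if "b \<in> coord v" for b
    using mem_word_singleton[of b v] that v coord_subset[of v] by auto
  then have "{b\<in>B. word {b} = {b}} \<subseteq> B - coord v" by auto
  then have "card {b\<in>B. word {b} = {b}} \<le> card (B - coord v)"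
    using finite_B by (intro card_mono) auto
  also have "\<dots> = card B - card (coord v)"
    using coord_subset finite_B finite_subset by (intro card_Diff_subset) blast+
  finally have "card {b\<in>B. word {b} = {b}} \<le> card B - card (coord v)" .
  moreover have "card (coord v) \<le> card B" using coord_subset finite_B by (intro card_mono)
  ultimately show ?thesis using two_le_card_coord[OF v] by linarith
qed

text \<open>Parity of the size is linear on the code: adding one fixed odd word sends odd words
  injectively to even ones.\<close>

lemma card_odd_words:
  "2 * card {U. U \<subseteq> B \<and> odd (card (word U))} \<le> 2 ^ card B"
proof (cases "\<exists>D\<subseteq>B. odd (card (word D))")
  case True
  then obtain D where D: "D \<subseteq> B" "odd (card (word D))" by auto
  let ?O = "{U. U \<subseteq> B \<and> odd (card (word U))}" and ?E = "{U. U \<subseteq> B \<and> even (card (word U))}"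
  have "inj_on (\<lambda>U. sym_diff U D) ?O" by (auto simp: inj_on_def)
  moreover have "(\<lambda>U. sym_diff U D) ` ?O \<subseteq> ?E"
  proof clarify
    fix U assume U: "U \<subseteq> B" "odd (card (word U))"
    then have "even (card (word (sym_diff U D)))"
      using D even_card_sym_diff[OF finite_word finite_word, of U D] word_sym_diff[of U D] by simp
    then show "sym_diff U D \<subseteq> B \<and> even (card (word (sym_diff U D)))" using U D by auto
  qed
  ultimately have "card ?O \<le> card ?E" using finite_B by (intro card_inj_on_le) auto
  moreover have "card ?O + card ?E = card (?O \<union> ?E)"
    using finite_B by (intro card_Un_disjoint[symmetric]) auto
  moreover have "?O \<union> ?E = Pow B" by auto
  ultimately show ?thesis using finite_B by (simp add: card_Pow)
next
  case False
  then have "{U. U \<subseteq> B \<and> odd (card (word U))} = {}" by auto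
  then show ?thesis by (simp only: card.empty)
qed

lemma word_basis:
  assumes "R = B" "U \<subseteq> B"
  shows "word U = U"
  using word_Int[OF assms(2)] word_subset[of U] assms by auto

lemma sum_basis_nonzero:
  assumes "U \<subseteq> B" "U \<noteq> {}"
  shows "\<Sum>U \<noteq> 0"
proof
  assume z: "\<Sum>U = 0"
  obtain b where b: "b \<in> U" using assms by auto
  have "finite U" using assms finite_B finite_subset by blast
  have "dot n (d b) (\<Sum>U) = (\<Sum>c\<in>U. if c = b then 1 else 0)"
    unfolding dot_sum_right
  proof (rule sum.cong)
    fix c assume "c \<in> U"
    then have "b \<in> B" "c \<in> B" using assms(1) b by auto
    then show "dot n (d b) c = (if c = b then 1 else 0)" using dual[of b c] by auto
  qed simp
  then show False using z b \<open>finite U\<close> by simp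
qed

end

subsection \<open>The spectral gap\<close>

text \<open>
  The values on sets of size at most three are forced up to the last one: they make the
  eigenvalues of all subsets of a Schur triple equal to \<open>-1/7\<close>. The perturbation on sets of size
  four pushes up the eigenvalues of two further kinds of sets, four independent vectors and the
  Fano plane without two points, which would otherwise be extremal as well.
\<close>

definition level_weight :: "nat \<Rightarrow> real" where
  "level_weight k = (if k = 0 then 1 else if k = 1 then - 5 / 7 else if k = 2 then - 1 / 7
     else if k = 3 then 3 / 28 else 0)"

definition trace_weight :: "vec2 set \<Rightarrow> real" where
  "trace_weight J = level_weight (card J)
     + (if card J = 4 then if \<Sum>J = 0 then - 1 / 112 else 1 / 112 else 0)"

lemma trace_weight_simps:
  "trace_weight {} = 1"
  "card J = 1 \<Longrightarrow> trace_weight J = - 5 / 7"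
  "card J = 2 \<Longrightarrow> trace_weight J = - 1 / 7"
  "card J = 3 \<Longrightarrow> trace_weight J = 3 / 28"
  "card J = 4 \<Longrightarrow> \<Sum>J = 0 \<Longrightarrow> trace_weight J = - 1 / 112"
  "card J = 4 \<Longrightarrow> \<Sum>J \<noteq> 0 \<Longrightarrow> trace_weight J = 1 / 112"
  "5 \<le> card J \<Longrightarrow> trace_weight J = 0"
  by (simp_all add: trace_weight_def level_weight_def)

lemma trace_weight_cases:
  obtains "card J = 0" "7 * trace_weight J = 7" | "card J = 1" "7 * trace_weight J = -5"
  | "card J = 2" "7 * trace_weight J = -1" | "card J = 3" "7 * trace_weight J = 3 / 4"
  | "4 \<le> card J" "- (1 / 16) \<le> 7 * trace_weight J" "7 * trace_weight J \<le> 1 / 16"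
proof -
  consider "card J = 0" | "card J = 1" | "card J = 2" | "card J = 3" | "4 \<le> card J" by linarith
  then show thesis
    by cases (auto intro: that simp: trace_weight_def level_weight_def)
qed

lemma sum_if_card_eq:
  assumes "finite B"
  shows "(\<Sum>U\<in>Pow B. if card U = k then c else (0::real)) = c * real (card B choose k)"
proof -
  have "(\<Sum>U\<in>Pow B. if card U = k then c else 0) = (\<Sum>U\<in>{U. U \<subseteq> B \<and> card U = k}. c)"
    by (rule sum_if_Pow[OF assms])
  then show ?thesis using n_subsets[OF assms, of k] by simp
qed

lemma sum_if_eq_Pow:
  assumes "finite B" "U\<^sub>0 \<subseteq> B"
  shows "(\<Sum>U\<in>Pow B. if U = U\<^sub>0 then c else (0::real)) = c"
  using assms by (simp add: sum.delta)

lemma binomial_bounds: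
  assumes "5 \<le> (r::nat)"
  shows "40 * r + 8 * (r choose 2) \<le> 56 + 7 * 2 ^ r"
    and "56 + 6 * (r + (r choose 2) + (r choose 3)) \<le> 7 * 2 ^ r"
proof -
  \<comment> \<open>The middle inequality is the increment of the first one and has to be carried
    along; the last one bounds its own increment.\<close>
  have "40 * r + 8 * (r choose 2) \<le> 56 + 7 * 2 ^ r \<and> 40 + 8 * r \<le> 7 * 2 ^ r \<and>
      56 + 6 * (r + (r choose 2) + (r choose 3)) \<le> 7 * 2 ^ r"
    using assms
  proof (induction r rule: dec_induct)
    case base
    show ?case by (simp add: numeral_eq_Suc)
  next
    case (step r)
    have "Suc r choose 2 = r + (r choose 2)" "Suc r choose 3 = (r choose 2) + (r choose 3)"
      by (simp_all add: numeral_2_eq_2 numeral_3_eq_3)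
    then show ?case using step by simp
  qed
  then show "40 * r + 8 * (r choose 2) \<le> 56 + 7 * 2 ^ r"
    and "56 + 6 * (r + (r choose 2) + (r choose 3)) \<le> 7 * 2 ^ r" by auto
qed

lemma of_nat_bit_eq_1_iff: "(of_nat k :: bit) = 1 \<longleftrightarrow> odd k"
proof (induction k)
  case (Suc k)
  then show ?case using bit_cases[of "of_nat k"] by (auto simp del: of_nat_eq_1_iff)
qed simp

lemma Collect_mem_insert:
  "{b. b \<in> insert a A \<and> P b} = (if P a then insert a {b. b \<in> A \<and> P b} else {b. b \<in> A \<and> P b})"
  by auto

section \<open>Bounds for the weight sum over the code\<close>

context dual_frame
begin

lemma finite_subset_B: "U \<subseteq> B \<Longrightarrow> finite U"
  using finite_B finite_subset by blast

lemma mem_word_iff: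
  assumes "U \<subseteq> B" "v \<in> R"
  shows "v \<in> word U \<longleftrightarrow> odd (card (coord v \<inter> U))"
proof -
  have "dot n (\<Sum>b\<in>U. d b) v = (\<Sum>b\<in>U. if dot n (d b) v = 1 then 1 else 0)"
    unfolding dot_sum_left by (rule sum.cong) (use bit_cases in auto)
  also have "\<dots> = (\<Sum>b\<in>{b\<in>U. dot n (d b) v = 1}. 1)"
    by (rule sum.inter_filter[OF finite_subset_B[OF assms(1)], symmetric])
  also have "\<dots> = of_nat (card {b\<in>U. dot n (d b) v = 1})" by simp
  also have "{b\<in>U. dot n (d b) v = 1} = coord v \<inter> U" using assms by (auto simp: coord_def)
  finally show ?thesis using assms by (simp add: word_def trace_def of_nat_bit_eq_1_iff)
qed

lemma coord_basis:
  assumes "b \<in> B"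
  shows "coord b = {b}"
  using assms dual[of _ b] by (auto simp: coord_def split: if_splits)

lemma card_word_eq_0_iff:
  assumes "U \<subseteq> B"
  shows "card (word U) = 0 \<longleftrightarrow> U = {}"
proof -
  have "card (word U) = 0 \<longleftrightarrow> word U = {}" using finite_word by simp
  then show ?thesis using word_Int[OF assms] by auto
qed

text \<open>As \<open>word U\<close> contains \<open>U\<close>, words of size one or two come only
  from sets \<open>U\<close> of at most that size. A word of size one is a coloop, which costs 4
  more than the 1 charged to every singleton; words of size three or more cost at most 1/16.\<close>

lemma sum_trace_weight_lower:
  defines "k \<equiv> card {b\<in>B. word {b} = {b}}"
  shows "7 - 4 * real k - real (card B) - real (card B choose 2) - 2 ^ card B / 16
    \<le> (\<Sum>U\<in>Pow B. 7 * trace_weight (word U))"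
proof -
  define C where "C = (\<lambda>b. {b}) ` {b\<in>B. word {b} = {b}}"
  have C: "C \<subseteq> Pow B" "card C = k" by (auto simp: C_def k_def card_image)
  have "(\<Sum>U\<in>Pow B. (if card U = 0 then 7 else 0) + (if card U = 1 then -1 else 0)
     + (if card U = 2 then -1 else 0) + (if U \<in> C then -4 else 0) - 1 / 16)
     \<le> (\<Sum>U\<in>Pow B. 7 * trace_weight (word U))"
  proof (rule sum_mono)
    fix U assume "U \<in> Pow B"
    then have U: "U \<subseteq> B" by simp
    have le: "card U \<le> card (word U)" by (rule card_le_card_word[OF U])
    have coloop: "U \<in> C" if "card (word U) = 1" "card U = 1"
    proof -
      obtain b where b: "U = {b}" using \<open>card U = 1\<close> by (auto simp: card_1_singleton_iff)
      then have "b \<in> word U" using word_Int[OF U] by auto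
      then have "word U = {b}" using \<open>card (word U) = 1\<close> by (auto simp: card_1_singleton_iff)
      then show ?thesis using b U by (auto simp: C_def)
    qed
    have nil: "card (word U) = 0 \<longleftrightarrow> card U = 0"
      using card_word_eq_0_iff[OF U] finite_subset_B[OF U] by simp
    show "(if card U = 0 then 7 else 0) + (if card U = 1 then -1 else 0)
     + (if card U = 2 then -1 else 0) + (if U \<in> C then -4 else 0) - 1 / 16
     \<le> 7 * trace_weight (word U)"
      by (cases "word U" rule: trace_weight_cases) (use le coloop nil in auto)
  qed
  moreover have "(\<Sum>U\<in>Pow B. if U \<in> C then -4 else (0::real)) = - 4 * real k"
  proof -
    have "{U. U \<subseteq> B \<and> U \<in> C} = C" using C by auto
    then show ?thesis using C finite_B by (simp add: sum_if_Pow)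
  qed
  ultimately show ?thesis
    using finite_B by (simp add: sum.distrib sum_subtractf sum_if_card_eq card_Pow)
qed

text \<open>Apart from the empty word, only words of size three contribute more than 1/16, and these
  come from sets \<open>U\<close> with at most three elements.\<close>

lemma sum_trace_weight_upper:
  "(\<Sum>U\<in>Pow B. 7 * trace_weight (word U))
    \<le> 7 + 3 / 4 * real (card B + (card B choose 2) + (card B choose 3)) + 2 ^ card B / 16"
proof -
  have "(\<Sum>U\<in>Pow B. 7 * trace_weight (word U))
    \<le> (\<Sum>U\<in>Pow B. (if card U = 0 then 7 else 0) + (if card U = 1 then 3 / 4 else 0)
     + (if card U = 2 then 3 / 4 else 0) + (if card U = 3 then 3 / 4 else 0) + 1 / 16)"
  proof (rule sum_mono)
    fix U assume "U \<in> Pow B"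
    then have U: "U \<subseteq> B" by simp
    have le: "card U \<le> card (word U)" by (rule card_le_card_word[OF U])
    have nil: "card (word U) = 0 \<longleftrightarrow> card U = 0"
      using card_word_eq_0_iff[OF U] finite_subset_B[OF U] by simp
    have "card (word U) = 3 \<Longrightarrow> card U = 0 \<or> card U = 1 \<or> card U = 2 \<or> card U = 3" using le by auto
    then show "7 * trace_weight (word U) \<le> (if card U = 0 then 7 else 0)
     + (if card U = 1 then 3 / 4 else 0)
     + (if card U = 2 then 3 / 4 else 0) + (if card U = 3 then 3 / 4 else 0) + 1 / 16"
      by (cases "word U" rule: trace_weight_cases) (use nil in auto)
  qed
  then show ?thesis
    using finite_B by (simp add: sum.distrib sum_if_card_eq card_Pow algebra_simps)
qed

text \<open>Meant for rank four, where the count by size gives 37/2 and exceeds 16. Words of size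
  three are odd, so at most half of all words contribute 3/4.\<close>

lemma sum_trace_weight_upper_parity:
  "(\<Sum>U\<in>Pow B. 7 * trace_weight (word U)) \<le> 7 + 7 / 16 * 2 ^ card B"
proof -
  have "(\<Sum>U\<in>Pow B. 7 * trace_weight (word U))
    \<le> (\<Sum>U\<in>Pow B. (if card U = 0 then 7 else 0) + (if odd (card (word U)) then 3 / 4 else 0) + 1 / 16)"
  proof (rule sum_mono)
    fix U assume "U \<in> Pow B"
    then have U: "U \<subseteq> B" by simp
    have nil: "card (word U) = 0 \<longleftrightarrow> card U = 0"
      using card_word_eq_0_iff[OF U] finite_subset_B[OF U] by simp
    show "7 * trace_weight (word U)
        \<le> (if card U = 0 then 7 else 0) + (if odd (card (word U)) then 3 / 4 else 0) + 1 / 16"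
      by (cases "word U" rule: trace_weight_cases) (use nil in auto)
  qed
  also have "\<dots> = 7 + 3 / 4 * real (card {U. U \<subseteq> B \<and> odd (card (word U))}) + 2 ^ card B / 16"
    using finite_B by (simp add: sum.distrib sum_if_card_eq sum_if_Pow card_Pow)
  also have "\<dots> \<le> 7 + 7 / 16 * 2 ^ card B"
  proof -
    have "real (2 * card {U. U \<subseteq> B \<and> odd (card (word U))}) \<le> real (2 ^ card B)"
      using card_odd_words by (rule of_nat_mono)
    then show ?thesis by simp
  qed
  finally show ?thesis .
qed

text \<open>On a basis every set is its own word. Rank four yields -16 + 1/16, which is exactly
  -255/256 times 16: the perturbation on four independent vectors sets the size of the spectral
  gap.\<close>

lemma sum_trace_weight_basis:
  assumes "R = B" "card B \<le> 4"
  shows "(\<Sum>U\<in>Pow B. 7 * trace_weight (word U))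
    = 7 - 5 * real (card B) - real (card B choose 2) + 3 / 4 * real (card B choose 3)
      + real (card B choose 4) / 16"
proof -
  have "(\<Sum>U\<in>Pow B. 7 * trace_weight (word U))
    = (\<Sum>U\<in>Pow B. (if card U = 0 then 7 else 0) + (if card U = 1 then -5 else 0)
     + (if card U = 2 then -1 else 0) + (if card U = 3 then 3 / 4 else 0) + (if card U = 4 then 1 / 16 else 0))"
  proof (rule sum.cong)
    fix U assume "U \<in> Pow B"
    then have U: "U \<subseteq> B" by simp
    have fin: "finite U" by (rule finite_subset_B[OF U])
    have w: "word U = U" by (rule word_basis[OF assms(1) U])
    have "card U \<le> 4" using card_mono[OF finite_B U] assms(2) by simp
    then consider "card U = 0" | "card U = 1" | "card U = 2" | "card U = 3" | "card U = 4"
      by linarith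
    then show "7 * trace_weight (word U) = (if card U = 0 then 7 else 0) + (if card U = 1 then -5 else 0)
     + (if card U = 2 then -1 else 0) + (if card U = 3 then 3 / 4 else 0) + (if card U = 4 then 1 / 16 else 0)"
    proof cases
      case 5
      then have "U \<noteq> {}" by auto
      then show ?thesis using 5 sum_basis_nonzero[OF U] by (simp add: w trace_weight_simps)
    qed (use fin in \<open>simp_all add: w trace_weight_simps\<close>)
  qed simp
  then show ?thesis
    using finite_B by (simp add: sum.distrib sum_if_card_eq)
qed

text \<open>Every nonempty word is charged 3/4; the corrections -7/4 and -13/16 replace this by the
  true values -1 for size two and -1/16 for four vectors with sum zero.\<close>

lemma sum_trace_weight_upper_three_words:
  assumes "U\<^sub>1 \<subseteq> B" "U\<^sub>2 \<subseteq> B" "U\<^sub>3 \<subseteq> B" "distinct [{}, U\<^sub>1, U\<^sub>2, U\<^sub>3]"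
    and "card (word U\<^sub>1) = 2" "card (word U\<^sub>2) = 2" "card (word U\<^sub>3) = 4" "\<Sum>(word U\<^sub>3) = 0"
  shows "(\<Sum>U\<in>Pow B. 7 * trace_weight (word U)) \<le> 3 / 4 * 2 ^ card B + 31 / 16"
proof -
  have "(\<Sum>U\<in>Pow B. 7 * trace_weight (word U))
    \<le> (\<Sum>U\<in>Pow B. 3 / 4 + (if U = {} then 25 / 4 else 0) + (if U = U\<^sub>1 then - 7 / 4 else 0)
       + (if U = U\<^sub>2 then - 7 / 4 else 0) + (if U = U\<^sub>3 then - 13 / 16 else 0))"
  proof (rule sum_mono)
    fix U assume "U \<in> Pow B"
    then have U: "U \<subseteq> B" by simp
    have "7 * trace_weight (word U) \<le> 3 / 4" if "U \<noteq> {}"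
      by (cases "word U" rule: trace_weight_cases) (use card_word_eq_0_iff[OF U] that in auto)
    then show "7 * trace_weight (word U)
      \<le> 3 / 4 + (if U = {} then 25 / 4 else 0) + (if U = U\<^sub>1 then - 7 / 4 else 0)
       + (if U = U\<^sub>2 then - 7 / 4 else 0) + (if U = U\<^sub>3 then - 13 / 16 else 0)"
      using assms by (auto simp: trace_weight_simps)
  qed
  then show ?thesis
    using assms finite_B by (simp add: sum.distrib sum_if_eq_Pow card_Pow)
qed

lemma coord_inject:
  assumes "u \<in> R" "v \<in> R" "coord u = coord v"
  shows "u = v"
proof -
  have "u = \<Sum>(coord u)" by (rule sum_coord[OF assms(1)])
  also have "\<dots> = v" unfolding assms(3) by (rule sum_coord[OF assms(2), symmetric])
  finally show ?thesis .
qed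

text \<open>The two ways to write the Fano plane without two points in terms of a basis.\<close>

lemma sum_trace_weight_five:
  assumes xyz: "distinct [x, y, z]" "B = {x, y, z}" and R: "R = {x, y, z, u, v}"
    and uv: "u \<notin> B" "v \<notin> B"
    and coords: "coord u = {x, y} \<and> (coord v = {x, z} \<or> coord v = {x, y, z})"
  shows "(\<Sum>U\<in>Pow B. 7 * trace_weight (word U)) \<le> 127 / 16"
proof -
  have u: "u \<in> R" "v \<in> R" using R by auto
  have ne: "u \<noteq> v" using coords xyz by (auto simp: insert_eq_iff doubleton_eq_iff)
  have cs: "coord x = {x}" "coord y = {y}" "coord z = {z}" using coord_basis xyz by auto
  have mem: "b \<in> word U \<longleftrightarrow> odd (card (coord b \<inter> U))" if "U \<subseteq> B" "b \<in> R" for U b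
    using mem_word_iff[OF that] .
  have word_eq: "word U = {b\<in>{x, y, z, u, v}. odd (card (coord b \<inter> U))}" if "U \<subseteq> B" for U
    using mem[OF that] word_subset[of U] R by auto
  have ds: "x \<noteq> y" "y \<noteq> x" "x \<noteq> z" "z \<noteq> x" "y \<noteq> z" "z \<noteq> y" "u \<noteq> v" "v \<noteq> u"
    "u \<noteq> x" "u \<noteq> y" "u \<noteq> z" "x \<noteq> u" "y \<noteq> u" "z \<noteq> u"
    "v \<noteq> x" "v \<noteq> y" "v \<noteq> z" "x \<noteq> v" "y \<noteq> v" "z \<noteq> v"
    using xyz uv ne by auto
  have sub: "{y} \<subseteq> B" "{z} \<subseteq> B" "{y, z} \<subseteq> B" "{x, y} \<subseteq> B" "{x, y, z} \<subseteq> B"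
    using xyz by auto
  have u_coord: "coord u = {x, y}" using coords by simp
  have u_sum: "u = x + y" using sum_coord[OF u(1)] coords xyz by simp
  \<comment> \<open>Without the perturbation the bound would be 8 = 2^3, that is, eigenvalue -1/7;
    the word of size four with sum zero lowers it by 1/16.\<close>
  have B8: "3 / 4 * 2 ^ card B + 31 / 16 = (127 / 16 :: real)" using xyz by simp
  from coords consider "coord v = {x, z}" | "coord v = {x, y, z}" by auto
  then show ?thesis
  proof cases
    case 1
    have v_sum: "v = x + z" using sum_coord[OF u(2)] 1 xyz by simp
    have w: "word {y} = {y, u}" "word {z} = {z, v}" "word {y, z} = {y, z, u, v}"
      unfolding word_eq[OF sub(1)] word_eq[OF sub(2)] word_eq[OF sub(3)] Collect_mem_insert
      by (simp_all add: cs u_coord 1 ds Int_insert_left)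
    have "\<Sum>(word {y, z}) = y + (z + (u + v))" unfolding w by (simp add: ds)
    also have "\<dots> = 0" unfolding u_sum v_sum by (simp add: ac_simps)
    finally have "(\<Sum>U\<in>Pow B. 7 * trace_weight (word U)) \<le> 3 / 4 * 2 ^ card B + 31 / 16"
      by (intro sum_trace_weight_upper_three_words[of "{y}" "{z}" "{y, z}"] sub)
        (simp_all add: w ds doubleton_eq_iff)
    then show ?thesis using B8 by simp
  next
    case 2
    have v_sum: "v = x + (y + z)" using sum_coord[OF u(2)] 2 xyz by simp
    have w: "word {z} = {z, v}" "word {x, y} = {x, y}" "word {x, y, z} = {x, y, z, v}"
      unfolding word_eq[OF sub(2)] word_eq[OF sub(4)] word_eq[OF sub(5)] Collect_mem_insert
      by (simp_all add: cs u_coord 2 ds Int_insert_left)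
    have "\<Sum>(word {x, y, z}) = x + (y + (z + v))" unfolding w by (simp add: ds)
    also have "\<dots> = 0" unfolding v_sum by (simp add: ac_simps)
    finally have "(\<Sum>U\<in>Pow B. 7 * trace_weight (word U)) \<le> 3 / 4 * 2 ^ card B + 31 / 16"
      by (intro sum_trace_weight_upper_three_words[of "{z}" "{x, y}" "{x, y, z}"] sub)
        (simp_all add: w ds doubleton_eq_iff insert_eq_iff)
    then show ?thesis using B8 by simp
  qed
qed

lemma insert_zero_subset_sums: "insert 0 R \<subseteq> Sum ` Pow B"
proof
  fix v assume "v \<in> insert 0 R"
  then show "v \<in> Sum ` Pow B"
  proof
    assume "v = 0"
    then have "v = \<Sum>{}" by simp
    then show ?thesis by blast
  next
    assume "v \<in> R"
    then have "v = \<Sum>(coord v)" by (rule sum_coord)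
    then show ?thesis using coord_subset by blast
  qed
qed

lemma card_R_less: "Suc (card R) \<le> 2 ^ card B"
proof -
  have "card (insert 0 R) \<le> card (Sum ` Pow B)"
    using insert_zero_subset_sums finite_B by (intro card_mono) auto
  also have "\<dots> \<le> card (Pow B)" using finite_B by (intro card_image_le) auto
  finally show ?thesis using zero_notin finite_R finite_B by (simp add: card_Pow)
qed

text \<open>Here \<open>R\<close> is its whole span without 0 and the code is the simplex code.
  Translation by some \<open>b\<close> in \<open>U\<close> moves the vectors where the functional is
  0 into those where it is 1.\<close>

lemma card_word_full:
  assumes full: "Suc (card R) = 2 ^ card B" and U: "U \<subseteq> B" "U \<noteq> {}"
  shows "2 ^ card B \<le> 2 * card (word U)"
proof -
  have "card (Sum ` Pow B) \<le> card (insert 0 R)"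
    using full zero_notin finite_R finite_B card_image_le[of "Pow B" Sum] by (simp add: card_Pow)
  then have eq: "insert 0 R = Sum ` Pow B"
    using insert_zero_subset_sums finite_B by (intro card_seteq) auto
  obtain b where b: "b \<in> U" using U by auto
  then have bB: "b \<in> B" using U by auto
  let ?a = "\<Sum>b\<in>U. d b"
  have "(\<lambda>v. v + b) ` (insert 0 R - word U) \<subseteq> word U"
  proof clarify
    fix v assume v: "v \<in> insert 0 R" "v \<notin> word U"
    then obtain C where C: "C \<subseteq> B" "v = \<Sum>C" using eq by auto
    have "finite C" using C finite_subset_B by auto
    then have "v + b = \<Sum>(sym_diff C {b})"
      using C by (cases "b \<in> C") (auto simp: sum.remove add.commute Un_absorb2 insert_absorb Diff_insert_absorb Un_commute)
    then have "v + b \<in> insert 0 R" using C bB unfolding eq by auto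
    moreover have "dot n ?a v = 0"
      using v bit_cases[of "dot n ?a v"] by (auto simp: word_def trace_def)
    then have "dot n ?a (v + b) = 1" using b dot_sum_d[OF U(1) bB] by (simp add: dot_add_right)
    ultimately show "v + b \<in> word U" by (auto simp: word_def trace_def)
  qed
  then have "card (insert 0 R - word U) \<le> card (word U)"
    by (rule card_inj_on_le[OF _ _ finite_word, rotated]) (auto simp: inj_on_def)
  moreover have "card (insert 0 R - word U) = card (insert 0 R) - card (word U)"
    using word_subset finite_word by (intro card_Diff_subset) auto
  ultimately show ?thesis using full zero_notin finite_R by simp
qed

text \<open>One non-basis vector is the sum of two basis vectors p and q. With s the third basis
  vector, the other is p + s, q + s or p + q + s, and exchanging p and q merges the first two
  cases.\<close>

lemma sum_trace_weight_five':
  assumes cB: "card B = 3" and R: "R = B \<union> {u, v}" and uv: "u \<notin> B" "v \<notin> B" "u \<noteq> v"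
    and cu: "card (coord u) = 2"
  shows "(\<Sum>U\<in>Pow B. 7 * trace_weight (word U)) \<le> 127 / 16"
proof -
  have u: "u \<in> R" "v \<in> R" using R by auto
  obtain p q where pq: "coord u = {p, q}" "p \<noteq> q" using cu by (auto simp: card_2_iff)
  have sub: "{p, q} \<subseteq> B" using coord_subset[of u] pq by simp
  have "card (B - {p, q}) = 1" using card_Diff_subset[of "{p, q}" B] sub cB pq by simp
  then obtain s where s: "B - {p, q} = {s}" by (auto simp: card_1_singleton_iff)
  have B: "B = {p, q, s}" "distinct [p, q, s]" using s sub pq by auto
  have "coord v \<subseteq> {p, q, s}" using coord_subset[of v] B by simp
  moreover have "2 \<le> card (coord v)" by (rule two_le_card_coord[OF u(2) uv(2)])
  moreover have "coord v \<noteq> {p, q}" using coord_inject[OF u] uv(3) pq by auto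
  ultimately have cv: "coord v \<subseteq> {p, q, s}" "2 \<le> card (coord v)" "coord v \<noteq> {p, q}" by auto
  have two: "coord v = {a, b}" if "coord v \<subseteq> {a, b}" for a b
  proof (rule card_seteq)
    show "card {a, b} \<le> card (coord v)" using cv(2) card_length[of "[a, b]"] by simp
  qed (use that in auto)
  have "coord v = {p, s} \<or> coord v = {q, s} \<or> coord v = {p, q, s}"
  proof (cases "p \<in> coord v \<and> q \<in> coord v")
    case True
    then have "coord v = {p, q} \<or> coord v = {p, q, s}" using cv(1) by blast
    then show ?thesis using cv(3) by simp
  next
    case False
    then have "coord v \<subseteq> {q, s} \<or> coord v \<subseteq> {p, s}" using cv(1) by blast
    then show ?thesis using two by blast
  qed
  then consider "coord v = {p, s} \<or> coord v = {p, q, s}" | "coord v = {q, s}" by auto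
  then show ?thesis
  proof cases
    case 1
    show ?thesis
    proof (rule sum_trace_weight_five[of p q s u v])
      show "R = {p, q, s, u, v}" using R B(1) by blast
      show "coord u = {p, q} \<and> (coord v = {p, s} \<or> coord v = {p, q, s})" using 1 pq(1) by blast
    qed (fact B uv)+
  next
    case 2
    show ?thesis
    proof (rule sum_trace_weight_five[of q p s u v])
      show "distinct [q, p, s]" "B = {q, p, s}" using B by auto
      show "R = {q, p, s, u, v}" using R B(1) by blast
      show "coord u = {q, p} \<and> (coord v = {q, s} \<or> coord v = {q, p, s})" using 2 pq(1) by blast
    qed (fact uv)+
  qed
qed

text \<open>Even sets have positive sign, so the sum must be bounded below. Bases of rank two and
  four, consisting of coloops only, are evaluated exactly. An even set that is not a basis has rank
  at least three and at least two basis vectors that are not coloops, so counting by size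
  suffices.\<close>

lemma sum_trace_weight_even:
  assumes "R \<noteq> {}" "even (card R)"
  shows "- (2 ^ card B) \<le> (\<Sum>U\<in>Pow B. 7 * trace_weight (word U))"
    and "card R \<noteq> 2 \<Longrightarrow> - (255 / 256 * 2 ^ card B) \<le> (\<Sum>U\<in>Pow B. 7 * trace_weight (word U))"
proof -
  let ?r = "card B" and ?k = "card {b\<in>B. word {b} = {b}}"
  let ?S = "\<Sum>U\<in>Pow B. 7 * trace_weight (word U)"
  have BR: "card B \<le> card R" using B_subset finite_R by (rule card_mono[rotated])
  have RB: "card R = card B \<Longrightarrow> R = B" using B_subset finite_R by (metis card_subset_eq)
  have "- (255 / 256 * 2 ^ ?r) \<le> ?S \<or> (card R = 2 \<and> - (2 ^ ?r) \<le> ?S)"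
  proof (cases "R = B")
    case True
    have "?r \<noteq> 0" using assms(1) True finite_B by simp
    moreover have "even ?r" using assms(2) True by simp
    ultimately have "?r = 2 \<or> ?r = 4 \<or> 5 \<le> ?r" by presburger
    then consider "?r = 2" | "?r = 4" | "5 \<le> ?r" by blast
    then show ?thesis
    proof cases
      case 1
      then show ?thesis using sum_trace_weight_basis[OF True] True by simp
    next
      case 2
      then show ?thesis using sum_trace_weight_basis[OF True] by (simp add: numeral_eq_Suc)
    next
      case 3
      have "?k \<le> ?r" using finite_B by (intro card_mono) auto
      moreover have "real (40 * ?r + 8 * (?r choose 2)) \<le> real (56 + 7 * 2 ^ ?r)"
        using binomial_bounds(1)[OF 3] by (rule of_nat_mono)
      moreover have "(0::real) \<le> 2 ^ ?r" by simp
      ultimately have "- (255 / 256 * 2 ^ ?r)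
          \<le> 7 - 4 * real ?k - real ?r - real (?r choose 2) - 2 ^ ?r / 16"
        unfolding of_nat_add of_nat_mult of_nat_power of_nat_numeral of_nat_le_iff[where ?'a = real, symmetric]
        by linarith
      then show ?thesis using sum_trace_weight_lower by simp
    qed
  next
    case False
    have k: "?k + 2 \<le> ?r" by (rule card_coloops[OF False])
    have "?r \<noteq> 2"
    proof
      assume "?r = 2"
      moreover have "card R \<noteq> card B" using RB False by auto
      ultimately have "card R = 3" using BR card_R_less by simp
      then show False using assms(2) by simp
    qed
    then consider "?r = 3" | "?r = 4" | "5 \<le> ?r" using k by linarith
    then have "- (255 / 256 * 2 ^ ?r) \<le> 7 - 4 * real ?k - real ?r - real (?r choose 2) - 2 ^ ?r / 16"
    proof cases
      case 1
      then have "real ?k \<le> 1" using k by simp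
      then show ?thesis using 1 by (simp add: numeral_eq_Suc)
    next
      case 2
      then have "real ?k \<le> 2" using k by simp
      then show ?thesis using 2 by (simp add: numeral_eq_Suc)
    next
      case 3
      moreover have "real (40 * ?r + 8 * (?r choose 2)) \<le> real (56 + 7 * 2 ^ ?r)"
        using binomial_bounds(1)[OF 3] by (rule of_nat_mono)
      moreover have "(0::real) \<le> 2 ^ ?r" by simp
      moreover have "real ?k \<le> real ?r" using k by simp
      ultimately show ?thesis
        unfolding of_nat_add of_nat_mult of_nat_power of_nat_numeral by linarith
    qed
    then show ?thesis using sum_trace_weight_lower by simp
  qed
  moreover have "(0::real) \<le> 2 ^ ?r" by simp
  ultimately show "- (2 ^ ?r) \<le> ?S" "card R \<noteq> 2 \<Longrightarrow> - (255 / 256 * 2 ^ ?r) \<le> ?S"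
    by linarith+
qed

text \<open>Outside a basis {x, y} the only nonzero vector of the span is x + y. The three nonempty
  words all have size two, so the sum is 7 - 3 = 2^2, the extremal value.\<close>

lemma sum_trace_weight_schur_triple:
  assumes "card B = 2" "R \<noteq> B"
  shows "schur_triple n R" "(\<Sum>U\<in>Pow B. 7 * trace_weight (word U)) = 4"
proof -
  obtain x y where xy: "B = {x, y}" "x \<noteq> y" using assms(1) by (auto simp: card_2_iff)
  obtain v where v: "v \<in> R" "v \<notin> B" using assms(2) B_subset by auto
  have co: "coord w = {x, y}" if "w \<in> R" "w \<notin> B" for w
    using two_le_card_coord[OF that] coord_subset[of w] xy
    by (intro card_seteq) auto
  have "w = v" if "w \<in> R" "w \<notin> B" for w
    by (rule coord_inject) (use that v co in auto)
  then have "R - B \<subseteq> {v}" by blast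
  then have R: "R = {x, y, v}" using v(1) B_subset xy(1) by blast
  have vxy: "v = x + y" using sum_coord[OF v(1)] co[OF v] xy by simp
  have ds: "x \<noteq> y" "y \<noteq> x" "v \<noteq> x" "v \<noteq> y" "x \<noteq> v" "y \<noteq> v" using xy v by auto
  have "schur_triple n {x, y, x + y}"
    unfolding schur_triple_def
  proof (rule bexI[of _ x], rule bexI[of _ y], intro conjI)
    show "x \<in> Z2n n" "y \<in> Z2n n" using R R_subset by auto
    show "distinct [x, y, x + y]" using ds unfolding vxy by simp
    show "0 \<notin> {x, y, x + y}" using zero_notin unfolding R vxy .
  qed simp
  then show "schur_triple n R" using R vxy by simp
  have cs: "coord x = {x}" "coord y = {y}" using coord_basis xy by auto
  have weq: "word U = {b. b \<in> {x, y, v} \<and> odd (card (coord b \<inter> U))}" if "U \<subseteq> B" for U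
  proof -
    have "word U = {b. b \<in> R \<and> odd (card (coord b \<inter> U))}"
    proof (rule set_eqI)
      fix b
      show "b \<in> word U \<longleftrightarrow> b \<in> {b. b \<in> R \<and> odd (card (coord b \<inter> U))}"
        by (cases "b \<in> R") (use mem_word_iff[OF that, of b] word_subset[of U] in auto)
    qed
    then show ?thesis unfolding R .
  qed
  have sub: "{x} \<subseteq> B" "{y} \<subseteq> B" "{x, y} \<subseteq> B" using xy by auto
  have w: "word {x} = {x, v}" "word {y} = {y, v}" "word {x, y} = {x, y}"
    unfolding weq[OF sub(1)] weq[OF sub(2)] weq[OF sub(3)] Collect_mem_insert
    by (simp_all add: cs co[OF v] ds Int_insert_left)
  have "Pow B = {{}, {x}, {y}, {x, y}}" using xy by (auto simp: Pow_insert)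
  moreover have "distinct [{}, {x}, {y}, {x, y}]" using ds by (simp add: doubleton_eq_iff)
  ultimately show "(\<Sum>U\<in>Pow B. 7 * trace_weight (word U)) = 4"
    by (simp add: w trace_weight_simps ds doubleton_eq_iff)
qed

text \<open>Odd sets have negative sign, so an upper bound is needed. The delicate rank is three,
  where an odd set is a basis, the Fano plane without two points or the whole plane; rank four is
  settled by parity and higher rank by counting.\<close>

lemma sum_trace_weight_odd:
  assumes "odd (card R)"
  shows "(\<Sum>U\<in>Pow B. 7 * trace_weight (word U)) \<le> 2 ^ card B"
    and "card R \<noteq> 1 \<Longrightarrow> \<not> schur_triple n R \<Longrightarrow>
      (\<Sum>U\<in>Pow B. 7 * trace_weight (word U)) \<le> 255 / 256 * 2 ^ card B"
proof -
  let ?r = "card B" and ?S = "\<Sum>U\<in>Pow B. 7 * trace_weight (word U)"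
  have BR: "card B \<le> card R" using B_subset finite_R by (rule card_mono[rotated])
  have RB: "card R = card B \<Longrightarrow> R = B" using B_subset finite_R by (metis card_subset_eq)
  have "?S \<le> 255 / 256 * 2 ^ ?r \<or> ((card R = 1 \<or> schur_triple n R) \<and> ?S \<le> 2 ^ ?r)"
  proof -
    consider "?r = 0" | "?r = 1" | "?r = 2" | "?r = 3" | "?r = 4" | "5 \<le> ?r" by linarith
    then show ?thesis
    proof cases
      case 1
      then have "card R = 0" using card_R_less by simp
      then show ?thesis using assms by simp
    next
      case 2
      then have "card R = 1" using BR card_R_less by simp
      moreover have "R = B" using RB 2 calculation by simp
      ultimately show ?thesis using sum_trace_weight_basis 2 by (simp add: numeral_eq_Suc)
    next
      case 3
      then have "R \<noteq> B" using assms by auto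
      then show ?thesis using sum_trace_weight_schur_triple[OF 3] 3 by simp
    next
      case 4
      show ?thesis
      proof (cases "R = B")
        case True
        then show ?thesis using sum_trace_weight_basis 4 by (simp add: numeral_eq_Suc)
      next
        case False
        have "3 < card R" using RB False 4 BR by force
        moreover have "card R \<le> 7" using card_R_less 4 by simp
        ultimately have "card R = 5 \<or> card R = 7" using assms by presburger
        then consider "card R = 5" | "card R = 7" by blast
        then show ?thesis
        proof cases
          case 1
          then have "card (R - B) = 2" using card_Diff_subset[OF finite_B B_subset] 4 by simp
          then obtain u v where uv: "R - B = {u, v}" "u \<noteq> v" by (auto simp: card_2_iff)
          then have R: "R = B \<union> {u, v}" "R = B \<union> {v, u}" "u \<notin> B" "v \<notin> B" using B_subset by auto
          have coords: "coord w = B" if "w \<in> R" "w \<notin> B" "card (coord w) \<noteq> 2" for w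
            using two_le_card_coord[OF that(1,2)] that(3) coord_subset[of w] 4 finite_B
            by (intro card_seteq) auto
          \<comment> \<open>\<open>coord\<close> is injective on \<open>R\<close>, so at most one of
            the two vectors is the sum of all of \<open>B\<close>; the other is a sum of two basis
            vectors.\<close>
          have "?S \<le> 127 / 16"
          proof (cases "card (coord u) = 2")
            case True
            then show ?thesis by (rule sum_trace_weight_five'[OF 4 R(1,3,4) uv(2)])
          next
            case False
            then have "coord u = B" using coords[of u] R by simp
            then have "coord v \<noteq> B" using coord_inject[of u v] R uv by blast
            then have "card (coord v) = 2" using coords[of v] R by auto
            then show ?thesis by (rule sum_trace_weight_five'[OF 4 R(2,4,3) uv(2)[symmetric]])
          qed
          then show ?thesis using 4 by simp
        next
          case 2
          have "?S \<le> (\<Sum>U\<in>Pow B. (if card U = 0 then 7 else 0) + 1 / 16)"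
          proof (rule sum_mono)
            fix U assume "U \<in> Pow B"
            then have U: "U \<subseteq> B" by simp
            show "7 * trace_weight (word U) \<le> (if card U = 0 then 7 else 0) + 1 / 16"
            proof (cases "U = {}")
              case False
              then have "4 \<le> card (word U)" using card_word_full[OF _ U] 2 4 by simp
              then show ?thesis by (cases "word U" rule: trace_weight_cases) auto
            qed (simp add: trace_weight_simps)
          qed
          also have "\<dots> = 15 / 2"
            using finite_B 4 by (simp add: sum.distrib sum_if_card_eq card_Pow)
          finally show ?thesis using 4 by simp
        qed
      qed
    next
      case 5
      then show ?thesis using sum_trace_weight_upper_parity by simp
    next
      case 6
      have "real (56 + 6 * (?r + (?r choose 2) + (?r choose 3))) \<le> real (7 * 2 ^ ?r)"
        using binomial_bounds(2)[OF 6] by (rule of_nat_mono)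
      moreover have "(0::real) \<le> 2 ^ ?r" by simp
      ultimately have "?S \<le> 255 / 256 * 2 ^ ?r"
        using sum_trace_weight_upper
        unfolding of_nat_add of_nat_mult of_nat_power of_nat_numeral by linarith
      then show ?thesis ..
    qed
  qed
  moreover have "(0::real) \<le> 2 ^ ?r" by simp
  ultimately show "?S \<le> 2 ^ ?r" "card R \<noteq> 1 \<Longrightarrow> \<not> schur_triple n R \<Longrightarrow> ?S \<le> 255 / 256 * 2 ^ ?r"
    by linarith+
qed

end

text \<open>The sign is the character of \<open>R\<close> at the full set: sets that agree exactly
  on \<open>K\<close> differ by a shift by the complement of \<open>K\<close>.\<close>

definition eigenvalue :: "nat \<Rightarrow> vec2 set \<Rightarrow> real" where
  "eigenvalue n R = (-1) ^ card R * (\<Sum>a\<in>Z2n n. trace_weight (trace n R a)) / 2 ^ n"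

definition extremal :: "nat \<Rightarrow> vec2 set \<Rightarrow> bool" where
  "extremal n R \<longleftrightarrow> R \<subseteq> Z2n n - {0} \<and> (R = {} \<or> card R = 1 \<or> card R = 2 \<or> schur_triple n R)"

lemma eigenvalue_empty: "eigenvalue n {} = 1"
  by (simp add: eigenvalue_def trace_def trace_weight_simps card_Z2n)

theorem eigenvalue_bounds:
  assumes "R \<subseteq> Z2n n" "0 \<notin> R" "R \<noteq> {}"
  shows "- 1 / 7 \<le> eigenvalue n R"
    and "\<not> extremal n R \<Longrightarrow> - 255 / 1792 \<le> eigenvalue n R"
proof -
  obtain B d where "dual_frame n R B d" by (rule exists_dual_frame[OF assms(1,2)])
  then interpret dual_frame n R B d .
  let ?S = "\<Sum>U\<in>Pow B. 7 * trace_weight (word U)"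
  have ex: "extremal n R" if "card R = 1 \<or> card R = 2 \<or> schur_triple n R"
    using that assms by (auto simp: extremal_def)
  have "?S = 7 * (\<Sum>U\<in>Pow B. trace_weight (word U))" by (rule sum_distrib_left[symmetric])
  moreover have "eigenvalue n R = (-1) ^ card R * ((\<Sum>U\<in>Pow B. trace_weight (word U)) / 2 ^ card B)"
    using expect_trace[of trace_weight] unfolding eigenvalue_def expect_def
    by (metis times_divide_eq_right)
  ultimately have "7 * eigenvalue n R = (-1) ^ card R * (?S / 2 ^ card B)" by simp
  then have ev: "7 * 2 ^ card B * eigenvalue n R = (-1) ^ card R * ?S" by (simp add: field_simps)
  have pos: "(0::real) < 2 ^ card B" by simp
  have "- (2 ^ card B) \<le> (-1) ^ card R * ?S"
    using sum_trace_weight_even(1)[OF assms(3)] sum_trace_weight_odd(1)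
    by (cases "even (card R)") auto
  then have "2 ^ card B * (- 1) \<le> 2 ^ card B * (7 * eigenvalue n R)" using ev by (simp add: mult_ac)
  then have "- 1 \<le> 7 * eigenvalue n R" using pos by (simp only: mult_le_cancel_left_pos)
  then show "- 1 / 7 \<le> eigenvalue n R" by simp
  assume "\<not> extremal n R"
  then have "- (255 / 256 * 2 ^ card B) \<le> (-1) ^ card R * ?S"
    using sum_trace_weight_even(2)[OF assms(3)] sum_trace_weight_odd(2) ex
    by (cases "even (card R)") auto
  then have "2 ^ card B * (- 255 / 256) \<le> 2 ^ card B * (7 * eigenvalue n R)"
    using ev by (simp add: mult_ac)
  then have "- 255 / 256 \<le> 7 * eigenvalue n R" using pos by (simp only: mult_le_cancel_left_pos)
  then show "- 255 / 1792 \<le> eigenvalue n R" by simp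
qed

subsection \<open>Agreeing families\<close>

text \<open>Pairing a dependency with \<open>a\<close> gives a sum of an odd number of ones, which
  is 1 rather than 0.\<close>

lemma no_odd_linear_dependency:
  assumes "\<And>v. v \<in> A \<Longrightarrow> v = 0 \<or> dot n a v = 1"
  shows "\<not> has_odd_linear_dependency A"
proof
  assume "has_odd_linear_dependency A"
  then obtain l :: nat and v where v: "\<And>i. i \<in> {1..2 * l + 1} \<Longrightarrow> v i \<in> A \<and> v i \<noteq> 0"
    and s: "(\<Sum>i = 1..2 * l + 1. v i) = 0"
    unfolding has_odd_linear_dependency_def by blast
  have "0 = dot n a (\<Sum>i = 1..2 * l + 1. v i)" unfolding s by simp
  also have "\<dots> = (\<Sum>i = 1..2 * l + 1. 1)"
    unfolding dot_sum_right by (rule sum.cong) (use v assms in blast)+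
  also have "\<dots> = of_nat (2 * l + 1)" by simp
  also have "\<dots> = 1" by (subst of_nat_bit_eq_1_iff) simp
  finally show False by simp
qed

lemma schur_triple_eq:
  assumes "schur_triple n X" "x \<in> X" "y \<in> X" "x \<noteq> y"
  shows "X = {x, y, x + y}"
proof -
  obtain p q where X: "X = {p, q, p + q}" using assms(1) unfolding schur_triple_def by blast
  have a: "q + p = p + q" "p + (p + q) = q" "q + (p + q) = p" "p + q + p = q" "p + q + q = p"
    by (simp_all add: ac_simps)
  show ?thesis
    using assms(2-4) unfolding X by (elim insertE emptyE; simp add: a insert_commute)
qed

lemma schur_tripleI:
  assumes "x \<in> Z2n n" "y \<in> Z2n n" "x \<noteq> 0" "y \<noteq> 0" "x \<noteq> y"
  shows "schur_triple n {x, y, x + y}"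
  unfolding schur_triple_def
proof (rule bexI[of _ x], rule bexI[of _ y], intro conjI)
  have "x \<noteq> x + y" "y \<noteq> x + y" "x + y \<noteq> 0"
    using assms by (metis add_cancel_left_right, metis add_cancel_right_left, metis vec2_add_eq_0_iff)
  then show "distinct [x, y, x + y]" "0 \<notin> {x, y, x + y}" using assms by auto
qed (use assms in auto)

lemma schur_triple_props:
  assumes "schur_triple n X"
  shows "card X = 3" "X \<subseteq> Z2n n" "0 \<notin> X"
  using assms unfolding schur_triple_def by (auto simp: add_in_Z2n)

lemma exists_dot_eq_1_1:
  assumes "x \<in> Z2n n" "y \<in> Z2n n" "x \<noteq> 0" "y \<noteq> 0"
  obtains a where "a \<in> Z2n n" "dot n a x = 1" "dot n a y = 1"
proof -
  obtain a where a: "a \<in> Z2n n" "dot n a x = 1" by (rule exists_dot_eq_1[OF assms(1,3)])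
  obtain b where b: "b \<in> Z2n n" "dot n b y = 1" by (rule exists_dot_eq_1[OF assms(2,4)])
  consider "dot n a y = 1" | "dot n b x = 1" | "dot n a y = 0" "dot n b x = 0"
    using bit_cases by blast
  then show thesis
  proof cases
    case 3
    then show thesis using a b by (intro that[of "a + b"]) (auto simp: dot_add_left add_in_Z2n)
  qed (use a b that in auto)
qed

lemma card_extremal:
  assumes "extremal n R"
  shows "card R \<le> 3"
  using assms schur_triple_props(1) unfolding extremal_def by fastforce

section \<open>Fourier coefficients of an agreeing family\<close>

locale agreeing =
  fixes n :: nat and F :: "vec2 set set"
  assumes agreeing: "odd_linear_dependency_agreeing n F"
begin

abbreviation "V \<equiv> Z2n n"

definition ind :: "vec2 set \<Rightarrow> real" where
  "ind S = of_bool (S \<in> F)"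

definition hat :: "vec2 set \<Rightarrow> real" where
  "hat R = fourier V ind R"

definition density :: real where
  "density = expect V ind"

definition signed_mass :: "vec2 set \<Rightarrow> real" where
  "signed_mass R = (-1) ^ card R * (hat R)\<^sup>2"

definition defect :: real where
  "defect = (\<Sum>R\<in>Pow V - Collect (extremal n). (hat R)\<^sup>2)"

text \<open>Dependencies may not use 0, so adjoining 0 to the hyperplane creates none. Traces on
  \<open>cut a\<close> thereby also record whether \<open>R\<close> contains 0.\<close>

definition cut :: "vec2 \<Rightarrow> vec2 set" where
  "cut a = {v\<in>V. v = 0 \<or> dot n a v = 1}"

lemma finite_V: "finite V" by (rule finite_Z2n)

lemma ind_01: "ind S = 0 \<or> ind S = 1"
  by (simp add: ind_def)

text \<open>The two sets agree exactly on \<open>K\<close>, which has no odd linear dependency, so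
  they cannot both belong to \<open>F\<close>.\<close>

lemma ind_shift:
  assumes "K \<subseteq> cut a" "S \<subseteq> V"
  shows "ind S * ind (sym_diff S (V - K)) = 0"
proof (rule ccontr)
  let ?T = "sym_diff S (V - K)"
  assume "\<not> ?thesis"
  then have "S \<in> F" "?T \<in> F" by (auto simp: ind_def)
  then have "has_odd_linear_dependency (V - sym_diff S ?T)"
    using agreeing unfolding odd_linear_dependency_agreeing_def by blast
  moreover have "V - sym_diff S ?T = K" using assms by (auto simp: cut_def)
  ultimately show False
    using no_odd_linear_dependency[of K n a] assms(1) by (auto simp: cut_def)
qed

lemma sum_signed_mass_walsh:
  assumes "K \<subseteq> cut a"
  shows "(\<Sum>R\<in>Pow V. signed_mass R * walsh R K) = 0"
proof -
  have KV: "K \<subseteq> V" using assms by (auto simp: cut_def)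
  have "0 = expect V (\<lambda>S. ind S * ind (sym_diff S (V - K)))"
    unfolding expect_def by (simp add: ind_shift[OF assms])
  also have "\<dots> = (\<Sum>R\<in>Pow V. hat R * (walsh R (V - K) * hat R))"
    unfolding parseval[OF finite_V]
    by (rule sum.cong) (auto simp: fourier_shift[OF finite_V] hat_def)
  also have "\<dots> = (\<Sum>R\<in>Pow V. signed_mass R * walsh R K)"
  proof (rule sum.cong)
    fix R assume R: "R \<in> Pow V"
    have "V - K = sym_diff V K" using KV by auto
    moreover have "finite R" using R finite_V finite_subset by auto
    ultimately have "walsh R (V - K) = walsh R V * walsh R K" using walsh_sym_diff by metis
    moreover have "walsh R V = (-1) ^ card R" using R by (simp add: walsh_def Int_absorb2)
    ultimately show "hat R * (walsh R (V - K) * hat R) = signed_mass R * walsh R K"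
      by (simp add: signed_mass_def power2_eq_square)
  qed simp
  finally show ?thesis by simp
qed

text \<open>Fourier inversion on the cube of subsets of \<open>cut a\<close>: the identities of
  \<open>sum_signed_mass_walsh\<close> for all \<open>K\<close> together isolate the coefficients
  with trace \<open>J\<close>.\<close>

lemma sum_signed_mass_fibre:
  assumes J: "J \<subseteq> cut a"
  shows "(\<Sum>R\<in>{R\<in>Pow V. R \<inter> cut a = J}. signed_mass R) = 0"
proof -
  have fc: "finite (cut a)" using finite_V by (simp add: cut_def)
  have "0 = (\<Sum>K\<in>Pow (cut a). walsh J K * (\<Sum>R\<in>Pow V. signed_mass R * walsh R K))"
    by (rule sum.neutral[symmetric]) (use sum_signed_mass_walsh in auto)
  also have "\<dots> = (\<Sum>R\<in>Pow V. \<Sum>K\<in>Pow (cut a). signed_mass R * (walsh J K * walsh R K))"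
    unfolding sum_distrib_left by (subst sum.swap) (simp add: mult_ac)
  also have "\<dots> = (\<Sum>R\<in>Pow V. if R \<inter> cut a = J then signed_mass R * 2 ^ card (cut a) else 0)"
  proof (rule sum.cong)
    fix R assume R: "R \<in> Pow V"
    have "(\<Sum>K\<in>Pow (cut a). signed_mass R * (walsh J K * walsh R K))
        = signed_mass R * (\<Sum>K\<in>Pow (cut a). walsh (sym_diff J R) K)"
      unfolding sum_distrib_left
    proof (rule sum.cong)
      fix K assume "K \<in> Pow (cut a)"
      then have "finite K" using fc finite_subset by auto
      then show "signed_mass R * (walsh J K * walsh R K) = signed_mass R * walsh (sym_diff J R) K"
        by (simp add: walsh_sym_diff_left)
    qed simp
    also have "\<dots> = (if sym_diff J R \<inter> cut a = {} then signed_mass R * 2 ^ card (cut a) else 0)"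
      by (simp add: sum_walsh[OF fc])
    also have "sym_diff J R \<inter> cut a = {} \<longleftrightarrow> R \<inter> cut a = J" using J by auto
    finally show "(\<Sum>K\<in>Pow (cut a). signed_mass R * (walsh J K * walsh R K))
       = (if R \<inter> cut a = J then signed_mass R * 2 ^ card (cut a) else 0)" .
  qed simp
  also have "\<dots> = (\<Sum>R\<in>{R\<in>Pow V. R \<inter> cut a = J}. signed_mass R) * 2 ^ card (cut a)"
    using finite_V by (simp add: sum.inter_filter[symmetric] sum_distrib_right del: Pow_iff)
  finally show ?thesis by simp
qed

lemma sum_signed_mass_trace:
  "(\<Sum>R\<in>Pow V. signed_mass R * (if 0 \<in> R then 0 else trace_weight (trace n R a))) = 0"
proof -
  \<comment> \<open>Weight 0 on traces containing 0 gives every \<open>R\<close> containing 0 the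
    eigenvalue 0, well above the gap, which allows such \<open>R\<close> to count as
    non-extremal.\<close>
  define G where "G J = (if 0 \<in> J then 0 else trace_weight J)" for J :: "vec2 set"
  have "(\<Sum>R\<in>Pow V. signed_mass R * (if 0 \<in> R then 0 else trace_weight (trace n R a)))
      = (\<Sum>R\<in>Pow V. signed_mass R * G (R \<inter> cut a))"
  proof (rule sum.cong)
    fix R assume R: "R \<in> Pow V"
    then have "R \<inter> cut a = trace n R a" if "0 \<notin> R" using that by (auto simp: cut_def trace_def)
    moreover have "0 \<in> R \<inter> cut a \<longleftrightarrow> 0 \<in> R" by (simp add: cut_def)
    ultimately show "signed_mass R * (if 0 \<in> R then 0 else trace_weight (trace n R a))
        = signed_mass R * G (R \<inter> cut a)"
      unfolding G_def by simp
  qed simp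
  also have "\<dots> = (\<Sum>J\<in>Pow (cut a). \<Sum>R\<in>{R\<in>Pow V. R \<inter> cut a = J}. signed_mass R * G (R \<inter> cut a))"
    by (rule sum.group[symmetric]) (use finite_V in \<open>auto simp: cut_def\<close>)
  also have "\<dots> = (\<Sum>J\<in>Pow (cut a). (\<Sum>R\<in>{R\<in>Pow V. R \<inter> cut a = J}. signed_mass R) * G J)"
    unfolding sum_distrib_right by (intro sum.cong refl) auto
  also have "\<dots> = 0"
    by (rule sum.neutral) (use sum_signed_mass_fibre in auto)
  finally show ?thesis .
qed

lemma sum_eigenvalue:
  "(\<Sum>R\<in>Pow V. (hat R)\<^sup>2 * (if 0 \<in> R then 0 else eigenvalue n R)) = 0"
proof -
  have "0 = (\<Sum>a\<in>V. \<Sum>R\<in>Pow V. signed_mass R * (if 0 \<in> R then 0 else trace_weight (trace n R a)))"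
    by (simp add: sum_signed_mass_trace)
  also have "\<dots> = (\<Sum>R\<in>Pow V. \<Sum>a\<in>V. signed_mass R * (if 0 \<in> R then 0 else trace_weight (trace n R a)))"
    by (rule sum.swap)
  also have "\<dots> = (\<Sum>R\<in>Pow V. 2 ^ n * ((hat R)\<^sup>2 * (if 0 \<in> R then 0 else eigenvalue n R)))"
    by (intro sum.cong refl)
      (auto simp: signed_mass_def eigenvalue_def sum_distrib_left[symmetric])
  finally show ?thesis by (simp add: sum_distrib_left[symmetric])
qed

lemma sum_hat_sq: "(\<Sum>R\<in>Pow V. (hat R)\<^sup>2) = density"
  unfolding hat_def density_def
  using expect_eq_sum_fourier_sq[where f = ind, OF finite_V ind_01] by simp

lemma hat_empty: "hat {} = density"
  by (simp add: hat_def density_def fourier_empty)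

lemma density_nonneg: "0 \<le> density"
  unfolding sum_hat_sq[symmetric] by (intro sum_nonneg) simp

lemma defect_nonneg: "0 \<le> defect"
  unfolding defect_def by (intro sum_nonneg) simp

lemma extremal_empty: "extremal n {}"
  unfolding extremal_def by simp

text \<open>Hoffman's bound, keeping track of the eigenvectors that are not extremal.\<close>

lemma defect_le: "defect \<le> 256 * density * (1 - 8 * density)"
proof -
  \<comment> \<open>Here 8/7 = 1 + 1/7 is the distance of the eigenvalue 1 from the minimum -1/7,
    and 1/1792 = 1/7 - 255/1792 is the gap.\<close>
  have "(\<Sum>R\<in>Pow V. (if R = {} then 8 / 7 * density\<^sup>2 else 0) - (hat R)\<^sup>2 / 7
      + (if \<not> extremal n R then (hat R)\<^sup>2 / 1792 else 0))
    \<le> (\<Sum>R\<in>Pow V. (hat R)\<^sup>2 * (if 0 \<in> R then 0 else eigenvalue n R))"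
  proof (rule sum_mono)
    fix R assume R: "R \<in> Pow V"
    show "(if R = {} then 8 / 7 * density\<^sup>2 else 0) - (hat R)\<^sup>2 / 7
      + (if \<not> extremal n R then (hat R)\<^sup>2 / 1792 else 0)
      \<le> (hat R)\<^sup>2 * (if 0 \<in> R then 0 else eigenvalue n R)"
    proof (cases "R = {}")
      case True
      then show ?thesis using extremal_empty by (simp add: eigenvalue_empty hat_empty)
    next
      case False
      define e where "e = (if 0 \<in> R then 0 else eigenvalue n R)"
      have "- 1 / 7 + (if \<not> extremal n R then 1 / 1792 else 0) \<le> e"
        using eigenvalue_bounds[of R n] R False by (auto simp: e_def)
      then have "(hat R)\<^sup>2 * (- 1 / 7 + (if \<not> extremal n R then 1 / 1792 else 0)) \<le> (hat R)\<^sup>2 * e"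
        by (intro mult_left_mono) auto
      then show ?thesis using False by (simp add: e_def[symmetric] algebra_simps split: if_splits)
    qed
  qed
  moreover have "(\<Sum>R\<in>Pow V. if \<not> extremal n R then (hat R)\<^sup>2 / 1792 else 0) = defect / 1792"
  proof -
    have "{R. R \<subseteq> V \<and> \<not> extremal n R} = Pow V - Collect (extremal n)" by auto
    then show ?thesis using finite_V by (simp add: sum_if_Pow defect_def sum_divide_distrib)
  qed
  moreover have "(\<Sum>R\<in>Pow V. (hat R)\<^sup>2 / 7) = density / 7"
    by (simp add: sum_divide_distrib[symmetric] sum_hat_sq)
  moreover have "(\<Sum>R\<in>Pow V. if R = {} then 8 / 7 * density\<^sup>2 else 0) = 8 / 7 * density\<^sup>2"
    using sum_if_eq_Pow[OF finite_V, of "{}"] by simp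
  ultimately have "8 / 7 * density\<^sup>2 - density / 7 + defect / 1792 \<le> 0"
    by (simp add: sum.distrib sum_subtractf sum_eigenvalue)
  then show ?thesis by (simp add: algebra_simps power2_eq_square)
qed

lemma density_le: "density \<le> 1 / 8"
proof (rule ccontr)
  assume "\<not> ?thesis"
  then have "256 * density * (1 - 8 * density) < 0"
    by (intro mult_pos_neg) auto
  then show False using defect_le defect_nonneg by simp
qed

text \<open>A single fibre identity, with the non-extremal coefficients moved into the error. A
  fibre with few extremal sets relates their coefficients directly.\<close>

lemma extremal_relation:
  assumes "J \<subseteq> cut a"
  shows "\<bar>\<Sum>R\<in>{R\<in>Pow V. R \<inter> cut a = J \<and> extremal n R}. signed_mass R\<bar> \<le> defect"
proof -
  let ?E = "{R\<in>Pow V. R \<inter> cut a = J \<and> extremal n R}"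
    and ?N = "{R\<in>Pow V. R \<inter> cut a = J \<and> \<not> extremal n R}"
  have fin: "finite ?E" "finite ?N" using finite_V by auto
  have eq: "{R\<in>Pow V. R \<inter> cut a = J} = ?E \<union> ?N" by blast
  have "0 = (\<Sum>R\<in>?E. signed_mass R) + (\<Sum>R\<in>?N. signed_mass R)"
    using sum_signed_mass_fibre[OF assms] unfolding eq
    by (subst (asm) sum.union_disjoint) (use fin in auto)
  then have "\<bar>\<Sum>R\<in>?E. signed_mass R\<bar> = \<bar>\<Sum>R\<in>?N. signed_mass R\<bar>" by linarith
  also have "\<dots> \<le> (\<Sum>R\<in>?N. \<bar>signed_mass R\<bar>)" by (rule sum_abs)
  also have "\<dots> = (\<Sum>R\<in>?N. (hat R)\<^sup>2)"
    by (intro sum.cong refl) (simp add: signed_mass_def abs_mult power_abs)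
  also have "\<dots> \<le> defect"
    unfolding defect_def by (rule sum_mono2) (use finite_V in auto)
  finally show ?thesis .
qed

text \<open>A functional that is 1 at x and y is 0 at x + y, so the only extremal sets over {x, y}
  are the pair and the triple, with opposite signs.\<close>

lemma hat_pair_triple:
  assumes "x \<in> V" "y \<in> V" "x \<noteq> 0" "y \<noteq> 0" "x \<noteq> y"
  shows "\<bar>(hat {x, y})\<^sup>2 - (hat {x, y, x + y})\<^sup>2\<bar> \<le> defect"
proof -
  obtain a where a: "a \<in> V" "dot n a x = 1" "dot n a y = 1"
    by (rule exists_dot_eq_1_1[OF assms(1-4)])
  let ?X = "{x, y, x + y}"
  have sX: "schur_triple n ?X" by (rule schur_tripleI[OF assms])
  note X = schur_triple_props[OF sX]
  have xy_notin: "x + y \<notin> cut a" using a X(3) by (auto simp: cut_def dot_add_right)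
  have J: "{x, y} \<subseteq> cut a" using assms a by (auto simp: cut_def)
  have "{R\<in>Pow V. R \<inter> cut a = {x, y} \<and> extremal n R} = {{x, y}, ?X}" (is "?L = ?R")
  proof
    show "?R \<subseteq> ?L" using J xy_notin sX X assms by (auto simp: extremal_def)
    show "?L \<subseteq> ?R"
    proof
      fix R assume "R \<in> ?L"
      then have R: "R \<inter> cut a = {x, y}" "extremal n R" "R \<subseteq> V" by auto
      then have sub: "{x, y} \<subseteq> R" by auto
      have fin: "finite R" using R finite_V finite_subset by auto
      have "2 \<le> card R" using card_mono[OF fin sub] assms(5) by simp
      then have "card R = 2 \<or> schur_triple n R" using R(2) by (auto simp: extremal_def)
      then show "R \<in> ?R"
      proof
        assume "card R = 2"
        then have "{x, y} = R" using card_subset_eq[OF fin sub] assms(5) by simp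
        then show ?thesis by simp
      next
        assume "schur_triple n R"
        then have "R = ?X" by (rule schur_triple_eq) (use sub assms in auto)
        then show ?thesis by simp
      qed
    qed
  qed
  moreover have "{x, y} \<noteq> ?X" using X(1) assms(5) by (metis card_2_iff numeral_eq_iff semiring_norm(89))
  moreover have "signed_mass {x, y} = (hat {x, y})\<^sup>2" using assms(5) by (simp add: signed_mass_def)
  moreover have "signed_mass ?X = - (hat ?X)\<^sup>2" unfolding signed_mass_def X(1) by simp
  ultimately show ?thesis using extremal_relation[OF J] by simp
qed

text \<open>A functional that is 1 at x is 1 at exactly two points of a Schur triple through x, so
  no triple lies over {x}; only {x} itself and pairs remain.\<close>

lemma hat_singleton_relation:
  assumes "x \<in> V" "dot n a x = 1"
  shows "\<bar>(\<Sum>R\<in>{R. R \<subseteq> V \<and> R \<inter> cut a = {x} \<and> card R = 2 \<and> 0 \<notin> R}. (hat R)\<^sup>2) - (hat {x})\<^sup>2\<bar> \<le> defect"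
proof -
  let ?P = "{R. R \<subseteq> V \<and> R \<inter> cut a = {x} \<and> card R = 2 \<and> 0 \<notin> R}"
  have x0: "x \<noteq> 0" using assms by auto
  have J: "{x} \<subseteq> cut a" using assms by (auto simp: cut_def)
  have eq: "{R\<in>Pow V. R \<inter> cut a = {x} \<and> extremal n R} = insert {x} ?P" (is "?L = ?R")
  proof
    show "?R \<subseteq> ?L" using J x0 assms by (auto simp: extremal_def)
    show "?L \<subseteq> ?R"
    proof
      fix R assume "R \<in> ?L"
      then have R: "R \<inter> cut a = {x}" "extremal n R" "R \<subseteq> V" by auto
      have "\<not> schur_triple n R"
      proof
        assume s: "schur_triple n R"
        have "x \<in> R" using R by auto
        moreover have "R \<noteq> {x}" using schur_triple_props(1)[OF s] by auto
        ultimately obtain q where q: "q \<in> R" "x \<noteq> q" by auto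
        have "R = {x, q, x + q}" by (rule schur_triple_eq[OF s \<open>x \<in> R\<close> q])
        then have xq: "x + q \<in> R" by simp
        have "x + q \<noteq> x"
          using schur_triple_props(3)[OF s] q by (metis add_cancel_left_right)
        moreover have "q \<in> cut a \<or> x + q \<in> cut a"
          using bit_cases[of "dot n a q"] q xq R(3) assms(2) by (auto simp: cut_def dot_add_right)
        ultimately have "q \<in> R \<inter> cut a \<or> x + q \<in> R \<inter> cut a" "x + q \<noteq> x" using q(1) xq by simp_all
        then show False unfolding R(1) using q(2) by simp
      qed
      moreover have "R \<noteq> {}" using R by auto
      ultimately have "card R = 1 \<or> card R = 2" "0 \<notin> R" using R(2) by (auto simp: extremal_def)
      then show "R \<in> ?R"
      proof (elim disjE)
        assume "card R = 1"
        then obtain r where "R = {r}" by (auto simp: card_1_singleton_iff)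
        moreover have "x \<in> R" using R(1) by blast
        ultimately show ?thesis by simp
      next
        assume "card R = 2"
        then show ?thesis using R(1,3) \<open>0 \<notin> R\<close> by simp
      qed
    qed
  qed
  have mass: "(\<Sum>R\<in>insert {x} ?P. signed_mass R) = (\<Sum>R\<in>?P. (hat R)\<^sup>2) - (hat {x})\<^sup>2"
  proof -
    have "finite ?P" by (rule finite_subset[of _ "Pow V"]) (use finite_V in auto)
    moreover have "{x} \<notin> ?P" by simp
    moreover have "(\<Sum>R\<in>?P. signed_mass R) = (\<Sum>R\<in>?P. (hat R)\<^sup>2)"
    proof (rule sum.cong[OF refl])
      fix R assume "R \<in> ?P"
      then have "card R = 2" by simp
      then show "signed_mass R = (hat R)\<^sup>2" unfolding signed_mass_def by simp
    qed
    moreover have "signed_mass {x} = - (hat {x})\<^sup>2" by (simp add: signed_mass_def)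
    ultimately show ?thesis using sum.insert[of ?P "{x}" signed_mass] by linarith
  qed
  show ?thesis using extremal_relation[OF J] unfolding eq mass .
qed

text \<open>A functional that is 1 at x and at x + y vanishes at y, so {x, y} is one of the pairs
  over {x}.\<close>

lemma hat_singleton_ge:
  assumes "x \<in> V" "y \<in> V" "x \<noteq> 0" "y \<noteq> 0" "x \<noteq> y"
  shows "(hat {x, y})\<^sup>2 - defect \<le> (hat {x})\<^sup>2"
proof -
  have "x + y \<noteq> 0" using assms(5) by (simp add: vec2_add_eq_0_iff)
  then obtain a where a: "a \<in> V" "dot n a x = 1" "dot n a (x + y) = 1"
    using exists_dot_eq_1_1[of x n "x + y"] assms by (auto simp: add_in_Z2n)
  then have "dot n a y = 0" using bit_cases[of "dot n a y"] by (auto simp: dot_add_right)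
  let ?P = "{R. R \<subseteq> V \<and> R \<inter> cut a = {x} \<and> card R = 2 \<and> 0 \<notin> R}"
  have fin: "finite ?P" by (rule finite_subset[of _ "Pow V"]) (use finite_V in auto)
  have "{x, y} \<in> ?P" using assms a \<open>dot n a y = 0\<close> by (auto simp: cut_def)
  then have "(hat {x, y})\<^sup>2 \<le> (\<Sum>R\<in>?P. (hat R)\<^sup>2)"
    using member_le_sum[of "{x, y}" ?P "\<lambda>R. (hat R)\<^sup>2"] fin by simp
  then show ?thesis using hat_singleton_relation[OF assms(1) a(2)] by linarith
qed

lemma hat_le_defect:
  assumes "R \<subseteq> V" "\<not> extremal n R"
  shows "(hat R)\<^sup>2 \<le> defect"
  unfolding defect_def
proof (rule member_le_sum)
  show "R \<in> Pow V - Collect (extremal n)" using assms by simp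
  show "finite (Pow V - Collect (extremal n))" using finite_V by simp
qed simp

lemma influence_le_defect_or_large:
  assumes "L \<subseteq> V"
  shows "influence V ind L \<le> 2 * defect \<or> 1 / 11664 < influence V ind L"
  by (rule influence_dichotomy[OF finite_V assms ind_01 _ defect_def[unfolded hat_def]])
    (simp add: card_extremal)

text \<open>Proper supersets of a triple have at least four elements and are not extremal, so 8
  times the coefficient is within 8 times the root of the defect of an integer. A mass above the
  defect makes this integer nonzero.\<close>

lemma hat_granular:
  assumes "schur_triple n X" "defect < (hat X)\<^sup>2"
  shows "1 / 64 - sqrt defect / 4 \<le> (hat X)\<^sup>2"
proof -
  note X = schur_triple_props[OF assms(1)]
  obtain k :: int where k: "(of_int k - 2 ^ card X * fourier V ind X)\<^sup>2
       \<le> 4 ^ card X * (\<Sum>R\<in>{R. R \<subseteq> V \<and> X \<subset> R}. (fourier V ind R)\<^sup>2)"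
    by (rule fourier_granularity[OF finite_V X(2), of ind]) (auto simp: ind_def)
  have "(\<Sum>R\<in>{R. R \<subseteq> V \<and> X \<subset> R}. (fourier V ind R)\<^sup>2) \<le> defect"
    unfolding defect_def hat_def
  proof (rule sum_mono2)
    show "{R. R \<subseteq> V \<and> X \<subset> R} \<subseteq> Pow V - Collect (extremal n)"
    proof
      fix R assume "R \<in> {R. R \<subseteq> V \<and> X \<subset> R}"
      then have R: "R \<subseteq> V" "X \<subset> R" by auto
      have "finite R" using R finite_V finite_subset by blast
      then have "3 < card R" using psubset_card_mono[OF _ R(2)] X by simp
      then show "R \<in> Pow V - Collect (extremal n)" using card_extremal[of n R] R(1) by auto
    qed
  qed (use finite_V in auto)
  then have "(of_int k - 8 * hat X)\<^sup>2 \<le> 64 * defect" using k X(1) by (simp add: hat_def)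
  then have "\<bar>of_int k - 8 * hat X\<bar> \<le> sqrt (64 * defect)"
    by (intro real_le_rsqrt) simp
  then have d: "\<bar>of_int k - 8 * hat X\<bar> \<le> 8 * sqrt defect" by (simp add: real_sqrt_mult)
  have "k \<noteq> 0"
  proof
    assume "k = 0"
    then have "64 * (hat X)\<^sup>2 \<le> 64 * defect"
      using \<open>(of_int k - 8 * hat X)\<^sup>2 \<le> 64 * defect\<close> by (simp add: power_mult_distrib)
    then show False using assms(2) by simp
  qed
  then have "1 \<le> \<bar>real_of_int k\<bar>" by linarith
  then have h: "1 / 8 - sqrt defect \<le> \<bar>hat X\<bar>" using d by linarith
  show ?thesis
  proof (cases "sqrt defect \<le> 1 / 8")
    case True
    then have "(1 / 8 - sqrt defect)\<^sup>2 \<le> \<bar>hat X\<bar>\<^sup>2" using h by (intro power_mono) auto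
    moreover have "(1 / 8 - sqrt defect)\<^sup>2 = 1 / 64 - sqrt defect / 4 + (sqrt defect)\<^sup>2"
      by (simp add: power2_eq_square algebra_simps)
    moreover have "0 \<le> (sqrt defect)\<^sup>2" by (rule zero_le_power2)
    ultimately show ?thesis unfolding power2_abs by linarith
  next
    case False
    then have "1 / 64 - sqrt defect / 4 \<le> 0" by simp
    then show ?thesis using zero_le_power2[of "hat X"] by linarith
  qed
qed

text \<open>Each pair loses one \<open>defect\<close> against the triple and each point two, which
  makes 3 + 6 = 9.\<close>

lemma sum_hat_subsets_triple:
  assumes "schur_triple n X"
  shows "density\<^sup>2 + 7 * (hat X)\<^sup>2 - 9 * defect \<le> (\<Sum>R\<in>Pow X. (hat R)\<^sup>2)"
proof -
  obtain x y where xy: "X = {x, y, x + y}" "distinct [x, y, x + y]" "x \<in> V" "y \<in> V" "0 \<notin> X"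
    using assms unfolding schur_triple_def by blast
  define z where "z = x + y"
  have z: "z \<in> V" using xy by (simp add: z_def add_in_Z2n)
  have X: "X = {x, y, z}" using xy(1) by (simp add: z_def)
  have ds: "x \<noteq> y" "y \<noteq> x" "x \<noteq> z" "z \<noteq> x" "y \<noteq> z" "z \<noteq> y" "x \<noteq> 0" "y \<noteq> 0" "z \<noteq> 0"
    using xy(2,5) X by (auto simp: z_def)
  have pair: "(hat X)\<^sup>2 - defect \<le> (hat {p, q})\<^sup>2" if "p \<in> X" "q \<in> X" "p \<noteq> q" for p q
  proof -
    have "X = {p, q, p + q}" by (rule schur_triple_eq[OF assms that])
    moreover have "p \<in> V" "q \<in> V" "p \<noteq> 0" "q \<noteq> 0"
      using that schur_triple_props[OF assms] by auto
    ultimately show ?thesis using hat_pair_triple[of p q] that(3) by simp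
  qed
  have single: "(hat X)\<^sup>2 - 2 * defect \<le> (hat {p})\<^sup>2" if "p \<in> X" "q \<in> X" "p \<noteq> q" for p q
  proof -
    have "p \<in> V" "q \<in> V" "p \<noteq> 0" "q \<noteq> 0"
      using that schur_triple_props[OF assms] by auto
    then show ?thesis using hat_singleton_ge[of p q] pair[OF that] that(3) by simp
  qed
  have "Pow X = {{}, {x}, {y}, {z}, {x, y}, {x, z}, {y, z}, X}"
    unfolding X by (auto simp: Pow_insert)
  moreover have "(\<Sum>R\<in>{{}, {x}, {y}, {z}, {x, y}, {x, z}, {y, z}, X}. (hat R)\<^sup>2)
     = (hat {})\<^sup>2 + (hat {x})\<^sup>2 + (hat {y})\<^sup>2 + (hat {z})\<^sup>2
       + (hat {x, y})\<^sup>2 + (hat {x, z})\<^sup>2 + (hat {y, z})\<^sup>2 + (hat X)\<^sup>2"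
    unfolding X by (simp add: ds doubleton_eq_iff insert_eq_iff)
  ultimately show ?thesis
    using pair[of x y] pair[of x z] pair[of y z] single[of x y] single[of y z] single[of z x] ds X
    by (simp add: hat_empty)
qed

lemma influence_complement_triple:
  assumes "schur_triple n X"
  shows "influence V ind (V - X) = density - (\<Sum>R\<in>Pow X. (hat R)\<^sup>2)"
proof -
  have "{R. R \<subseteq> V \<and> R \<inter> (V - X) = {}} = Pow X"
    using schur_triple_props(2)[OF assms] by auto
  then show ?thesis
    using sum_Pow_influence[OF finite_V, of ind "V - X"] sum_hat_sq by (simp add: hat_def)
qed

end

text \<open>An upper bound for the number of sets of influential coordinates.\<close>

definition coordinate_sets :: real where
  "coordinate_sets = 2 ^ 69984"

lemma coordinate_sets_ge_1: "1 \<le> coordinate_sets"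
  unfolding coordinate_sets_def by (rule one_le_power) simp

context agreeing
begin

text \<open>
  If no Schur triple carried Fourier mass, then by the relations above all low-level mass on the
  boundedly many influential coordinates would be small.
\<close>

lemma exists_heavy_triple:
  assumes "1 / 16 \<le> density" and small: "defect * coordinate_sets\<^sup>2 \<le> 1 / 10 ^ 12"
  obtains X where "schur_triple n X" "defect < (hat X)\<^sup>2"
proof (rule ccontr)
  note found = that
  assume "\<not> thesis"
  then have light: "(hat X)\<^sup>2 \<le> defect" if "schur_triple n X" for X
    using found[OF that] by (meson not_le)
  define M where "M = coordinate_sets"
  have M1: "1 \<le> M" unfolding M_def by (rule coordinate_sets_ge_1)
  have small': "defect * M\<^sup>2 \<le> 1 / 10 ^ 12" using small by (simp add: M_def)
  have "defect * 1 \<le> defect * M\<^sup>2"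
    using M1 defect_nonneg by (intro mult_left_mono) (simp_all add: one_le_power)
  then have d_small: "defect \<le> 1 / 10 ^ 12" using small' by simp
  have "4 * defect \<le> 1 / 11664" using d_small by simp
  then obtain H where H: "H \<subseteq> V" "card H \<le> 69984" "influence V ind (V - H) \<le> 2 * defect"
    using few_influential_coordinates[of V ind "Collect (extremal n)" defect]
      finite_V ind_01 card_extremal by (auto simp: defect_def hat_def)
  have finH: "finite H" using H(1) finite_V finite_subset by blast
  have "real (card (Pow H)) = 2 ^ card H" using finH by (simp add: card_Pow)
  moreover have "(2::real) ^ card H \<le> M"
    unfolding M_def coordinate_sets_def by (rule power_increasing[OF H(2)]) simp
  ultimately have cardH: "real (card (Pow H)) \<le> M" by (simp only:)
  have pair: "(hat R)\<^sup>2 \<le> 2 * defect" if R: "R \<subseteq> V" "card R = 2" "0 \<notin> R" for R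
  proof -
    obtain x y where xy: "R = {x, y}" "x \<noteq> y" using R(2) by (auto simp: card_2_iff)
    have xyV: "x \<in> V" "y \<in> V" "x \<noteq> 0" "y \<noteq> 0" using xy R by auto
    then show ?thesis
      using hat_pair_triple[of x y] light[OF schur_tripleI[OF xyV xy(2)]] xy by simp
  qed
  have escape: "(\<Sum>R\<in>A. (hat R)\<^sup>2) \<le> 2 * defect" if "A \<subseteq> {R. R \<subseteq> V \<and> R \<inter> (V - H) \<noteq> {}}" for A
  proof -
    have "(\<Sum>R\<in>A. (hat R)\<^sup>2) \<le> influence V ind (V - H)"
      unfolding influence_def hat_def by (rule sum_mono2) (use that finite_V in auto)
    then show ?thesis using H(3) by simp
  qed
  have inside: "(\<Sum>R\<in>A. (hat R)\<^sup>2) \<le> M * e"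
    if "A \<subseteq> Pow H" "0 \<le> e" "\<And>R. R \<in> A \<Longrightarrow> (hat R)\<^sup>2 \<le> e" for A e
  proof -
    have "(\<Sum>R\<in>A. (hat R)\<^sup>2) \<le> real (card A) * e"
      using sum_bounded_above[of A "\<lambda>R. (hat R)\<^sup>2" e] that(3) by simp
    also have "\<dots> \<le> M * e"
    proof (rule mult_right_mono[OF _ that(2)])
      have "card A \<le> card (Pow H)" using that(1) finH by (intro card_mono) auto
      then show "real (card A) \<le> M" using cardH by linarith
    qed
    finally show ?thesis .
  qed
  \<comment> \<open>The pairs over {x} may be numerous, but those leaving \<open>H\<close> have
    total mass at most twice the defect, and at most \<open>M\<close> of them stay inside
    \<open>H\<close>.\<close>
  have single: "(hat {x})\<^sup>2 \<le> (2 * M + 3) * defect" if x: "x \<in> V" "x \<noteq> 0" for x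
  proof -
    obtain a where a: "a \<in> V" "dot n a x = 1" by (rule exists_dot_eq_1[OF x])
    let ?P = "{R. R \<subseteq> V \<and> R \<inter> cut a = {x} \<and> card R = 2 \<and> 0 \<notin> R}"
    let ?A = "{R\<in>?P. R \<inter> (V - H) \<noteq> {}}" and ?B = "{R\<in>?P. R \<inter> (V - H) = {}}"
    have fin: "finite ?A" "finite ?B"
      by (rule finite_subset[of _ "Pow V"]; use finite_V in auto)+
    have "?P = ?A \<union> ?B" "?A \<inter> ?B = {}" by blast+
    then have "(\<Sum>R\<in>?P. (hat R)\<^sup>2) = (\<Sum>R\<in>?A. (hat R)\<^sup>2) + (\<Sum>R\<in>?B. (hat R)\<^sup>2)"
      using sum.union_disjoint[OF fin, of "\<lambda>R. (hat R)\<^sup>2"] by (simp only:)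
    also have "\<dots> \<le> 2 * defect + M * (2 * defect)"
    proof (rule add_mono)
      show "(\<Sum>R\<in>?A. (hat R)\<^sup>2) \<le> 2 * defect" by (rule escape) blast
      show "(\<Sum>R\<in>?B. (hat R)\<^sup>2) \<le> M * (2 * defect)"
      proof (rule inside)
        show "?B \<subseteq> Pow H" by blast
        show "0 \<le> 2 * defect" using defect_nonneg by simp
        show "(hat R)\<^sup>2 \<le> 2 * defect" if "R \<in> ?B" for R by (rule pair) (use that in auto)
      qed
    qed
    finally show ?thesis
      using hat_singleton_relation[OF x(1) a(2)] by (simp add: algebra_simps)
  qed
  have each: "(hat R)\<^sup>2 \<le> (2 * M + 3) * defect" if R: "R \<subseteq> V" "R \<noteq> {}" for R
  proof -
    have c: "2 * defect \<le> (2 * M + 3) * defect"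
      using M1 defect_nonneg by (intro mult_right_mono) auto
    show ?thesis
    proof (cases "extremal n R")
      case True
      then consider "card R = 1" | "card R = 2" | "schur_triple n R" using R(2) by (auto simp: extremal_def)
      then show ?thesis
      proof cases
        case 1
        then show ?thesis using single True R by (auto simp: card_1_singleton_iff extremal_def)
      next
        case 2
        then have "(hat R)\<^sup>2 \<le> 2 * defect" using pair True by (auto simp: extremal_def)
        then show ?thesis using c by linarith
      next
        case 3
        then show ?thesis using light[of R] c defect_nonneg by linarith
      qed
    next
      case False
      then show ?thesis using hat_le_defect[OF R(1)] c defect_nonneg by linarith
    qed
  qed
  let ?A = "{R. R \<subseteq> V \<and> R \<inter> (V - H) \<noteq> {}}" and ?B = "Pow H - {{}}"
  have "density = (\<Sum>R\<in>Pow V. (hat R)\<^sup>2)" by (rule sum_hat_sq[symmetric])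
  also have "Pow V = insert {} (?A \<union> ?B)" using H(1) by blast
  also have "(\<Sum>R\<in>insert {} (?A \<union> ?B). (hat R)\<^sup>2)
      = density\<^sup>2 + ((\<Sum>R\<in>?A. (hat R)\<^sup>2) + (\<Sum>R\<in>?B. (hat R)\<^sup>2))"
  proof -
    have fin: "finite ?A" "finite ?B" using finite_V finH by auto
    have AB: "(\<Sum>R\<in>?A \<union> ?B. (hat R)\<^sup>2) = (\<Sum>R\<in>?A. (hat R)\<^sup>2) + (\<Sum>R\<in>?B. (hat R)\<^sup>2)"
      by (rule sum.union_disjoint[OF fin]) blast
    have "finite (?A \<union> ?B)" "{} \<notin> ?A \<union> ?B" using fin by auto
    then show ?thesis unfolding AB[symmetric] hat_empty[symmetric] by (rule sum.insert)
  qed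
  also have "\<dots> \<le> density\<^sup>2 + (2 * defect + M * ((2 * M + 3) * defect))"
  proof (intro add_left_mono add_mono)
    show "(\<Sum>R\<in>?A. (hat R)\<^sup>2) \<le> 2 * defect" by (rule escape) blast
    show "(\<Sum>R\<in>?B. (hat R)\<^sup>2) \<le> M * ((2 * M + 3) * defect)"
    proof (rule inside)
      show "?B \<subseteq> Pow H" by blast
      show "0 \<le> (2 * M + 3) * defect" using defect_nonneg M1 by simp
      show "(hat R)\<^sup>2 \<le> (2 * M + 3) * defect" if "R \<in> ?B" for R by (rule each) (use that H(1) in auto)
    qed
  qed
  also have "\<dots> \<le> density\<^sup>2 + 7 * (defect * M\<^sup>2)"
  proof -
    have "1 \<le> M\<^sup>2" "M \<le> M\<^sup>2" using M1 by (simp_all add: one_le_power self_le_power)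
    then have "defect \<le> defect * M\<^sup>2" "defect * M \<le> defect * M\<^sup>2"
      using defect_nonneg mult_left_mono[of 1 "M\<^sup>2" defect] mult_left_mono[of M "M\<^sup>2" defect] by auto
    moreover have "2 * defect + M * ((2 * M + 3) * defect)
        = 2 * defect + 3 * (defect * M) + 2 * (defect * M\<^sup>2)"
      by (simp add: power2_eq_square algebra_simps)
    ultimately show ?thesis by linarith
  qed
  \<comment> \<open>A density between 1/16 and 1/8 exceeds its square by at least 7/128, far more
    than this error.\<close>
  finally have "density \<le> density\<^sup>2 + 7 / 10 ^ 12" using small' by simp
  moreover have "density\<^sup>2 \<le> density * (1 / 8)"
    unfolding power2_eq_square using density_le density_nonneg by (intro mult_left_mono)
  ultimately show False using assms(1) by simp
qed

text \<open>The eight coefficients inside the heavy triple exhaust the mass up to the order of the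
  square root of the defect. This is below the threshold of the dichotomy, which improves it to
  twice the defect; dividing by a density of at least 1/16 gives the factor 32.\<close>

lemma density_cell:
  assumes "1 / 16 \<le> density" and small: "defect * coordinate_sets\<^sup>2 \<le> 1 / 10 ^ 12"
  obtains X B where "schur_triple n X" "B \<subseteq> X"
    "1 - 32 * defect \<le> expect (V - X) (\<lambda>U. ind (B \<union> U))"
proof -
  obtain X where X: "schur_triple n X" "defect < (hat X)\<^sup>2"
    by (rule exists_heavy_triple[OF assms])
  have "1 \<le> coordinate_sets\<^sup>2" by (rule one_le_power[OF coordinate_sets_ge_1])
  then have "defect * 1 \<le> defect * coordinate_sets\<^sup>2"
    using defect_nonneg by (intro mult_left_mono)
  then have d: "defect \<le> 1 / 10 ^ 12" using small by simp
  then have "sqrt defect \<le> sqrt ((1 / 10 ^ 6)\<^sup>2)" by (intro real_sqrt_le_mono) (simp add: power_divide)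
  then have sq: "sqrt defect \<le> 1 / 10 ^ 6" by simp
  have "density - density\<^sup>2 \<le> 7 / 64"
  proof -
    have "0 \<le> (1 / 8 - density) * (7 / 8 - density)"
      using density_le by (intro mult_nonneg_nonneg) auto
    then show ?thesis by (simp add: power2_eq_square algebra_simps)
  qed
  then have "influence V ind (V - X) \<le> 7 / 4 * sqrt defect + 9 * defect"
    using hat_granular[OF X] sum_hat_subsets_triple[OF X(1)] influence_complement_triple[OF X(1)]
    by linarith
  then have "influence V ind (V - X) \<le> 1 / 11664" using d sq by simp
  then have inf: "influence V ind (V - X) \<le> 2 * defect"
    using influence_le_defect_or_large[of "V - X"] by auto
  obtain B where B: "B \<subseteq> X"
    "1 - influence V ind (V - X) / expect V ind \<le> expect (V - X) (\<lambda>U. ind (B \<union> U))"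
    by (rule concentrated_on_cell[OF finite_V schur_triple_props(2)[OF X(1)], of ind])
      (use ind_01 assms(1) in \<open>auto simp: density_def\<close>)
  have "influence V ind (V - X) / expect V ind \<le> 2 * defect / (1 / 16)"
    using inf assms(1) defect_nonneg influence_nonneg[of V ind "V - X"]
    by (intro frac_le) (auto simp: density_def)
  then have "1 - 32 * defect \<le> expect (V - X) (\<lambda>U. ind (B \<union> U))" using B(2) by simp
  then show thesis using that X(1) B(1) by blast
qed

end

subsection \<open>Biased measures\<close>

text \<open>The ground set is a parameter and \<open>F\<close> may contain sets outside it, so that
  induction on \<open>V\<close> can pass to the link \<open>{S. insert x S \<in> F}\<close>.\<close>

definition biased :: "real \<Rightarrow> 'a set \<Rightarrow> 'a set set \<Rightarrow> real" where
  "biased p V F = (\<Sum>S\<in>Pow V. if S \<in> F then p ^ card S * (1 - p) ^ (card V - card S) else 0)"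

lemma mu_eq_biased:
  assumes "F \<subseteq> Pow (Z2n n)"
  shows "mu n p F = biased p (Z2n n) F"
proof -
  have "{S. S \<subseteq> Z2n n \<and> S \<in> F} = F" using assms by auto
  then show ?thesis
    unfolding biased_def mu_def sum_if_Pow[OF finite_Z2n] by (simp add: mu_set_def card_Z2n)
qed

lemma biased_nonneg: "0 \<le> p \<Longrightarrow> p \<le> 1 \<Longrightarrow> 0 \<le> biased p V F"
  unfolding biased_def by (intro sum_nonneg) auto

lemma biased_mono:
  assumes "0 \<le> p" "p \<le> 1" "\<And>S. S \<subseteq> V \<Longrightarrow> S \<in> F \<Longrightarrow> S \<in> G"
  shows "biased p V F \<le> biased p V G"
  unfolding biased_def by (rule sum_mono) (use assms in auto)

lemma biased_cong:
  assumes "\<And>S. S \<subseteq> V \<Longrightarrow> S \<in> F \<longleftrightarrow> S \<in> G"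
  shows "biased p V F = biased p V G"
  unfolding biased_def by (rule sum.cong) (use assms in auto)

lemma biased_Un_Int: "biased p V (F \<union> G) + biased p V (F \<inter> G) = biased p V F + biased p V G"
  unfolding biased_def sum.distrib[symmetric] by (rule sum.cong) auto

lemma biased_sym_diff: "biased p V (sym_diff F G) + biased p V (F \<inter> G) = biased p V (F \<union> G)"
  unfolding biased_def sum.distrib[symmetric] by (rule sum.cong) auto

lemma biased_insert:
  assumes "finite V" "x \<notin> V"
  shows "biased p (insert x V) F = (1 - p) * biased p V F + p * biased p V {S. insert x S \<in> F}"
proof -
  have "biased p (insert x V) F = (\<Sum>S\<in>Pow V.
      (1 - p) * (if S \<in> F then p ^ card S * (1 - p) ^ (card V - card S) else 0)
      + p * (if insert x S \<in> F then p ^ card S * (1 - p) ^ (card V - card S) else 0))"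
    unfolding biased_def sum_Pow_insert[OF assms]
  proof (rule sum.cong)
    fix S assume "S \<in> Pow V"
    then have S: "S \<subseteq> V" "finite S" "x \<notin> S" using assms finite_subset by auto
    have le: "card S \<le> card V" using S assms by (intro card_mono)
    have c: "card (insert x V) = Suc (card V)" "card (insert x S) = Suc (card S)"
      using assms S by simp_all
    show "(if S \<in> F then p ^ card S * (1 - p) ^ (card (insert x V) - card S) else 0)
        + (if insert x S \<in> F then p ^ card (insert x S) * (1 - p) ^ (card (insert x V) - card (insert x S)) else 0)
      = (1 - p) * (if S \<in> F then p ^ card S * (1 - p) ^ (card V - card S) else 0)
        + p * (if insert x S \<in> F then p ^ card S * (1 - p) ^ (card V - card S) else 0)"
      unfolding c using le by (simp add: Suc_diff_le)
  qed simp
  then show ?thesis by (simp add: biased_def sum.distrib sum_distrib_left)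
qed

lemma biased_empty_family: "(\<And>S. S \<subseteq> V \<Longrightarrow> S \<notin> F) \<Longrightarrow> biased p V F = 0"
  unfolding biased_def by (rule sum.neutral) auto

lemma biased_cell:
  assumes "finite V" "X \<subseteq> V" "B \<subseteq> X"
  shows "biased p V {S. S \<inter> X = B} = p ^ card B * (1 - p) ^ (card X - card B)"
  using assms
proof (induction V arbitrary: X B rule: finite_induct)
  case empty
  then show ?case by (simp add: biased_def)
next
  case (insert x V)
  show ?case
  proof (cases "x \<in> X")
    case False
    then have "biased p V {S. insert x S \<in> {S. S \<inter> X = B}} = biased p V {S. S \<inter> X = B}"
      by (intro biased_cong) auto
    moreover have "X \<subseteq> V" using insert.prems False by auto
    ultimately show ?thesis
      using insert by (simp add: biased_insert algebra_simps)
  next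
    case True
    have "finite (insert x V)" using insert.hyps by simp
    then have fin: "finite X" "finite B"
      using insert.prems by (auto intro: finite_subset[of X] finite_subset[of B])
    have X': "X - {x} \<subseteq> V" using insert.prems by auto
    show ?thesis
    proof (cases "x \<in> B")
      case True
      have "biased p V {S. S \<inter> X = B} = 0"
        by (rule biased_empty_family) (use True insert.hyps in auto)
      moreover have "biased p V {S. insert x S \<in> {S. S \<inter> X = B}} = biased p V {S. S \<inter> (X - {x}) = B - {x}}"
        by (intro biased_cong) (use True \<open>x \<in> X\<close> insert.hyps in auto)
      moreover have "biased p V {S. S \<inter> (X - {x}) = B - {x}}
          = p ^ card (B - {x}) * (1 - p) ^ (card (X - {x}) - card (B - {x}))"
        by (rule insert.IH) (use X' insert.prems in auto)
      moreover have "card B = Suc (card (B - {x}))" "card X = Suc (card (X - {x}))"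
        using fin True \<open>x \<in> X\<close> by (metis card_Suc_Diff1)+
      ultimately show ?thesis
        using insert.hyps by (simp add: biased_insert)
    next
      case False
      have "biased p V {S. insert x S \<in> {S. S \<inter> X = B}} = 0"
        by (rule biased_empty_family) (use False \<open>x \<in> X\<close> in auto)
      moreover have "biased p V {S. S \<inter> X = B} = biased p V {S. S \<inter> (X - {x}) = B}"
        by (intro biased_cong) (use insert.hyps in auto)
      moreover have "biased p V {S. S \<inter> (X - {x}) = B} = p ^ card B * (1 - p) ^ (card (X - {x}) - card B)"
        by (rule insert.IH) (use X' False insert.prems in auto)
      moreover have "card X - card B = Suc (card (X - {x}) - card B)"
      proof -
        have "card B \<le> card (X - {x})" using False insert.prems fin by (intro card_mono) auto
        moreover have "card X = Suc (card (X - {x}))" using fin \<open>x \<in> X\<close> by (metis card_Suc_Diff1)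
        ultimately show ?thesis by simp
      qed
      ultimately show ?thesis
        using insert.hyps by (simp add: biased_insert)
    qed
  qed
qed

lemma biased_le_1:
  assumes "finite V" "0 \<le> p" "p \<le> 1"
  shows "biased p V F \<le> 1"
proof -
  have "biased p V F \<le> biased p V {S. S \<inter> {} = {}}"
    by (rule biased_mono) (use assms in auto)
  then show ?thesis using biased_cell[OF assms(1), of "{}" "{}" p] by simp
qed

lemma biased_half:
  assumes "finite V"
  shows "biased (1/2) V F = expect V (\<lambda>S. of_bool (S \<in> F))"
proof -
  have "(1/2::real) ^ card S * (1 - 1/2) ^ (card V - card S) = 1 / 2 ^ card V" if "S \<in> Pow V" for S
  proof -
    have "card S \<le> card V" using that assms by (auto intro: card_mono)
    then have "(1/2::real) ^ card S * (1/2) ^ (card V - card S) = (1/2) ^ card V"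
      by (simp add: power_add[symmetric])
    then show ?thesis by (simp add: power_one_over)
  qed
  then show ?thesis
    unfolding biased_def expect_def sum_divide_distrib by (intro sum.cong) auto
qed

subsection \<open>Interpolation for increasing families\<close>

text \<open>There is equality at a = b, and raising a from there helps because (x + b)^t - x^t is
  nondecreasing in x for t at least 1. The factor p = 2^(-t) turns this into the claim.\<close>

lemma powr_two_point:
  fixes a b t :: real
  assumes "0 \<le> b" "b \<le> a" "1 \<le> t"
  defines "p \<equiv> (1/2) powr t"
  shows "(1 - p) * b powr t + p * a powr t \<le> ((a + b) / 2) powr t"
proof (cases "b = 0")
  case True
  then show ?thesis using assms by (simp add: p_def powr_mult[symmetric])
next
  case False
  then have b: "0 < b" using assms by simp
  have "(b + b) powr t - b powr t \<le> (a + b) powr t - a powr t"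
  proof (rule DERIV_nonneg_imp_nondecreasing[OF assms(2)])
    fix x assume x: "b \<le> x" "x \<le> a"
    have "((\<lambda>x. (x + b) powr t - x powr t) has_real_derivative
        t * (x + b) powr (t - 1) - t * x powr (t - 1)) (at x)"
      using x b by (auto intro!: derivative_eq_intros)
    moreover have "0 \<le> t * (x + b) powr (t - 1) - t * x powr (t - 1)"
      using x b assms(3) by (simp add: powr_mono2 mult_left_mono)
    ultimately show "\<exists>y. ((\<lambda>x. (x + b) powr t - x powr t) has_real_derivative y) (at x) \<and> 0 \<le> y"
      by blast
  qed
  then have "p * ((b + b) powr t - b powr t) \<le> p * ((a + b) powr t - a powr t)"
    by (intro mult_left_mono) (auto simp: p_def)
  moreover have "p * (b + b) powr t = b powr t" "p * (a + b) powr t = ((a + b) / 2) powr t"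
    using b assms by (simp_all add: p_def powr_mult[symmetric])
  ultimately show ?thesis by (simp add: algebra_simps)
qed

text \<open>Induction on the coordinates by the two-point inequality, whose condition b <= a is the
  monotonicity of the family. Umvirates attain equality, so transferring the bound loses
  nothing.\<close>

lemma biased_le_powr:
  fixes t :: real
  assumes "finite V" "\<And>S T. S \<in> F \<Longrightarrow> S \<subseteq> T \<Longrightarrow> T \<subseteq> V \<Longrightarrow> T \<in> F" "1 \<le> t"
  shows "biased ((1/2) powr t) V F \<le> biased (1/2) V F powr t"
  using assms(1,2)
proof (induction V arbitrary: F rule: finite_induct)
  case empty
  show ?case unfolding biased_def Pow_empty by (cases "{} \<in> F") simp_all
next
  case (insert x V)
  let ?p = "(1/2::real) powr t" and ?F = "{S. insert x S \<in> F}"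
  define a where "a = biased (1/2) V ?F"
  define b where "b = biased (1/2) V F"
  have p: "0 \<le> ?p" "?p \<le> 1" using assms(3) by (auto intro: powr_le1)
  have IH: "biased ?p V F \<le> b powr t" "biased ?p V ?F \<le> a powr t"
    unfolding a_def b_def
  proof (rule insert.IH, goal_cases)
    case (1 S T)
    then show ?case using insert.prems[of S T] by auto
  next
    show "biased ?p V ?F \<le> biased (1/2) V ?F powr t"
    proof (rule insert.IH)
      fix S T assume "S \<in> ?F" "S \<subseteq> T" "T \<subseteq> V"
      then show "T \<in> ?F" using insert.prems[of "insert x S" "insert x T"] by auto
    qed
  qed
  have "b \<le> a"
    unfolding a_def b_def
  proof (rule biased_mono)
    fix S assume "S \<subseteq> V" "S \<in> F"
    then show "S \<in> ?F" using insert.prems[of S "insert x S"] by auto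
  qed simp_all
  moreover have "0 \<le> b" by (simp add: b_def biased_nonneg)
  ultimately have two: "(1 - ?p) * b powr t + ?p * a powr t \<le> ((a + b) / 2) powr t"
    using assms(3) by (intro powr_two_point)
  have half: "biased (1/2) (insert x V) F = (a + b) / 2"
    unfolding biased_insert[OF insert.hyps] a_def b_def by simp
  have "biased ?p (insert x V) F \<le> (1 - ?p) * b powr t + ?p * a powr t"
    unfolding biased_insert[OF insert.hyps] using IH p by (intro add_mono mult_left_mono) auto
  then show ?case unfolding half using two by (rule order_trans)
qed

lemma powr_one_plus_le:
  fixes x t :: real
  assumes "0 \<le> x" "x \<le> 1" "1 \<le> t"
  shows "(1 + x) powr t \<le> 1 + (2 powr t - 1) * x"
proof -
  have "((1 - x) *\<^sub>R 1 + x *\<^sub>R 2) powr t \<le> (1 - x) * 1 powr t + x * 2 powr t"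
    by (rule convex_onD[OF powr_convex[OF assms(3)]]) (use assms in auto)
  then show ?thesis by (simp add: algebra_simps)
qed

subsection \<open>Stability\<close>

text \<open>The defect is at most 256 \<epsilon>, and \<open>exists_heavy_triple\<close> wants it
  below 1 / 10^12 after multiplication by \<open>coordinate_sets\<^sup>2\<close>. With this constant
  that holds unless the claimed bound is at least 1.\<close>

definition stability_constant :: real where
  "stability_constant = 256 * 10 ^ 12 * coordinate_sets\<^sup>2"

lemma stability_constant_ge: "256 * 10 ^ 12 \<le> stability_constant"
proof -
  have "1 \<le> coordinate_sets\<^sup>2" by (rule one_le_power[OF coordinate_sets_ge_1])
  then show ?thesis unfolding stability_constant_def by simp
qed

definition cell :: "nat \<Rightarrow> vec2 set \<Rightarrow> vec2 set \<Rightarrow> vec2 set set" where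
  "cell n X B = {S. S \<subseteq> Z2n n \<and> S \<inter> X = B}"

lemma cell_subset: "cell n X B \<subseteq> Pow (Z2n n)"
  by (auto simp: cell_def)

lemma biased_cell_triple:
  assumes "schur_triple n X" "B \<subseteq> X"
  shows "biased p (Z2n n) (cell n X B) = p ^ card B * (1 - p) ^ (3 - card B)"
proof -
  have "biased p (Z2n n) (cell n X B) = biased p (Z2n n) {S. S \<inter> X = B}"
    by (rule biased_cong) (auto simp: cell_def)
  then show ?thesis
    using biased_cell[OF finite_Z2n schur_triple_props(2)[OF assms(1)] assms(2)]
      schur_triple_props(1)[OF assms(1)] by simp
qed

lemma biased_half_cell_triple:
  assumes "schur_triple n X" "B \<subseteq> X"
  shows "biased (1/2) (Z2n n) (cell n X B) = 1 / 8"
proof -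
  have "finite X" using schur_triple_props(1)[OF assms(1)] card.infinite by force
  then have "card B \<le> 3" using card_mono[OF _ assms(2)] schur_triple_props(1)[OF assms(1)] by simp
  then have "(1/2::real) ^ card B * (1/2) ^ (3 - card B) = (1/2) ^ 3"
    by (simp add: power_add[symmetric])
  then show ?thesis using biased_cell_triple[OF assms, of "1/2"] by (simp add: power3_eq_cube)
qed

lemma biased_half_Int_cell:
  assumes "schur_triple n X" "B \<subseteq> X"
  shows "biased (1/2) (Z2n n) (cell n X B \<inter> F)
    = expect (Z2n n - X) (\<lambda>U. of_bool (B \<union> U \<in> F)) / 8"
proof -
  let ?V = "Z2n n"
  note X = schur_triple_props[OF assms(1)]
  have "card ?V = card (?V - X) + 3"
    using X card_Diff_subset[OF finite_subset[OF X(2) finite_Z2n] X(2)] card_mono[OF finite_Z2n X(2)] by simp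
  then have c: "(2::real) ^ card ?V = 2 ^ card (?V - X) * 8" by (simp add: power_add)
  have "(\<Sum>S\<in>Pow ?V. of_bool (S \<in> cell n X B \<inter> F) :: real)
      = (\<Sum>S\<in>{S. S \<subseteq> ?V \<and> S \<inter> X = B}. of_bool (S \<in> F))"
  proof -
    have "(\<Sum>S\<in>Pow ?V. of_bool (S \<in> cell n X B \<inter> F) :: real)
        = (\<Sum>S\<in>Pow ?V. if S \<inter> X = B then of_bool (S \<in> F) else 0)"
      by (rule sum.cong) (auto simp: cell_def)
    then show ?thesis by (simp only: sum_if_Pow[OF finite_Z2n])
  qed
  also have "\<dots> = (\<Sum>U\<in>Pow (?V - X). of_bool (B \<union> U \<in> F))"
  proof (rule sum.reindex_bij_betw[symmetric])
    show "bij_betw (\<lambda>U. B \<union> U) (Pow (?V - X)) {S. S \<subseteq> ?V \<and> S \<inter> X = B}"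
      by (rule bij_betwI[where g = "\<lambda>S. S - X"]) (use assms X in auto)
  qed
  finally show ?thesis
    unfolding biased_half[OF finite_Z2n] expect_def c by simp
qed

lemma exists_schur_triple:
  assumes "2 \<le> n"
  obtains X where "schur_triple n X"
proof -
  let ?x = "(\<lambda>i. if i = 0 then 1 else 0) :: vec2" and ?y = "(\<lambda>i. if i = 1 then 1 else 0) :: vec2"
  have "?x \<noteq> ?y"
  proof
    assume "?x = ?y"
    then have "?x 0 = ?y 0" by (rule fun_cong)
    then show False by simp
  qed
  moreover have "?x \<noteq> 0"
  proof
    assume "?x = 0"
    then have "?x 0 = (0::vec2) 0" by (rule fun_cong)
    then show False by simp
  qed
  moreover have "?y \<noteq> 0"
  proof
    assume "?y = 0"
    then have "?y 1 = (0::vec2) 1" by (rule fun_cong)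
    then show False by simp
  qed
  moreover have "?x \<in> Z2n n" "?y \<in> Z2n n" using assms by (auto simp: Z2n_def)
  ultimately show thesis using schur_tripleI[of ?x n ?y] that by blast
qed

context agreeing
begin

lemma density_eq_biased: "density = biased (1/2) V F"
  unfolding density_def biased_half[OF finite_V] ind_def ..

end

lemma agreeing_bound:
  assumes "odd_linear_dependency_agreeing n F"
  shows "biased (1/2) (Z2n n) F \<le> 1 / 8"
proof -
  interpret agreeing n F by unfold_locales (rule assms)
  show ?thesis using density_le by (simp add: density_eq_biased)
qed

lemma agreeing_stability:
  assumes n: "2 \<le> n" and F: "odd_linear_dependency_agreeing n F"
    and eps: "0 < \<epsilon>" "1 / 8 - \<epsilon> \<le> biased (1/2) (Z2n n) F"
  obtains X B where "schur_triple n X" "B \<subseteq> X"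
    "biased (1/2) (Z2n n) (sym_diff (cell n X B) F) \<le> stability_constant * \<epsilon>"
proof (cases "1 \<le> stability_constant * \<epsilon>")
  case True
  obtain X where X: "schur_triple n X" by (rule exists_schur_triple[OF n])
  have "biased (1/2) (Z2n n) (sym_diff (cell n X {}) F) \<le> 1"
    by (rule biased_le_1) (simp_all add: finite_Z2n)
  then show ?thesis using True X that[of X "{}"] by simp
next
  case False
  interpret agreeing n F by unfold_locales (rule F)
  have "256 * 10 ^ 12 * \<epsilon> \<le> stability_constant * \<epsilon>"
    using stability_constant_ge eps(1) by (intro mult_right_mono) auto
  then have e: "256 * 10 ^ 12 * \<epsilon> < 1" using False by simp
  then have lower: "1 / 16 \<le> density" using eps by (simp add: density_eq_biased)
  have "density * (1 - 8 * density) \<le> 1 / 8 * (8 * \<epsilon>)"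
    using eps density_le density_nonneg
    by (intro mult_mono) (auto simp: density_eq_biased)
  then have d: "defect \<le> 256 * \<epsilon>" using defect_le by simp
  then have "defect * coordinate_sets\<^sup>2 \<le> 256 * \<epsilon> * coordinate_sets\<^sup>2"
    by (intro mult_right_mono) auto
  also have "\<dots> = stability_constant * \<epsilon> / 10 ^ 12"
    by (simp add: stability_constant_def)
  also have "\<dots> \<le> 1 / 10 ^ 12" using False by (intro divide_right_mono) auto
  finally obtain X B where XB: "schur_triple n X" "B \<subseteq> X"
    "1 - 32 * defect \<le> expect (V - X) (\<lambda>U. ind (B \<union> U))"
    using density_cell[OF lower] by blast
  let ?T = "cell n X B"
  have "biased (1/2) V (?T \<inter> F) \<ge> (1 - 32 * defect) / 8"
    unfolding biased_half_Int_cell[OF XB(1,2)] using XB(3) by (simp add: ind_def)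
  \<comment> \<open>Both measures are at most 1/8 and the intersection is subtracted twice: 1/4 - (1
    - 32 defect)/4 = 8 defect.\<close>
  then have "biased (1/2) V (sym_diff ?T F) \<le> 8 * defect"
    using biased_sym_diff[of "1/2" V ?T F] biased_Un_Int[of "1/2" V ?T F] density_le
      biased_half_cell_triple[OF XB(1,2)]
    by (simp add: density_eq_biased)
  also have "\<dots> \<le> 256 * 10 ^ 12 * \<epsilon>" using d eps(1) by simp
  also have "\<dots> \<le> stability_constant * \<epsilon>" by fact
  finally show ?thesis using that XB(1,2) by blast
qed

definition up_closure :: "nat \<Rightarrow> vec2 set set \<Rightarrow> vec2 set set" where
  "up_closure n F = {T. T \<subseteq> Z2n n \<and> (\<exists>S\<in>F. S \<subseteq> T)}"

lemma up_closure_increasing: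
  "S \<in> up_closure n F \<Longrightarrow> S \<subseteq> T \<Longrightarrow> T \<subseteq> Z2n n \<Longrightarrow> T \<in> up_closure n F"
  unfolding up_closure_def by blast

lemma has_odd_linear_dependency_mono:
  assumes "has_odd_linear_dependency A" "A \<subseteq> B"
  shows "has_odd_linear_dependency B"
proof -
  obtain l :: nat and v where "\<forall>i\<in>{1..2 * l + 1}. v i \<in> A \<and> v i \<noteq> 0" "(\<Sum>i = 1..2 * l + 1. v i) = 0"
    using assms(1) unfolding has_odd_linear_dependency_def by blast
  then show ?thesis using assms(2) unfolding has_odd_linear_dependency_def by blast
qed

text \<open>Two sets agree on their intersection, and passing to supersets only enlarges it.\<close>

lemma agreeing_up_closure:
  assumes "odd_linear_dependency_intersecting n F"
  shows "odd_linear_dependency_agreeing n (up_closure n F)"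
  unfolding odd_linear_dependency_agreeing_def
proof (intro conjI ballI)
  show "up_closure n F \<subseteq> Pow (Z2n n)" by (auto simp: up_closure_def)
  fix S T assume "S \<in> up_closure n F" "T \<in> up_closure n F"
  then obtain S' T' where "S' \<in> F" "S' \<subseteq> S" "T' \<in> F" "T' \<subseteq> T" "S \<subseteq> Z2n n"
    by (auto simp: up_closure_def)
  moreover from this have "has_odd_linear_dependency (S' \<inter> T')"
    using assms unfolding odd_linear_dependency_intersecting_def by blast
  ultimately show "has_odd_linear_dependency (Z2n n - sym_diff S T)"
    by (elim has_odd_linear_dependency_mono) blast
qed

section \<open>Intersecting families at bias p\<close>

context
  fixes n :: nat and p :: real and F :: "vec2 set set" and t :: real
  assumes n: "2 \<le> n" and p: "0 < p" "p \<le> 1 / 2"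
    and F: "odd_linear_dependency_intersecting n F"
  defines "t \<equiv> log 2 (1 / p)"
begin

lemma F_subset_up_closure: "F \<subseteq> up_closure n F" and F_subset_Pow: "F \<subseteq> Pow (Z2n n)"
  using F by (auto simp: odd_linear_dependency_intersecting_def up_closure_def)

lemma t_ge_1: "1 \<le> t"
proof -
  have "log 2 2 \<le> log 2 (1 / p)" using p by (subst log_le_cancel_iff) (auto simp: field_simps)
  then show ?thesis by (simp add: t_def)
qed

lemma powr_t: "2 powr t = 1 / p" "(1/2) powr t = p" "(1/8) powr t = p ^ 3"
proof -
  show a: "2 powr t = 1 / p" using p by (simp add: t_def)
  show b: "(1/2) powr t = p" using a p by (simp add: powr_divide)
  have "(1/8) powr t = (1/2 * (1/2) * (1/2)) powr t" by simp
  also have "\<dots> = p ^ 3" unfolding powr_mult b by (simp add: power3_eq_cube)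
  finally show "(1/8) powr t = p ^ 3" .
qed

lemma biased_p_le_powr:
  assumes "\<And>S T. S \<in> G \<Longrightarrow> S \<subseteq> T \<Longrightarrow> T \<subseteq> Z2n n \<Longrightarrow> T \<in> G"
  shows "biased p (Z2n n) G \<le> biased (1/2) (Z2n n) G powr t"
  using biased_le_powr[OF finite_Z2n _ t_ge_1, of G n] assms unfolding powr_t by blast

lemma intersecting_bound: "biased p (Z2n n) F \<le> p ^ 3"
proof -
  let ?G = "up_closure n F"
  have "biased p (Z2n n) F \<le> biased p (Z2n n) ?G"
    by (rule biased_mono) (use p F_subset_up_closure in auto)
  also have "\<dots> \<le> biased (1/2) (Z2n n) ?G powr t"
    by (rule biased_p_le_powr) (rule up_closure_increasing)
  also have "\<dots> \<le> (1/8) powr t"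
    using agreeing_bound[OF agreeing_up_closure[OF F]] t_ge_1
    by (intro powr_mono2) (auto intro: biased_nonneg)
  finally show ?thesis unfolding powr_t .
qed

text \<open>
  Raising a set by an element of \<open>X - B\<close> maps \<open>cell n X B \<inter> G\<close> injectively into \<open>G - cell n X B\<close>,
  so an increasing family cannot be close to a junta that is not an umvirate.
\<close>

lemma increasing_near_cell:
  assumes "schur_triple n X" "B \<subseteq> X"
    and close: "biased (1/2) (Z2n n) (sym_diff (cell n X B) (up_closure n F)) < 1 / 16"
  shows "B = X"
proof (rule ccontr)
  let ?V = "Z2n n" and ?T = "cell n X B" and ?G = "up_closure n F"
  assume "B \<noteq> X"
  then obtain x where x: "x \<in> X" "x \<notin> B" using assms(2) by auto
  have half: "biased (1/2) ?V A = real (card A) / 2 ^ card ?V" if "A \<subseteq> Pow ?V" for A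
  proof -
    have "(\<Sum>S\<in>Pow ?V. of_bool (S \<in> A) :: real) = (\<Sum>S\<in>Pow ?V. if S \<in> A then 1 else 0)"
      by (rule sum.cong) auto
    also have "\<dots> = (\<Sum>S\<in>{S. S \<subseteq> ?V \<and> S \<in> A}. 1)" by (rule sum_if_Pow[OF finite_Z2n])
    also have "{S. S \<subseteq> ?V \<and> S \<in> A} = A" using that by auto
    finally show ?thesis unfolding biased_half[OF finite_Z2n] expect_def by simp
  qed
  have sub: "?T \<inter> ?G \<subseteq> Pow ?V" "?G - ?T \<subseteq> Pow ?V" by (auto simp: cell_def up_closure_def)
  have "card (?T \<inter> ?G) \<le> card (?G - ?T)"
  proof (rule card_inj_on_le)
    have "x \<notin> S" if "S \<in> ?T" for S using that x by (auto simp: cell_def)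
    then show "inj_on (insert x) (?T \<inter> ?G)" by (intro inj_onI) (metis IntD1 insert_ident)
    show "insert x ` (?T \<inter> ?G) \<subseteq> ?G - ?T"
      using x schur_triple_props(2)[OF assms(1)] by (auto simp: cell_def up_closure_def)
    show "finite (?G - ?T)" using sub finite_family_Z2n by blast
  qed
  then have "biased (1/2) ?V (?T \<inter> ?G) \<le> biased (1/2) ?V (?G - ?T)"
    unfolding half[OF sub(1)] half[OF sub(2)] by (intro divide_right_mono) auto
  also have "\<dots> \<le> biased (1/2) ?V (sym_diff ?T ?G)" by (rule biased_mono) auto
  finally have a: "biased (1/2) ?V (?T \<inter> ?G) < 1 / 16" using close by simp
  \<comment> \<open>The union is the symmetric difference plus the intersection, both below 1/16,
    yet it contains a cell of measure 1/8.\<close>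
  have "biased (1/2) ?V ?T \<le> biased (1/2) ?V (?T \<union> ?G)" by (rule biased_mono) auto
  then show False
    using a close biased_half_cell_triple[OF assms(1,2)] biased_sym_diff[of "1/2" ?V ?T ?G] by simp
qed

text \<open>A symmetric difference is not an increasing family, so its measure cannot be carried
  from 1/2 to p. It equals twice the union minus the two measures, and the union is bounded through
  its increasing enlargement by \<open>up_closure n F\<close>.\<close>

lemma intersecting_stability:
  assumes eps: "0 < \<epsilon>" "p ^ 3 - \<epsilon> \<le> biased p (Z2n n) F"
  obtains X where "schur_triple n X"
    "biased p (Z2n n) (sym_diff (cell n X X) F) \<le> (2 * stability_constant / p ^ 3 + 1) * \<epsilon>"
proof -
  let ?V = "Z2n n" and ?G = "up_closure n F"
  define D where "D = stability_constant * (\<epsilon> / (8 * p ^ 3))"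
  have p01: "0 \<le> p" "p \<le> 1" using p by auto
  have p3: "0 < p ^ 3" using p by simp
  have D0: "0 \<le> D" using stability_constant_ge eps p3 by (simp add: D_def)
  have const: "16 * D + \<epsilon> = (2 * stability_constant / p ^ 3 + 1) * \<epsilon>"
    using p3 by (simp add: D_def field_simps)
  define m where "m = biased (1/2) ?V ?G"
  have m: "0 \<le> m" "m \<le> 1 / 8"
    using agreeing_bound[OF agreeing_up_closure[OF F]] by (auto simp: m_def intro: biased_nonneg)
  have "biased p ?V F \<le> biased p ?V ?G"
    by (rule biased_mono) (use p01 F_subset_up_closure in auto)
  also have "\<dots> \<le> m powr t"
    unfolding m_def by (rule biased_p_le_powr) (rule up_closure_increasing)
  finally have "p ^ 3 - \<epsilon> \<le> m powr t" using eps by simp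
  also have "m powr t = p ^ 3 * (8 * m) powr t"
    using m powr_mult[of "1/8" "8 * m" t] by (simp add: powr_t)
  \<comment> \<open>The base 8m is at most 1 and the exponent at least 1, so the power is at most
    the base; this keeps the loss at bias 1/2 linear in \<epsilon>.\<close>
  also have "\<dots> \<le> p ^ 3 * (8 * m)"
  proof (rule mult_left_mono)
    show "(8 * m) powr t \<le> 8 * m"
    proof (cases "m = 0")
      case False
      then show ?thesis using m t_ge_1 powr_mono'[of 1 t "8 * m"] by simp
    qed simp
  qed (use p3 in simp)
  finally have "1 / 8 - \<epsilon> / (8 * p ^ 3) \<le> m" using p3 by (simp add: field_simps)
  then obtain X B where XB: "schur_triple n X" "B \<subseteq> X" "biased (1/2) ?V (sym_diff (cell n X B) ?G) \<le> D"
    using agreeing_stability[OF n agreeing_up_closure[OF F], of "\<epsilon> / (8 * p ^ 3)"] eps(1) p3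
    unfolding m_def D_def by (metis zero_less_divide_iff zero_less_mult_iff zero_less_numeral)
  show thesis
  \<comment> \<open>If 16 D < 1, the cell is an umvirate and 8 D is small enough for the chord bound
    \<open>powr_one_plus_le\<close>; otherwise the claimed bound exceeds 1.\<close>
  proof (cases "1 \<le> 16 * D")
    case True
    have "biased p ?V (sym_diff (cell n X X) F) \<le> 1" by (rule biased_le_1) (use p01 finite_Z2n in auto)
    also have "\<dots> \<le> 16 * D + \<epsilon>" using True eps by simp
    finally show thesis using that XB(1) unfolding const by blast
  next
    case False
    then have "B = X" using increasing_near_cell[OF XB(1,2)] XB(3) by simp
    let ?T = "cell n X X"
    have close: "biased (1/2) ?V (sym_diff ?T ?G) \<le> D" using XB(3) \<open>B = X\<close> by simp
    have T: "biased (1/2) ?V ?T = 1 / 8" "biased p ?V ?T = p ^ 3"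
      using biased_half_cell_triple[OF XB(1)] biased_cell_triple[OF XB(1), of X p]
        schur_triple_props(1)[OF XB(1)] by auto
    have "biased (1/2) ?V (?T \<inter> ?G) \<le> biased (1/2) ?V ?T" by (rule biased_mono) auto
    then have un: "biased (1/2) ?V (?T \<union> ?G) \<le> 1 / 8 + D"
      using biased_sym_diff[of "1/2" ?V ?T ?G] close T by simp
    have "biased p ?V (?T \<union> ?G) \<le> biased (1/2) ?V (?T \<union> ?G) powr t"
    proof (rule biased_p_le_powr)
      fix A A' assume A: "A \<in> ?T \<union> ?G" "A \<subseteq> A'" "A' \<subseteq> ?V"
      from A(1) show "A' \<in> ?T \<union> ?G"
      proof
        assume "A \<in> ?T"
        then have "A' \<in> ?T" using A by (auto simp: cell_def)
        then show ?thesis ..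
      next
        assume "A \<in> ?G"
        then have "A' \<in> ?G" using A(2,3) by (rule up_closure_increasing)
        then show ?thesis ..
      qed
    qed
    also have "\<dots> \<le> (1 / 8 + D) powr t"
      using un t_ge_1 by (intro powr_mono2) (auto intro: biased_nonneg)
    also have "\<dots> = p ^ 3 * (1 + 8 * D) powr t"
      using D0 powr_mult[of "1/8" "1 + 8 * D" t] by (simp add: powr_t algebra_simps)
    also have "\<dots> \<le> p ^ 3 * (1 + (2 powr t - 1) * (8 * D))"
      using p3 False D0 t_ge_1 by (intro mult_left_mono powr_one_plus_le) auto
    also have "\<dots> = p ^ 3 + (p\<^sup>2 * (1 - p)) * (8 * D)"
      using p by (simp add: powr_t field_simps power2_eq_square power3_eq_cube)
    also have "\<dots> \<le> p ^ 3 + 1 * (8 * D)"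
      using p01 D0 by (intro add_left_mono mult_right_mono mult_le_one) (auto simp: power_le_one)
    finally have unp: "biased p ?V (?T \<union> ?G) \<le> p ^ 3 + 8 * D" by simp
    have "biased p ?V (?T \<union> F) \<le> biased p ?V (?T \<union> ?G)"
      by (rule biased_mono) (use p01 F_subset_up_closure in auto)
    then have "biased p ?V (sym_diff ?T F) \<le> 16 * D + \<epsilon>"
      using biased_sym_diff[of p ?V ?T F] biased_Un_Int[of p ?V ?T F] unp T eps by simp
    then show thesis using that XB(1) unfolding const by blast
  qed
qed

end

subsection \<open>Equality from stability\<close>

text \<open>For p at most 1/2, no single set weighs less than the full ground set.\<close>

lemma biased_small_imp_empty:
  assumes "finite V" "0 < p" "p \<le> 1 / 2" "F \<subseteq> Pow V" "biased p V F < p ^ card V"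
  shows "F = {}"
proof (rule ccontr)
  assume "F \<noteq> {}"
  then obtain S where S: "S \<in> F" "S \<subseteq> V" using assms(4) by blast
  have "card S \<le> card V" using S assms(1) by (intro card_mono)
  then have "p ^ card V = p ^ card S * p ^ (card V - card S)" by (simp add: power_add[symmetric])
  also have "\<dots> \<le> p ^ card S * (1 - p) ^ (card V - card S)"
    using assms by (intro mult_left_mono power_mono) auto
  also have "\<dots> = (if S \<in> F then p ^ card S * (1 - p) ^ (card V - card S) else 0)" using S by simp
  also have "\<dots> \<le> biased p V F"
    unfolding biased_def by (rule member_le_sum) (use S assms in auto)
  finally show False using assms(5) by simp
qed

text \<open>The cell may vary with \<epsilon>, so one \<epsilon> is fixed for which the symmetric
  difference weighs less than any single set.\<close>

lemma eq_if_arbitrarily_close: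
  assumes p: "0 < p" "p \<le> 1 / 2" and F: "F \<subseteq> Pow (Z2n n)"
    and close: "\<And>\<epsilon>. 0 < \<epsilon> \<Longrightarrow> \<exists>X B. P X B \<and> biased p (Z2n n) (sym_diff (cell n X B) F) \<le> c * \<epsilon>"
  obtains X B where "P X B" "F = cell n X B"
proof -
  define \<epsilon> where "\<epsilon> = p ^ card (Z2n n) / (2 * (\<bar>c\<bar> + 1))"
  have "0 < \<epsilon>" using p by (simp add: \<epsilon>_def)
  then obtain X B where XB: "P X B" "biased p (Z2n n) (sym_diff (cell n X B) F) \<le> c * \<epsilon>"
    using close by blast
  have "c * \<epsilon> \<le> (\<bar>c\<bar> + 1) * \<epsilon>" using \<open>0 < \<epsilon>\<close> by (intro mult_right_mono) auto
  also have "\<dots> = p ^ card (Z2n n) / 2" by (simp add: \<epsilon>_def field_simps)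
  also have "\<dots> < p ^ card (Z2n n)" using p by simp
  finally have "biased p (Z2n n) (sym_diff (cell n X B) F) < p ^ card (Z2n n)" using XB by simp
  then have "sym_diff (cell n X B) F = {}"
    by (rule biased_small_imp_empty[OF finite_Z2n p, rotated]) (use F cell_subset in blast)
  then show thesis using that XB(1) by blast
qed

lemma schur_umvirate_iff: "schur_umvirate n F \<longleftrightarrow> (\<exists>X. schur_triple n X \<and> F = cell n X X)"
proof -
  have "{S. S \<subseteq> Z2n n \<and> X \<subseteq> S} = cell n X X" for X by (auto simp: cell_def)
  then show ?thesis by (simp add: schur_umvirate_def)
qed

lemma schur_junta_iff: "schur_junta n F \<longleftrightarrow> (\<exists>X B. schur_triple n X \<and> B \<subseteq> X \<and> F = cell n X B)"
  by (simp add: schur_junta_def cell_def)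

theorem theorem1p3:
  shows
    "(\<forall>n\<ge>2. \<forall>p::real. 0 < p \<and> p \<le> 1/2 \<longrightarrow>
        (\<forall>F. odd_linear_dependency_intersecting n F \<longrightarrow>
           mu n p F \<le> p ^ 3 \<and> (mu n p F = p ^ 3 \<longleftrightarrow> schur_umvirate n F))) \<and>
     (\<forall>n\<ge>2. \<forall>F. odd_linear_dependency_agreeing n F \<longrightarrow>
        mu n (1/2) F \<le> 1/8 \<and> (mu n (1/2) F = 1/8 \<longleftrightarrow> schur_junta n F)) \<and>
     (\<exists>c :: real \<Rightarrow> real.
        (\<forall>\<delta>>0. bdd_above (c ` {\<delta>..1/2})) \<and>
        (\<forall>n\<ge>2. \<forall>p::real. 0 < p \<and> p \<le> 1/2 \<longrightarrow>
           (\<forall>F. odd_linear_dependency_intersecting n F \<longrightarrow>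
              (\<forall>\<epsilon>>0. mu n p F \<ge> p ^ 3 - \<epsilon> \<longrightarrow>
                 (\<exists>T. schur_umvirate n T \<and> mu n p (sym_diff T F) \<le> c p * \<epsilon>)))) \<and>
        (\<forall>n\<ge>2. \<forall>F. odd_linear_dependency_agreeing n F \<longrightarrow>
           (\<forall>\<epsilon>>0. mu n (1/2) F \<ge> 1/8 - \<epsilon> \<longrightarrow>
              (\<exists>T. schur_junta n T \<and> mu n (1/2) (sym_diff T F) \<le> c (1/2) * \<epsilon>))))"
proof -
  \<comment> \<open>One function serves both statements: at p = 1/2 it is 16 times
    \<open>stability_constant\<close> plus 1, which dominates the constant for agreeing
    families.\<close>
  define c where "c p = 2 * stability_constant / p ^ 3 + 1" for p :: real
  have C0: "0 < stability_constant" using stability_constant_ge by simp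
  have intersecting: "mu n p F = biased p (Z2n n) F" "F \<subseteq> Pow (Z2n n)"
    "\<And>T. T \<subseteq> Pow (Z2n n) \<Longrightarrow> mu n p (sym_diff T F) = biased p (Z2n n) (sym_diff T F)"
    if "odd_linear_dependency_intersecting n F" for n p F
    using that by (auto simp: odd_linear_dependency_intersecting_def intro!: mu_eq_biased)
  have agreeing: "mu n p F = biased p (Z2n n) F" "F \<subseteq> Pow (Z2n n)"
    "\<And>T. T \<subseteq> Pow (Z2n n) \<Longrightarrow> mu n p (sym_diff T F) = biased p (Z2n n) (sym_diff T F)"
    if "odd_linear_dependency_agreeing n F" for n p F
    using that by (auto simp: odd_linear_dependency_agreeing_def intro!: mu_eq_biased)
  have "mu n p F \<le> p ^ 3 \<and> (mu n p F = p ^ 3 \<longleftrightarrow> schur_umvirate n F)"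
    if n: "2 \<le> n" and p: "0 < p" "p \<le> 1/2" and F: "odd_linear_dependency_intersecting n F" for n p F
  proof (intro conjI iffI)
    show "mu n p F \<le> p ^ 3" using intersecting_bound[OF n p F] intersecting[OF F] by simp
    assume "mu n p F = p ^ 3"
    then have eq: "biased p (Z2n n) F = p ^ 3" using intersecting[OF F] by simp
    have "\<exists>X B. (schur_triple n X \<and> B = X) \<and> biased p (Z2n n) (sym_diff (cell n X B) F) \<le> c p * \<epsilon>"
      if "0 < \<epsilon>" for \<epsilon>
      using intersecting_stability[OF n p F that] eq that unfolding c_def by force
    then obtain X B where "schur_triple n X \<and> B = X" "F = cell n X B"
      by (rule eq_if_arbitrarily_close[OF p intersecting(2)[OF F], where P = "\<lambda>X B. schur_triple n X \<and> B = X"])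
    then show "schur_umvirate n F" by (auto simp: schur_umvirate_iff)
  next
    assume "schur_umvirate n F"
    then obtain X where "schur_triple n X" "F = cell n X X" by (auto simp: schur_umvirate_iff)
    then show "mu n p F = p ^ 3"
      using intersecting(1)[OF F] biased_cell_triple[of n X X p] schur_triple_props(1)[of n X] by simp
  qed
  moreover have "mu n (1/2) F \<le> 1/8 \<and> (mu n (1/2) F = 1/8 \<longleftrightarrow> schur_junta n F)"
    if n: "2 \<le> n" and F: "odd_linear_dependency_agreeing n F" for n F
  proof (intro conjI iffI)
    show "mu n (1/2) F \<le> 1/8" using agreeing_bound[OF F] agreeing[OF F] by simp
    assume "mu n (1/2) F = 1/8"
    then have eq: "biased (1/2) (Z2n n) F = 1/8" using agreeing[OF F] by simp
    have "\<exists>X B. (schur_triple n X \<and> B \<subseteq> X) \<and>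
        biased (1/2) (Z2n n) (sym_diff (cell n X B) F) \<le> stability_constant * \<epsilon>"
      if "0 < \<epsilon>" for \<epsilon>
      using agreeing_stability[OF n F that] eq that by force
    then obtain X B where "schur_triple n X \<and> B \<subseteq> X" "F = cell n X B"
      by (rule eq_if_arbitrarily_close[OF _ _ agreeing(2)[OF F], where P = "\<lambda>X B. schur_triple n X \<and> B \<subseteq> X" and p = "1/2", rotated 2]) simp_all
    then show "schur_junta n F" by (auto simp: schur_junta_iff)
  next
    assume "schur_junta n F"
    then obtain X B where "schur_triple n X" "B \<subseteq> X" "F = cell n X B" by (auto simp: schur_junta_iff)
    then show "mu n (1/2) F = 1/8"
      using agreeing(1)[OF F] biased_half_cell_triple[of n X B] by simp
  qed
  moreover have "bdd_above (c ` {\<delta>..1/2})" if "0 < \<delta>" for \<delta>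
  proof (rule bdd_aboveI2)
    fix p assume "p \<in> {\<delta>..1/2}"
    then have "2 * stability_constant / p ^ 3 \<le> 2 * stability_constant / \<delta> ^ 3"
      using that C0 by (intro divide_left_mono power_mono mult_pos_pos zero_less_power) auto
    then show "c p \<le> c \<delta>" by (simp add: c_def)
  qed
  moreover have "\<exists>T. schur_umvirate n T \<and> mu n p (sym_diff T F) \<le> c p * \<epsilon>"
    if n: "2 \<le> n" and p: "0 < p" "p \<le> 1/2" and F: "odd_linear_dependency_intersecting n F"
      and eps: "0 < \<epsilon>" "p ^ 3 - \<epsilon> \<le> mu n p F" for n p F \<epsilon>
  proof -
    obtain X where "schur_triple n X" "biased p (Z2n n) (sym_diff (cell n X X) F) \<le> c p * \<epsilon>"
      using intersecting_stability[OF n p F eps(1)] eps(2) intersecting(1)[OF F] unfolding c_def by auto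
    then show ?thesis using intersecting(3)[OF F cell_subset] schur_umvirate_iff by metis
  qed
  moreover have "\<exists>T. schur_junta n T \<and> mu n (1/2) (sym_diff T F) \<le> c (1/2) * \<epsilon>"
    if n: "2 \<le> n" and F: "odd_linear_dependency_agreeing n F"
      and eps: "0 < \<epsilon>" "1/8 - \<epsilon> \<le> mu n (1/2) F" for n F \<epsilon>
  proof -
    obtain X B where XB: "schur_triple n X" "B \<subseteq> X"
      "biased (1/2) (Z2n n) (sym_diff (cell n X B) F) \<le> stability_constant * \<epsilon>"
      using agreeing_stability[OF n F eps(1)] eps(2) agreeing(1)[OF F] by auto
    have "stability_constant \<le> c (1/2)" using C0 by (simp add: c_def power3_eq_cube)
    then have "stability_constant * \<epsilon> \<le> c (1/2) * \<epsilon>" using eps(1) by (intro mult_right_mono) auto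
    then have "mu n (1/2) (sym_diff (cell n X B) F) \<le> c (1/2) * \<epsilon>"
      using XB(3) agreeing(3)[OF F cell_subset] by simp
    then show ?thesis using XB(1,2) schur_junta_iff by blast
  qed
  ultimately show ?thesis by (intro conjI exI[of _ c]) (blast+)
qed

end
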